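(* Let $E$ be a row-finite graph, $K$ a field, $L=L_K(E)$ the Leavitt path algebra of $E$ over $K$, and $A=\mathrm{End}(L_L)$ the ring of endomorphisms of $L$ considered as a right $L$-module. Then the following are equivalent: (i) $A$ is von Neumann regular. (ii) $E$ is acyclic and every infinite path in $E$ ends in a sink. (iii) $L$ is both left and right self-injective and von Neumann regular. (iv) $L$ is a semisimple right $L$-module.
   Context: A (directed) graph $E=(E^0,E^1,r,s)$ consists of sets $E^0$ (vertices), $E^1$ (edges) and maps $r,s:E^1\to E^0$. It is row-finite if $s^{-1}(v)$ is finite for every $v\in E^0$. A vertex $v$ is a sink if $s^{-1}(v)=\emptyset$, and is regular if $0\neq|s^{-1}(v)|<\infty$. A path is a finite sequence of edges $e_1\cdots e_n$ with $r(e_i)=s(e_{i+1})$; vertices are paths of length $0$. A cycle is a path $e_1\cdots e_n$ ($n\ge1$) with $r(e_n)=s(e_1)$ and $s(e_i)\ne s(e_j)$ for $i\neq j$; $E$ is acyclic if it has no cycles. For a vertex $v$, $T(v)$ is the set of vertices $w$ such that there is a path from $v$ to $w$. There is a bifurcation at $v$ if $|s^{-1}(v)|\ge 2$. A vertex $v$ is a line point if $T(v)$ contains no bifurcations and no vertices lying on cycles. An infinite path is $e_1e_2e_3\cdots$ with $e_i\in E^1$, $r(e_i)=s(e_{i+1})$ for all $i$; it ends in a sink if there is $i$ such that $s(e_i)$ is a line point (so an infinite path that eventually has no bifurcations and no cycles counts as ending in a sink). The Leavitt path algebra $L_K(E)$ is the $K$-algebra generated by a set $\{v: v\in E^0\}$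 of pairwise orthogonal idempotents together with $\{e,e^*:e\in E^1\}$ subject to: (1) $s(e)e=e=er(e)$; (2) $r(e)e^*=e^*=e^*s(e)$; (3) $e^*e=r(e)$ and $e^*f=0$ for edges $e\ne f$; (4) $v=\sum_{s(e)=v}ee^*$ for every regular vertex $v$. It is in general non-unital, but has local units (finite sums of distinct vertices). A ring $R$ is von Neumann regular if for every $a\in R$ there is $b\in R$ with $a=aba$. $L$ is left (right) self-injective if it is injective as a left (right) $L$-module, in the category of left (right) $L$-modules $M$ with $LM=M$ (resp. $ML=M$). *)

theory Defs
  imports
    "Graph_Theory.Arc_Walk"
    "HOL-Algebra.QuotRing"
    "HOL-Algebra.Module"
    "HOL-Algebra.Generated_Groups"
    "HOL-Library.Poly_Mapping"
begin

section \<open>Graphs\<close>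

text \<open>
  A directed graph is a \<^const>\<open>wf_digraph\<close>: parallel arcs and loops are allowed, the sets of
  vertices and arcs may be infinite or empty, \<^const>\<open>tail\<close> is the source map and \<^const>\<open>head\<close>
  the range map.  Paths and cycles are \<^const>\<open>pre_digraph.awalk\<close> and \<^const>\<open>pre_digraph.cycle\<close>.
\<close>

definition row_finite :: "('v, 'e) pre_digraph \<Rightarrow> bool" where
  "row_finite E \<longleftrightarrow> (\<forall>v \<in> verts E. finite (out_arcs E v))"

definition regular_vertex :: "('v, 'e) pre_digraph \<Rightarrow> 'v \<Rightarrow> bool" where
  "regular_vertex E v \<longleftrightarrow> v \<in> verts E \<and> out_arcs E v \<noteq> {} \<and> finite (out_arcs E v)"

definition acyclic_graph :: "('v, 'e) pre_digraph \<Rightarrow> bool" where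
  "acyclic_graph E \<longleftrightarrow> (\<nexists>p. pre_digraph.cycle E p)"

definition tree :: "('v, 'e) pre_digraph \<Rightarrow> 'v \<Rightarrow> 'v set" where
  "tree E v = {w. \<exists>p. pre_digraph.awalk E v p w}"

definition bifurcation :: "('v, 'e) pre_digraph \<Rightarrow> 'v \<Rightarrow> bool" where
  "bifurcation E v \<longleftrightarrow> (\<exists>e \<in> out_arcs E v. \<exists>f \<in> out_arcs E v. e \<noteq> f)"

definition on_cycle :: "('v, 'e) pre_digraph \<Rightarrow> 'v \<Rightarrow> bool" where
  "on_cycle E v \<longleftrightarrow> (\<exists>p. pre_digraph.cycle E p \<and> v \<in> tail E ` set p)"

definition line_point :: "('v, 'e) pre_digraph \<Rightarrow> 'v \<Rightarrow> bool" where
  "line_point E v \<longleftrightarrow> v \<in> verts E \<and> (\<forall>w \<in> tree E v. \<not> bifurcation E w \<and> \<not> on_cycle E w)"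

definition infinite_path :: "('v, 'e) pre_digraph \<Rightarrow> (nat \<Rightarrow> 'e) \<Rightarrow> bool" where
  "infinite_path E p \<longleftrightarrow> (\<forall>i. p i \<in> arcs E \<and> head E (p i) = tail E (p (Suc i)))"

definition ends_in_sink :: "('v, 'e) pre_digraph \<Rightarrow> (nat \<Rightarrow> 'e) \<Rightarrow> bool" where
  "ends_in_sink E p \<longleftrightarrow> (\<exists>i. line_point E (tail E (p i)))"


section \<open>Leavitt path algebras\<close>

text \<open>
  Words under concatenation, written additively so that the convolution product of
  finitely supported functions on words is the multiplication of the free unital algebra.
\<close>

datatype 'x free_word = Word (letters: "'x list")

instantiation free_word :: (type) monoid_add
begin

definition zero_free_word :: "'a free_word" where
  "0 = Word []"

definition plus_free_word :: "'a free_word \<Rightarrow> 'a free_word \<Rightarrow> 'a free_word" where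
  "u + w = Word (letters u @ letters w)"

instance
  by standard (simp_all add: zero_free_word_def plus_free_word_def)

end

datatype ('v, 'e) lpa_gen = Vertex 'v | Edge 'e | Ghost 'e

type_synonym ('v, 'e, 'k) lpa_free = "('v, 'e) lpa_gen free_word \<Rightarrow>\<^sub>0 'k"

type_synonym ('v, 'e, 'k) lpa_elem = "('v, 'e, 'k) lpa_free set"

definition lpa_gens :: "('v, 'e) pre_digraph \<Rightarrow> ('v, 'e) lpa_gen set" where
  "lpa_gens E = Vertex ` verts E \<union> Edge ` arcs E \<union> Ghost ` arcs E"

definition vx :: "'v \<Rightarrow> ('v, 'e, 'k::field) lpa_free" where
  "vx v = Poly_Mapping.single (Word [Vertex v]) 1"

definition ed :: "'e \<Rightarrow> ('v, 'e, 'k::field) lpa_free" where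
  "ed e = Poly_Mapping.single (Word [Edge e]) 1"

definition gh :: "'e \<Rightarrow> ('v, 'e, 'k::field) lpa_free" where
  "gh e = Poly_Mapping.single (Word [Ghost e]) 1"

definition free_algebra :: "('v, 'e) pre_digraph \<Rightarrow> ('v, 'e, 'k::field) lpa_free ring" where
  "free_algebra E =
    \<lparr>carrier = {p. \<forall>w \<in> Poly_Mapping.keys p. set (letters w) \<subseteq> lpa_gens E},
     mult = (*), one = 1, zero = 0, add = (+)\<rparr>"

text \<open>The free non-unital algebra: linear combinations of non-empty words.\<close>

definition free_nonunital :: "('v, 'e) pre_digraph \<Rightarrow> ('v, 'e, 'k::field) lpa_free set" where
  "free_nonunital E = {p \<in> carrier (free_algebra E). Poly_Mapping.lookup p (Word []) = 0}"

definition lpa_relations :: "('v, 'e) pre_digraph \<Rightarrow> ('v, 'e, 'k::field) lpa_free set" where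
  "lpa_relations E =
     {vx v * vx v - vx v | v. v \<in> verts E} \<union>
     {vx v * vx w | v w. v \<in> verts E \<and> w \<in> verts E \<and> v \<noteq> w} \<union>
     {vx (tail E e) * ed e - ed e | e. e \<in> arcs E} \<union>
     {ed e * vx (head E e) - ed e | e. e \<in> arcs E} \<union>
     {vx (head E e) * gh e - gh e | e. e \<in> arcs E} \<union>
     {gh e * vx (tail E e) - gh e | e. e \<in> arcs E} \<union>
     {gh e * ed e - vx (head E e) | e. e \<in> arcs E} \<union>
     {gh e * ed f | e f. e \<in> arcs E \<and> f \<in> arcs E \<and> e \<noteq> f} \<union>
     {vx v - (\<Sum>e \<in> out_arcs E v. ed e * gh e) | v. regular_vertex E v}"

definition lpa_ideal :: "('v, 'e) pre_digraph \<Rightarrow> ('v, 'e, 'k::field) lpa_free set" where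
  "lpa_ideal E = Idl\<^bsub>free_algebra E\<^esub> (lpa_relations E)"

text \<open>
  The image of the free non-unital algebra in the quotient of the free unital algebra.  The
  relations have no constant term, so the ideal they generate in the unital algebra is contained
  in \<^const>\<open>free_nonunital\<close> and is also the algebra ideal they generate there.  The algebra is in
  general not unital: the field \<^const>\<open>one\<close> of this record (the unit of the ambient quotient) does
  not lie in the carrier, and no notion below refers to it.
\<close>

definition leavitt_path_algebra ::
    "('v, 'e) pre_digraph \<Rightarrow> ('v, 'e, 'k::field) lpa_elem ring" where
  "leavitt_path_algebra E =
     (free_algebra E Quot lpa_ideal E)
       \<lparr>carrier := (\<lambda>p. lpa_ideal E +>\<^bsub>free_algebra E\<^esub> p) ` free_nonunital E\<rparr>"


section \<open>Modules over rings without unit\<close>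

text \<open>
  Below, \<^term>\<open>R\<close> is an associative ring that need not have a unit.  A left module is a
  \<^typ>\<open>('a, 'm) module\<close> record of which the fields \<^const>\<open>mult\<close> and \<^const>\<open>one\<close> are ignored.
  A right \<^term>\<open>R\<close>-module is a left module over the opposite ring, with \<^const>\<open>smult\<close> applied
  to \<^term>\<open>a\<close> and \<^term>\<open>x\<close> standing for the right action of \<^term>\<open>a\<close> on \<^term>\<open>x\<close>.
\<close>

definition opp_ring :: "('a, 'x) ring_scheme \<Rightarrow> 'a ring" where
  "opp_ring R =
    \<lparr>carrier = carrier R, mult = (\<lambda>a b. b \<otimes>\<^bsub>R\<^esub> a), one = \<one>\<^bsub>R\<^esub>, zero = \<zero>\<^bsub>R\<^esub>, add = add R\<rparr>"

definition regular_module :: "('a, 'x) ring_scheme \<Rightarrow> ('a, 'a) module" where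
  "regular_module R =
    \<lparr>carrier = carrier R, mult = mult R, one = \<one>\<^bsub>R\<^esub>, zero = \<zero>\<^bsub>R\<^esub>, add = add R, smult = mult R\<rparr>"

definition left_regular_module :: "('a, 'x) ring_scheme \<Rightarrow> ('a, 'a) module" where
  "left_regular_module R = regular_module R"

text \<open>The ring as a right module over itself, hence as a module over \<^term>\<open>opp_ring R\<close>.\<close>

definition right_regular_module :: "('a, 'x) ring_scheme \<Rightarrow> ('a, 'a) module" where
  "right_regular_module R = regular_module (opp_ring R)"

locale nonunital_module = M?: abelian_group M
  for R :: "('a, 'x) ring_scheme" and M :: "('a, 'm, 'y) module_scheme" (structure) +
  assumes smult_in_carrier: "\<lbrakk>a \<in> carrier R; x \<in> carrier M\<rbrakk> \<Longrightarrow> a \<odot> x \<in> carrier M"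
    and smult_add_left: "\<lbrakk>a \<in> carrier R; b \<in> carrier R; x \<in> carrier M\<rbrakk>
      \<Longrightarrow> (a \<oplus>\<^bsub>R\<^esub> b) \<odot> x = a \<odot> x \<oplus> b \<odot> x"
    and smult_add_right: "\<lbrakk>a \<in> carrier R; x \<in> carrier M; y \<in> carrier M\<rbrakk>
      \<Longrightarrow> a \<odot> (x \<oplus> y) = a \<odot> x \<oplus> a \<odot> y"
    and smult_mult: "\<lbrakk>a \<in> carrier R; b \<in> carrier R; x \<in> carrier M\<rbrakk>
      \<Longrightarrow> (a \<otimes>\<^bsub>R\<^esub> b) \<odot> x = a \<odot> (b \<odot> x)"

text \<open>The modules \<open>M\<close> with \<open>RM = M\<close>, where \<open>RM\<close> is the additive group generated by all \<open>ax\<close>.\<close>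

definition unitary_module :: "('a, 'x) ring_scheme \<Rightarrow> ('a, 'm) module \<Rightarrow> bool" where
  "unitary_module R M \<longleftrightarrow> nonunital_module R M \<and>
     generate (add_monoid M) {a \<odot>\<^bsub>M\<^esub> x | a x. a \<in> carrier R \<and> x \<in> carrier M} = carrier M"

definition mod_homs ::
    "('a, 'x) ring_scheme \<Rightarrow> ('a, 'm) module \<Rightarrow> ('a, 'n) module \<Rightarrow> ('m \<Rightarrow> 'n) set" where
  "mod_homs R M N =
    {f \<in> extensional (carrier M). f \<in> hom (add_monoid M) (add_monoid N) \<and>
       (\<forall>a \<in> carrier R. \<forall>x \<in> carrier M. f (a \<odot>\<^bsub>M\<^esub> x) = a \<odot>\<^bsub>N\<^esub> f x)}"

definition endo_ring :: "('a, 'x) ring_scheme \<Rightarrow> ('a, 'm) module \<Rightarrow> ('m \<Rightarrow> 'm) ring" where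
  "endo_ring R M =
    \<lparr>carrier = mod_homs R M M,
     mult = (\<lambda>f g. compose (carrier M) f g),
     one = (\<lambda>x \<in> carrier M. x),
     zero = (\<lambda>x \<in> carrier M. \<zero>\<^bsub>M\<^esub>),
     add = (\<lambda>f g. \<lambda>x \<in> carrier M. f x \<oplus>\<^bsub>M\<^esub> g x)\<rparr>"

text \<open>
  Injectivity in the category of modules \<open>M\<close> with \<open>RM = M\<close>.  The test modules have their elements
  in the type \<^typ>\<open>'a + 'm\<close>, where \<^typ>\<open>'a\<close> is the element type of \<^term>\<open>R\<close> and \<^typ>\<open>'m\<close> is
  arbitrary.  The summand \<^typ>\<open>'a\<close> guarantees that all submodules of the regular module occur
  among the test modules, whatever \<^typ>\<open>'m\<close> is.
\<close>

definition injective_module ::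
    "'m itself \<Rightarrow> ('a, 'x) ring_scheme \<Rightarrow> ('a, 'q) module \<Rightarrow> bool" where
  "injective_module _ R Q \<longleftrightarrow> unitary_module R Q \<and>
     (\<forall>(M :: ('a, 'a + 'm) module) (N :: ('a, 'a + 'm) module).
        unitary_module R M \<longrightarrow> unitary_module R N \<longrightarrow>
        (\<forall>f \<in> mod_homs R M N. inj_on f (carrier M) \<longrightarrow>
          (\<forall>g \<in> mod_homs R M Q. \<exists>h \<in> mod_homs R N Q. \<forall>x \<in> carrier M. h (f x) = g x)))"

definition left_self_injective :: "'m itself \<Rightarrow> ('a, 'x) ring_scheme \<Rightarrow> bool" where
  "left_self_injective U R \<longleftrightarrow> injective_module U R (left_regular_module R)"

definition right_self_injective :: "'m itself \<Rightarrow> ('a, 'x) ring_scheme \<Rightarrow> bool" where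
  "right_self_injective U R \<longleftrightarrow> injective_module U (opp_ring R) (right_regular_module R)"

definition von_neumann_regular :: "('a, 'x) ring_scheme \<Rightarrow> bool" where
  "von_neumann_regular R \<longleftrightarrow>
     (\<forall>a \<in> carrier R. \<exists>b \<in> carrier R. a = a \<otimes>\<^bsub>R\<^esub> b \<otimes>\<^bsub>R\<^esub> a)"

definition simple_submodule :: "('a, 'x) ring_scheme \<Rightarrow> ('a, 'm) module \<Rightarrow> 'm set \<Rightarrow> bool" where
  "simple_submodule R M S \<longleftrightarrow> submodule S R M \<and>
     (\<exists>a \<in> carrier R. \<exists>x \<in> S. a \<odot>\<^bsub>M\<^esub> x \<noteq> \<zero>\<^bsub>M\<^esub>) \<and>
     (\<forall>H. submodule H R M \<longrightarrow> H \<subseteq> S \<longrightarrow> H = {\<zero>\<^bsub>M\<^esub>} \<or> H = S)"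

text \<open>
  A module is semisimple if it is the internal direct sum of a family of simple submodules.
  The subgroup generated by a union of submodules is their sum.
\<close>

definition semisimple_module :: "('a, 'x) ring_scheme \<Rightarrow> ('a, 'm) module \<Rightarrow> bool" where
  "semisimple_module R M \<longleftrightarrow>
     (\<exists>\<S>. (\<forall>S \<in> \<S>. simple_submodule R M S) \<and>
          generate (add_monoid M) (\<Union>\<S>) = carrier M \<and>
          (\<forall>S \<in> \<S>. S \<inter> generate (add_monoid M) (\<Union>(\<S> - {S})) = {\<zero>\<^bsub>M\<^esub>}))"

end

theory Submission
  imports Defs
begin

text \<open>
  If \<open>E\<close> is acyclic and every infinite path ends in a sink, then by well-founded recursion every
  vertex is a finite sum of idempotents \<open>a a*\<close>, where \<open>a\<close> is a path ending in a line point; each of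
  these generates a minimal one-sided ideal, on either side.  Hence all unitary modules are sums of
  minimal submodules, and Zorn's lemma yields complements; semisimplicity, self-injectivity and
  regularity of endomorphism rings all follow.

  Conversely, regularity of \<open>A\<close> passes to \<open>L\<close>, and a cycle \<open>c\<close> at \<open>v\<close> would give the
  non-regular element \<open>v - c\<close>.  If an infinite path \<open>p\<close> does not end in a sink, infinitely many
  edges \<open>f\<^sub>i\<close> leave it, at distinct vertices \<open>v\<^sub>i\<close>; the paths \<open>g\<^sub>i\<close> that leave \<open>p\<close> along \<open>f\<^sub>i\<close> give
  infinitely many orthogonal idempotents \<open>g\<^sub>i g\<^sub>i*\<close> in \<open>v\<^sub>0 L v\<^sub>0\<close>.  The infinite sums
  \<open>\<Sum> g\<^sub>i f\<^sub>i*\<close> and \<open>\<Sum> f\<^sub>i g\<^sub>i*\<close> define homomorphisms of right modules, on \<open>L\<close> and on a right ideal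
  of \<open>L\<close> respectively.  The first is not a regular element of \<open>A\<close>, and the second does not extend
  to \<open>L\<close>.
\<close>

section \<open>Modules over rings without unit\<close>

text \<open>The relations are stable under the involution exchanging \<open>e\<close> and
  \<open>e*\<close>, so ideals at line points are computed on one side only. The converse needs
  certain elements to be nonzero, which a presentation by generators and relations does not show by
  itself; hence a concrete representation, whose integer grading also handles \<open>v - c\<close>.
  For an infinite path the obstacle is that the infinite sums are not elements of \<open>L\<close>.
  Every element of \<open>L\<close> is annihilated from the left by all but finitely many vertices,
  and \<open>g_i f_i* = g_i f_i* v_i\<close> with distinct \<open>v_i\<close>; so the first sum is
  finite on each element. The terms of the second satisfy \<open>f_i g_i* = f_i g_i* v_0\<close>,
  and no such argument applies: it is taken only on the right ideal where its partial sums
  stabilise. Both contradictions arise because a homomorphism of right modules is determined on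
  \<open>v_0 L\<close> by its value at \<open>v_0\<close>, a single element of \<open>L\<close>,
  which would have to account for infinitely many indices.\<close>

context nonunital_module
begin

abbreviation span :: "'m set \<Rightarrow> 'm set" where
  "span X \<equiv> generate (add_monoid M) X"

lemma smult_zero_right: "a \<in> carrier R \<Longrightarrow> a \<odot> \<zero> = \<zero>"
  using smult_add_right[of a \<zero> \<zero>] smult_in_carrier[of a \<zero>] M.add.r_cancel_one' by fastforce

lemma smult_minus_right:
  assumes "a \<in> carrier R" "x \<in> carrier M"
  shows "a \<odot> (\<ominus> x) = \<ominus> (a \<odot> x)"
proof -
  have "a \<odot> (\<ominus> x) \<oplus> a \<odot> x = \<zero>"
    using smult_add_right[of a "\<ominus> x" x] assms smult_zero_right by (simp add: M.l_neg)
  then show ?thesis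
    using assms by (simp add: M.minus_equality smult_in_carrier)
qed

lemma submoduleI:
  assumes "H \<subseteq> carrier M" "\<zero> \<in> H" "\<And>x y. \<lbrakk>x \<in> H; y \<in> H\<rbrakk> \<Longrightarrow> x \<oplus> y \<in> H"
    and "\<And>x. x \<in> H \<Longrightarrow> \<ominus> x \<in> H" "\<And>a x. \<lbrakk>a \<in> carrier R; x \<in> H\<rbrakk> \<Longrightarrow> a \<odot> x \<in> H"
  shows "submodule H R M"
proof
  show "\<And>x. x \<in> H \<Longrightarrow> inv\<^bsub>add_monoid M\<^esub> x \<in> H"
    using assms(4) by (simp add: a_inv_def)
qed (use assms in auto)

lemma submoduleD:
  assumes "submodule H R M"
  shows "H \<subseteq> carrier M" "\<zero> \<in> H" "\<And>x y. \<lbrakk>x \<in> H; y \<in> H\<rbrakk> \<Longrightarrow> x \<oplus> y \<in> H"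
    and "\<And>x. x \<in> H \<Longrightarrow> \<ominus> x \<in> H" "\<And>a x. \<lbrakk>a \<in> carrier R; x \<in> H\<rbrakk> \<Longrightarrow> a \<odot> x \<in> H"
    and "\<And>x y. \<lbrakk>x \<in> H; y \<in> H\<rbrakk> \<Longrightarrow> x \<ominus> y \<in> H"
proof -
  interpret submodule H R M by fact
  show "H \<subseteq> carrier M" "\<zero> \<in> H" using subset one_closed by auto
  show *: "\<And>x y. \<lbrakk>x \<in> H; y \<in> H\<rbrakk> \<Longrightarrow> x \<oplus> y \<in> H" using m_closed by auto
  show **: "\<And>x. x \<in> H \<Longrightarrow> \<ominus> x \<in> H" using m_inv_closed by (auto simp: a_inv_def)
  show "\<And>a x. \<lbrakk>a \<in> carrier R; x \<in> H\<rbrakk> \<Longrightarrow> a \<odot> x \<in> H" using smult_closed by auto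
  show "\<And>x y. \<lbrakk>x \<in> H; y \<in> H\<rbrakk> \<Longrightarrow> x \<ominus> y \<in> H" using * ** by (auto simp: a_minus_def)
qed

lemma submodule_zero: "submodule {\<zero>} R M"
  by (rule submoduleI) (auto simp: smult_zero_right)

lemma submodule_Int:
  assumes "submodule H R M" "submodule K R M"
  shows "submodule (H \<inter> K) R M"
  using submoduleD[OF assms(1)] submoduleD[OF assms(2)] by (intro submoduleI) auto

lemma zero_in_span: "\<zero> \<in> span X"
  using generate.one[of "add_monoid M" X] by simp

lemma span_minimal:
  assumes "submodule H R M" "X \<subseteq> H"
  shows "span X \<subseteq> H"
  using M.add.generate_subgroup_incl[OF assms(2)] assms(1) unfolding submodule_def by blast

lemma span_submodule:
  assumes "Y \<subseteq> carrier M" "\<And>a y. \<lbrakk>a \<in> carrier R; y \<in> Y\<rbrakk> \<Longrightarrow> a \<odot> y \<in> Y"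
  shows "submodule (span Y) R M"
proof -
  have "a \<odot> y \<in> span Y" if "y \<in> span Y" "a \<in> carrier R" for a y
    using that
  proof (induction rule: generate.induct)
    case one
    then show ?case using zero_in_span by (simp add: smult_zero_right)
  next
    case (incl h)
    then show ?case using assms(2) by (auto intro: generate.incl)
  next
    case (inv h)
    then show ?case
      using assms generate.inv[of "a \<odot> h" Y "add_monoid M"] smult_minus_right[of a h]
      by (auto simp: a_inv_def)
  next
    case (eng h1 h2)
    then have "h1 \<in> carrier M" "h2 \<in> carrier M"
      using M.add.generate_in_carrier[OF assms(1)] by auto
    with eng show ?case
      using generate.eng[of "a \<odot> h1" "add_monoid M" Y "a \<odot> h2"] by (simp add: smult_add_right)
  qed
  then show ?thesis
    using M.add.generate_is_subgroup[OF assms(1)]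
    by (simp add: submodule_def submodule_axioms_def)
qed

lemma span_Union_submodule:
  assumes "\<And>S. S \<in> \<S> \<Longrightarrow> submodule S R M"
  shows "submodule (span (\<Union>\<S>)) R M"
  using submoduleD(1,5)[OF assms] by (intro span_submodule) blast+

lemma span_Un_decompose:
  assumes "submodule T R M" "Y \<subseteq> carrier M" "x \<in> span (T \<union> Y)"
  shows "\<exists>t \<in> T. \<exists>z \<in> span Y. x = t \<oplus> z"
  using assms(3)
proof (induction rule: generate.induct)
  note T = submoduleD[OF assms(1)]
  have z: "\<zero> \<in> span Y" using zero_in_span by simp
  {
    case one
    show ?case using T(2) z by (metis M.l_zero M.zero_closed monoid.select_convs(2))
  next
    case (incl h)
    then show ?case
    proof
      assume "h \<in> T" then show ?thesis using T(1) z by (intro bexI[of _ h] bexI[of _ \<zero>]) auto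
    next
      assume "h \<in> Y" then show ?thesis using T(2) assms(2)
        by (intro bexI[of _ \<zero>] bexI[of _ h]) (auto intro: generate.incl)
    qed
  next
    case (inv h)
    then show ?case
    proof
      assume "h \<in> T" then show ?thesis
        using T(1,4) z by (intro bexI[of _ "\<ominus> h"] bexI[of _ \<zero>]) (auto simp: a_inv_def[symmetric])
    next
      assume "h \<in> Y" then show ?thesis using T(2) assms(2) generate.inv[of h Y "add_monoid M"]
        by (intro bexI[of _ \<zero>] bexI[of _ "\<ominus> h"]) (auto simp: a_inv_def[symmetric])
    qed
  next
    case (eng h1 h2)
    then obtain t1 z1 t2 z2 where *: "t1 \<in> T" "z1 \<in> span Y" "h1 = t1 \<oplus> z1"
      "t2 \<in> T" "z2 \<in> span Y" "h2 = t2 \<oplus> z2" by blast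
    have "z1 \<in> carrier M" "z2 \<in> carrier M" "t1 \<in> carrier M" "t2 \<in> carrier M"
      using * M.add.generate_in_carrier[OF assms(2)] T(1) by auto
    with * have "h1 \<oplus> h2 = (t1 \<oplus> t2) \<oplus> (z1 \<oplus> z2)"
      by (simp add: M.a_ac)
    moreover have "z1 \<oplus> z2 \<in> span Y"
      using generate.eng[of z1 "add_monoid M" Y z2] * by simp
    ultimately show ?case using T(3) * by auto
  }
qed

text \<open>An element of a span involves only finitely many generators, and directedness gathers
  them in one \<open>X k\<close>. This finite character is what makes Zorn's lemma applicable to
  independent families.\<close>

lemma span_directed:
  assumes "x \<in> span (\<Union>i \<in> I. X i)" "I \<noteq> {}"
    and dir: "\<And>i j. \<lbrakk>i \<in> I; j \<in> I\<rbrakk> \<Longrightarrow> \<exists>k \<in> I. X i \<subseteq> X k \<and> X j \<subseteq> X k"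
  shows "\<exists>i \<in> I. x \<in> span (X i)"
  using assms(1)
proof (induction rule: generate.induct)
  case one
  then show ?case using assms(2) zero_in_span by auto
next
  case (incl h)
  then show ?case by (auto intro: generate.incl)
next
  case (inv h)
  then show ?case by (auto intro: generate.inv)
next
  case (eng h1 h2)
  then obtain i j where "i \<in> I" "h1 \<in> span (X i)" "j \<in> I" "h2 \<in> span (X j)" by blast
  moreover with dir[of i j] obtain k where "k \<in> I" "X i \<subseteq> X k" "X j \<subseteq> X k" by auto
  ultimately show ?case
    using M.add.mono_generate[of "X i" "X k"] M.add.mono_generate[of "X j" "X k"]
    by (intro bexI[of _ k] generate.eng) auto
qed

section \<open>Independent families of submodules and complements\<close>

definition minimal_submodule :: "'m set \<Rightarrow> bool" where
  "minimal_submodule T \<longleftrightarrow> submodule T R M \<and>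
     (\<forall>H. submodule H R M \<longrightarrow> H \<subseteq> T \<longrightarrow> H = {\<zero>} \<or> H = T)"

definition independent :: "'m set set \<Rightarrow> bool" where
  "independent \<S> \<longleftrightarrow> (\<forall>S \<in> \<S>. S \<inter> span (\<Union>(\<S> - {S})) = {\<zero>})"

lemma independent_mono:
  assumes "independent \<S>" "\<S>' \<subseteq> \<S>" "\<And>S. S \<in> \<S> \<Longrightarrow> submodule S R M"
  shows "independent \<S>'"
  unfolding independent_def
proof
  fix S assume "S \<in> \<S>'"
  moreover have "span (\<Union>(\<S>' - {S})) \<subseteq> span (\<Union>(\<S> - {S}))"
    using assms(2) by (intro M.add.mono_generate) auto
  moreover have "\<zero> \<in> S" "\<zero> \<in> span (\<Union>(\<S>' - {S}))"
    using submoduleD(2)[OF assms(3)] assms(2) \<open>S \<in> \<S>'\<close> zero_in_span by auto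
  ultimately show "S \<inter> span (\<Union>(\<S>' - {S})) = {\<zero>}"
    using assms(1,2) unfolding independent_def by blast
qed

text \<open>If \<open>x = t + z\<close> lies in \<open>S\<close>, with \<open>t\<close> in
  \<open>T\<close> and \<open>z\<close> in the span of the remaining members, then
  \<open>t = x - z\<close> lies in the span of the old family and vanishes by the hypothesis on
  \<open>T\<close>. Independence of the old family then gives \<open>x = \<zero>\<close>.\<close>

lemma independent_insert:
  assumes ind: "independent \<S>" and sub: "\<And>S. S \<in> \<S> \<Longrightarrow> submodule S R M"
    and T: "submodule T R M" "T \<inter> span (\<Union>\<S>) = {\<zero>}" "T \<notin> \<S>"
  shows "independent (insert T \<S>)"
  unfolding independent_def
proof
  fix S assume "S \<in> insert T \<S>"
  then consider "S = T" | "S \<in> \<S>" "S \<noteq> T" using T(3) by blast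
  then show "S \<inter> span (\<Union>(insert T \<S> - {S})) = {\<zero>}"
  proof cases
    case 1
    then show ?thesis using T by simp
  next
    case 2
    let ?Y = "\<Union>(\<S> - {S})"
    have Y: "?Y \<subseteq> carrier M" and YS: "?Y \<union> S \<subseteq> \<Union>\<S>" and SY: "\<Union>\<S> \<subseteq> carrier M"
      using submoduleD(1)[OF sub] 2 by auto
    have eq: "\<Union>(insert T \<S> - {S}) = T \<union> ?Y" using 2 by auto
    have G: "submodule (span (\<Union>\<S>)) R M" by (rule span_Union_submodule[OF sub])
    have "x = \<zero>" if x: "x \<in> S" "x \<in> span (T \<union> ?Y)" for x
    proof -
      obtain t z where tz: "t \<in> T" "z \<in> span ?Y" "x = t \<oplus> z"
        using span_Un_decompose[OF T(1) Y x(2)] by blast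
      have z: "z \<in> span (\<Union>\<S>)" "z \<in> carrier M"
        using tz(2) M.add.mono_generate[of ?Y "\<Union>\<S>"] M.add.generate_in_carrier[OF Y] YS by auto
      have "x \<in> span (\<Union>\<S>)" using x(1) YS by (auto intro: generate.incl)
      with z have "x \<ominus> z \<in> span (\<Union>\<S>)" using submoduleD(6)[OF G] by blast
      moreover have tc: "t \<in> carrier M" using tz T(1) submoduleD(1) by blast
      then have "x \<ominus> z = t" using tz z
        by (simp add: a_minus_def M.a_assoc M.r_neg)
      ultimately have "t = \<zero>" using T(2) tz by auto
      then have "x = z" using tz z by simp
      then show ?thesis using ind 2 tz x unfolding independent_def by auto
    qed
    moreover have "\<zero> \<in> S" "\<zero> \<in> span (T \<union> ?Y)"
      using submoduleD(2)[OF sub] 2 zero_in_span by auto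
    ultimately show ?thesis unfolding eq by blast
  qed
qed

text \<open>A dependency uses finitely many elements, so it already occurs in one member of the
  chain, which can be enlarged to contain \<open>S\<close>.\<close>

lemma independent_Union_chain:
  assumes chain: "subset.chain UNIV \<C>" "\<C> \<noteq> {}"
    and ind: "\<And>\<S>. \<S> \<in> \<C> \<Longrightarrow> independent \<S>"
    and sub: "\<And>S. S \<in> \<Union>\<C> \<Longrightarrow> submodule S R M"
  shows "independent (\<Union>\<C>)"
  unfolding independent_def
proof
  fix S assume S: "S \<in> \<Union>\<C>"
  then obtain \<S>0 where \<S>0: "S \<in> \<S>0" "\<S>0 \<in> \<C>" by blast
  have cmp: "\<A> \<subseteq> \<B> \<or> \<B> \<subseteq> \<A>" if "\<A> \<in> \<C>" "\<B> \<in> \<C>" for \<A> \<B>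
    using chain(1) that unfolding subset.chain_def by blast
  have "x = \<zero>" if x: "x \<in> S" "x \<in> span (\<Union>(\<Union>\<C> - {S}))" for x
  proof -
    have "\<Union>(\<Union>\<C> - {S}) = (\<Union>\<A>\<in>\<C>. \<Union>(\<A> - {S}))" by auto
    with x(2) have "x \<in> span (\<Union>\<A>\<in>\<C>. \<Union>(\<A> - {S}))" by simp
    then have "\<exists>\<A>\<in>\<C>. x \<in> span (\<Union>(\<A> - {S}))"
    proof (rule span_directed[OF _ chain(2)])
      fix \<A> \<B> assume "\<A> \<in> \<C>" "\<B> \<in> \<C>"
      with cmp[of \<A> \<B>]
      show "\<exists>\<D>\<in>\<C>. \<Union> (\<A> - {S}) \<subseteq> \<Union> (\<D> - {S}) \<and> \<Union> (\<B> - {S}) \<subseteq> \<Union> (\<D> - {S})"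
        by (metis Diff_mono Union_mono order_refl)
    qed
    then obtain \<A> where \<A>: "\<A> \<in> \<C>" "x \<in> span (\<Union>(\<A> - {S}))" by blast
    obtain \<B> where \<B>: "\<B> \<in> \<C>" "\<A> \<subseteq> \<B>" "S \<in> \<B>"
      using cmp[OF \<A>(1) \<S>0(2)] \<S>0 \<A> by blast
    have "x \<in> span (\<Union>(\<B> - {S}))"
      using \<A>(2) M.add.mono_generate[of "\<Union>(\<A> - {S})" "\<Union>(\<B> - {S})"] \<B> by auto
    then show ?thesis using ind[OF \<B>(1)] \<B>(3) x(1) unfolding independent_def by blast
  qed
  moreover have "\<zero> \<in> S" "\<zero> \<in> span (\<Union>(\<Union>\<C> - {S}))"
    using submoduleD(2)[OF sub[OF S]] zero_in_span by auto
  ultimately show "S \<inter> span (\<Union>(\<Union>\<C> - {S})) = {\<zero>}" by blast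
qed

text \<open>A maximal independent family among those containing \<open>H\<close> generates
  everything: a minimal \<open>T\<close> not inside its span meets the span in zero only and could
  be added. \<open>H\<close> is arbitrary, which yields complements; \<open>H = {\<zero>}\<close>
  yields direct decompositions.\<close>

lemma independent_extension:
  assumes min: "\<And>T. T \<in> \<T> \<Longrightarrow> minimal_submodule T" and gen: "span (\<Union>\<T>) = carrier M"
    and H: "submodule H R M"
  obtains \<S> where "H \<in> \<S>" "\<S> \<subseteq> insert H \<T>" "independent \<S>" "span (\<Union>\<S>) = carrier M"
proof -
  define \<Phi> where "\<Phi> = {\<S>. H \<in> \<S> \<and> \<S> \<subseteq> insert H \<T> \<and> independent \<S>}"
  have subH: "\<And>S. S \<in> insert H \<T> \<Longrightarrow> submodule S R M"
    using min H unfolding minimal_submodule_def by blast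
  have "H \<inter> span {} = {\<zero>}"
    using span_minimal[OF submodule_zero, of "{}"] submoduleD(2)[OF H]
      zero_in_span by auto
  then have ne: "{H} \<in> \<Phi>" unfolding \<Phi>_def independent_def by auto
  have "\<exists>\<S>\<in>\<Phi>. \<forall>X\<in>\<Phi>. \<S> \<subseteq> X \<longrightarrow> X = \<S>"
  proof (rule subset_Zorn_nonempty)
    show "\<Phi> \<noteq> {}" using ne by blast
  next
    fix \<C> assume \<C>: "\<C> \<noteq> {}" "subset.chain \<Phi> \<C>"
    then have C\<Phi>: "\<C> \<subseteq> \<Phi>" unfolding subset.chain_def by blast
    have "subset.chain UNIV \<C>" using \<C>(2) unfolding subset.chain_def by blast
    then have "independent (\<Union>\<C>)"
    proof (rule independent_Union_chain)
      show "\<C> \<noteq> {}" by (rule \<C>(1))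
      show "\<And>\<S>. \<S> \<in> \<C> \<Longrightarrow> independent \<S>" using C\<Phi> unfolding \<Phi>_def by blast
      show "\<And>S. S \<in> \<Union>\<C> \<Longrightarrow> submodule S R M" using C\<Phi> subH unfolding \<Phi>_def by blast
    qed
    then show "\<Union>\<C> \<in> \<Phi>" using C\<Phi> \<C>(1) unfolding \<Phi>_def by blast
  qed
  then obtain \<S> where \<S>: "\<S> \<in> \<Phi>" "\<And>X. X \<in> \<Phi> \<Longrightarrow> \<S> \<subseteq> X \<Longrightarrow> X = \<S>" by blast
  then have S1: "H \<in> \<S>" "\<S> \<subseteq> insert H \<T>" "independent \<S>" unfolding \<Phi>_def by auto
  have subS: "\<And>S. S \<in> \<S> \<Longrightarrow> submodule S R M" using S1 subH by blast
  have G: "submodule (span (\<Union>\<S>)) R M" by (rule span_Union_submodule[OF subS])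
  have "T \<subseteq> span (\<Union>\<S>)" if T: "T \<in> \<T>" for T
  proof (rule ccontr)
    assume n: "\<not> T \<subseteq> span (\<Union>\<S>)"
    then have "T \<notin> \<S>" by (blast intro: generate.incl)
    have "T \<inter> span (\<Union>\<S>) = {\<zero>}"
      using submodule_Int[OF subH G, of T] min[OF T] T n unfolding minimal_submodule_def by blast
    then have "independent (insert T \<S>)"
      using independent_insert[OF S1(3) subS] subH T \<open>T \<notin> \<S>\<close> by blast
    then have "insert T \<S> \<in> \<Phi>" using S1 T unfolding \<Phi>_def by blast
    then show False using \<S>(2)[of "insert T \<S>"] \<open>T \<notin> \<S>\<close> by blast
  qed
  then have "carrier M \<subseteq> span (\<Union>\<S>)" using span_minimal[OF G, of "\<Union>\<T>"] gen by blast
  then have "span (\<Union>\<S>) = carrier M" using submoduleD(1)[OF G] by blast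
  then show ?thesis using that S1 by blast
qed

lemma complement:
  assumes "\<And>T. T \<in> \<T> \<Longrightarrow> minimal_submodule T" "span (\<Union>\<T>) = carrier M" "submodule H R M"
  obtains C where "submodule C R M" "H \<inter> C = {\<zero>}"
    "\<And>x. x \<in> carrier M \<Longrightarrow> \<exists>h \<in> H. \<exists>c \<in> C. x = h \<oplus> c"
proof -
  obtain \<S> where S: "H \<in> \<S>" "\<S> \<subseteq> insert H \<T>" "independent \<S>" "span (\<Union>\<S>) = carrier M"
    using independent_extension[OF assms] .
  let ?Y = "\<Union>(\<S> - {H})"
  have sub: "\<And>S. S \<in> \<S> \<Longrightarrow> submodule S R M"
    using S assms unfolding minimal_submodule_def by blast
  have "\<exists>h \<in> H. \<exists>c \<in> span ?Y. x = h \<oplus> c" if "x \<in> carrier M" for x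
  proof (rule span_Un_decompose[OF assms(3)])
    show "?Y \<subseteq> carrier M" using sub submoduleD(1) by blast
    have "H \<union> ?Y = \<Union>\<S>" using S(1) by auto
    then show "x \<in> span (H \<union> ?Y)" using that S(4) by simp
  qed
  moreover have "submodule (span ?Y) R M" using sub by (intro span_Union_submodule) auto
  moreover have "H \<inter> span ?Y = {\<zero>}" using S unfolding independent_def by blast
  ultimately show ?thesis using that by blast
qed

end

section \<open>Homomorphisms, their extension, and regularity of endomorphism rings\<close>

lemma (in abelian_group) minus_eq_zeroD:
  assumes "x \<ominus> y = \<zero>" "x \<in> carrier G" "y \<in> carrier G"
  shows "x = y"
proof -
  have "(x \<ominus> y) \<oplus> y = x" using assms(2,3) by (simp add: a_minus_def a_assoc l_neg)
  then show ?thesis using assms by simp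
qed

lemma mod_homsI:
  assumes "f \<in> extensional (carrier M)" "\<And>x. x \<in> carrier M \<Longrightarrow> f x \<in> carrier N"
    and "\<And>x y. \<lbrakk>x \<in> carrier M; y \<in> carrier M\<rbrakk> \<Longrightarrow> f (x \<oplus>\<^bsub>M\<^esub> y) = f x \<oplus>\<^bsub>N\<^esub> f y"
    and "\<And>a x. \<lbrakk>a \<in> carrier R; x \<in> carrier M\<rbrakk> \<Longrightarrow> f (a \<odot>\<^bsub>M\<^esub> x) = a \<odot>\<^bsub>N\<^esub> f x"
  shows "f \<in> mod_homs R M N"
  using assms unfolding mod_homs_def hom_def by auto

lemma mod_homsD:
  assumes "f \<in> mod_homs R M N"
  shows "f \<in> extensional (carrier M)" "\<And>x. x \<in> carrier M \<Longrightarrow> f x \<in> carrier N"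
    and "\<And>x y. \<lbrakk>x \<in> carrier M; y \<in> carrier M\<rbrakk> \<Longrightarrow> f (x \<oplus>\<^bsub>M\<^esub> y) = f x \<oplus>\<^bsub>N\<^esub> f y"
    and "\<And>a x. \<lbrakk>a \<in> carrier R; x \<in> carrier M\<rbrakk> \<Longrightarrow> f (a \<odot>\<^bsub>M\<^esub> x) = a \<odot>\<^bsub>N\<^esub> f x"
  using assms unfolding mod_homs_def hom_def by auto

lemma mod_homs_zero_minus:
  assumes "nonunital_module R M" "nonunital_module R N" "f \<in> mod_homs R M N"
  shows "f \<zero>\<^bsub>M\<^esub> = \<zero>\<^bsub>N\<^esub>" "\<And>x. x \<in> carrier M \<Longrightarrow> f (\<ominus>\<^bsub>M\<^esub> x) = \<ominus>\<^bsub>N\<^esub> f x"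
proof -
  interpret M: nonunital_module R M by fact
  interpret N: nonunital_module R N by fact
  note f = mod_homsD[OF assms(3)]
  have "f \<zero>\<^bsub>M\<^esub> \<oplus>\<^bsub>N\<^esub> f \<zero>\<^bsub>M\<^esub> = f \<zero>\<^bsub>M\<^esub>" using f(3)[of "\<zero>\<^bsub>M\<^esub>" "\<zero>\<^bsub>M\<^esub>"] by simp
  then show 0: "f \<zero>\<^bsub>M\<^esub> = \<zero>\<^bsub>N\<^esub>" using f(2)[of "\<zero>\<^bsub>M\<^esub>"] N.add.r_cancel_one' by fastforce
  show "f (\<ominus>\<^bsub>M\<^esub> x) = \<ominus>\<^bsub>N\<^esub> f x" if x: "x \<in> carrier M" for x
  proof -
    have "f (\<ominus>\<^bsub>M\<^esub> x) \<oplus>\<^bsub>N\<^esub> f x = \<zero>\<^bsub>N\<^esub>"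
      using f(3)[of "\<ominus>\<^bsub>M\<^esub> x" x] 0 x by (simp add: M.l_neg)
    then show ?thesis using f(2) x by (simp add: N.minus_equality)
  qed
qed

lemma mod_homs_image_submodule:
  assumes M: "nonunital_module R M" and N: "nonunital_module R N" and f: "f \<in> mod_homs R M N"
  shows "submodule (f ` carrier M) R N"
proof -
  interpret M: nonunital_module R M by (rule M)
  interpret N: nonunital_module R N by (rule N)
  note fD = mod_homsD[OF f]
  show ?thesis
  proof (rule N.submoduleI)
    show "f ` carrier M \<subseteq> carrier N" using fD(2) by blast
    show "\<zero>\<^bsub>N\<^esub> \<in> f ` carrier M" using mod_homs_zero_minus(1)[OF M N f] M.zero_closed by force
    show "x \<oplus>\<^bsub>N\<^esub> y \<in> f ` carrier M" if "x \<in> f ` carrier M" "y \<in> f ` carrier M" for x y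
      using that fD(3)[symmetric] M.a_closed by auto
    show "\<ominus>\<^bsub>N\<^esub> x \<in> f ` carrier M" if "x \<in> f ` carrier M" for x
      using that mod_homs_zero_minus(2)[OF M N f, symmetric] by auto
    show "a \<odot>\<^bsub>N\<^esub> x \<in> f ` carrier M" if "a \<in> carrier R" "x \<in> f ` carrier M" for a x
      using that fD(4)[symmetric] M.smult_in_carrier by auto
  qed
qed

lemma mod_homs_kernel_submodule:
  assumes M: "nonunital_module R M" and N: "nonunital_module R N" and f: "f \<in> mod_homs R M N"
  shows "submodule {x \<in> carrier M. f x = \<zero>\<^bsub>N\<^esub>} R M"
proof -
  interpret M: nonunital_module R M by (rule M)
  interpret N: nonunital_module R N by (rule N)
  show ?thesis
    using mod_homsD[OF f] mod_homs_zero_minus[OF M N f]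
    by (intro M.submoduleI) (auto simp: M.smult_in_carrier N.smult_zero_right)
qed

lemma (in nonunital_module) submodule_is_nonunital_module:
  assumes "submodule H R M"
  shows "nonunital_module R (M\<lparr>carrier := H\<rparr>)"
proof -
  note H = submoduleD[OF assms]
  have c: "x \<in> carrier M" if "x \<in> H" for x using that H(1) by blast
  have "abelian_group (M\<lparr>carrier := H\<rparr>)"
  proof (rule abelian_groupI)
    fix x assume "x \<in> carrier (M\<lparr>carrier := H\<rparr>)"
    then show "\<exists>y \<in> carrier (M\<lparr>carrier := H\<rparr>). y \<oplus>\<^bsub>M\<lparr>carrier := H\<rparr>\<^esub> x = \<zero>\<^bsub>M\<lparr>carrier := H\<rparr>\<^esub>"
      using H(4) c by (intro bexI[of _ "\<ominus> x"]) (auto simp: M.l_neg)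
  qed (use H c in \<open>auto simp: M.a_ac\<close>)
  then show ?thesis
    using H c by (simp add: nonunital_module_def nonunital_module_axioms_def
        smult_add_left smult_add_right smult_mult)
qed

text \<open>The image of \<open>f\<close> has a complement \<open>C\<close> in \<open>N\<close>.
  Every element of \<open>N\<close> is \<open>f m\<close> plus an element of \<open>C\<close> with a
  unique \<open>m\<close>, and the extension maps it to \<open>g m\<close>. As the complement is
  taken in \<open>N\<close>, the target \<open>P\<close> may be any module.\<close>

lemma extend_mod_hom:
  assumes M: "nonunital_module R M" and N: "nonunital_module R N" and P: "nonunital_module R P"
    and min: "\<And>T. T \<in> \<T> \<Longrightarrow> nonunital_module.minimal_submodule R N T"
    and gen: "generate (add_monoid N) (\<Union>\<T>) = carrier N"
    and f: "f \<in> mod_homs R M N" "inj_on f (carrier M)" and g: "g \<in> mod_homs R M P"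
  shows "\<exists>h \<in> mod_homs R N P. \<forall>x \<in> carrier M. h (f x) = g x"
proof -
  interpret M: nonunital_module R M by (rule M)
  interpret N: nonunital_module R N by (rule N)
  interpret P: nonunital_module R P by (rule P)
  note fD = mod_homsD[OF f(1)] and gD = mod_homsD[OF g]
  obtain C where C: "submodule C R N" "f ` carrier M \<inter> C = {\<zero>\<^bsub>N\<^esub>}"
    "\<And>x. x \<in> carrier N \<Longrightarrow> \<exists>h \<in> f ` carrier M. \<exists>c \<in> C. x = h \<oplus>\<^bsub>N\<^esub> c"
    using N.complement[OF min gen mod_homs_image_submodule[OF M N f(1)]] by blast
  note CD = N.submoduleD[OF C(1)]
  have Cc: "c \<in> carrier N" if "c \<in> C" for c using that CD(1) by blast
  \<comment> \<open>The projection of \<open>N\<close> onto the image of \<open>f\<close> along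
    \<open>C\<close>, followed by the inverse of \<open>f\<close>.\<close>
  define pr where "pr = (\<lambda>x. THE m. m \<in> carrier M \<and> (\<exists>c \<in> C. x = f m \<oplus>\<^bsub>N\<^esub> c))"
  have uniq: "m = m'"
    if m: "m \<in> carrier M" "m' \<in> carrier M" "c \<in> C" "c' \<in> C" "f m \<oplus>\<^bsub>N\<^esub> c = f m' \<oplus>\<^bsub>N\<^esub> c'" for m m' c c'
  proof -
    have cc: "c \<in> carrier N" "c' \<in> carrier N" "f m \<in> carrier N" "f m' \<in> carrier N"
      using m fD(2) Cc by auto
    have "f m = (f m \<oplus>\<^bsub>N\<^esub> c) \<ominus>\<^bsub>N\<^esub> c"
      using cc by (simp add: a_minus_def N.a_assoc N.r_neg)
    also have "\<dots> = f m' \<oplus>\<^bsub>N\<^esub> (c' \<ominus>\<^bsub>N\<^esub> c)"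
      using cc m(5) by (simp add: a_minus_def N.a_assoc)
    finally have "f m \<ominus>\<^bsub>N\<^esub> f m' = f m' \<oplus>\<^bsub>N\<^esub> (c' \<ominus>\<^bsub>N\<^esub> c) \<ominus>\<^bsub>N\<^esub> f m'" by simp
    also have "\<dots> = c' \<ominus>\<^bsub>N\<^esub> c"
      using cc N.a_comm[of "f m'" "c' \<ominus>\<^bsub>N\<^esub> c"] by (simp add: a_minus_def N.a_assoc N.r_neg)
    finally have eq: "f m \<ominus>\<^bsub>N\<^esub> f m' = c' \<ominus>\<^bsub>N\<^esub> c" .
    have "f (m \<ominus>\<^bsub>M\<^esub> m') = f m \<ominus>\<^bsub>N\<^esub> f m'"
      using m fD(3) mod_homs_zero_minus(2)[OF M N f(1)] by (simp add: a_minus_def)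
    then have "f m \<ominus>\<^bsub>N\<^esub> f m' \<in> f ` carrier M \<inter> C"
      using eq CD(6)[OF m(4,3)] m M.minus_closed by (metis IntI imageI)
    then have "f m \<ominus>\<^bsub>N\<^esub> f m' = \<zero>\<^bsub>N\<^esub>" using C(2) by blast
    then have "f m = f m'" using cc N.minus_eq_zeroD by blast
    then show ?thesis using f(2) m unfolding inj_on_def by blast
  qed
  have pr: "pr (f m \<oplus>\<^bsub>N\<^esub> c) = m" if "m \<in> carrier M" "c \<in> C" for m c
    unfolding pr_def using that uniq by (intro the_equality) blast+
  define h where "h = (\<lambda>x \<in> carrier N. g (pr x))"
  have h: "h (f m \<oplus>\<^bsub>N\<^esub> c) = g m" if "m \<in> carrier M" "c \<in> C" for m c
    unfolding h_def using pr[OF that] that Cc fD(2) by simp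
  have dec: "\<exists>m \<in> carrier M. \<exists>c \<in> C. x = f m \<oplus>\<^bsub>N\<^esub> c" if "x \<in> carrier N" for x
    using C(3)[OF that] by blast
  have "h \<in> mod_homs R N P"
  proof (rule mod_homsI)
    show "h \<in> extensional (carrier N)" unfolding h_def by simp
    show "h x \<in> carrier P" if "x \<in> carrier N" for x
      using dec[OF that] h gD(2) by auto
    show "h (x \<oplus>\<^bsub>N\<^esub> y) = h x \<oplus>\<^bsub>P\<^esub> h y" if xy: "x \<in> carrier N" "y \<in> carrier N" for x y
    proof -
      obtain m c m' c' where *: "m \<in> carrier M" "c \<in> C" "x = f m \<oplus>\<^bsub>N\<^esub> c"
        "m' \<in> carrier M" "c' \<in> C" "y = f m' \<oplus>\<^bsub>N\<^esub> c'"
        using dec[OF xy(1)] dec[OF xy(2)] by blast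
      then have "x \<oplus>\<^bsub>N\<^esub> y = f (m \<oplus>\<^bsub>M\<^esub> m') \<oplus>\<^bsub>N\<^esub> (c \<oplus>\<^bsub>N\<^esub> c')"
        using fD(2,3) Cc by (simp add: N.a_ac)
      then show ?thesis using * h CD(3) gD(3) by simp
    qed
    show "h (a \<odot>\<^bsub>N\<^esub> x) = a \<odot>\<^bsub>P\<^esub> h x" if ax: "a \<in> carrier R" "x \<in> carrier N" for a x
    proof -
      obtain m c where *: "m \<in> carrier M" "c \<in> C" "x = f m \<oplus>\<^bsub>N\<^esub> c"
        using dec[OF ax(2)] by blast
      then have "a \<odot>\<^bsub>N\<^esub> x = f (a \<odot>\<^bsub>M\<^esub> m) \<oplus>\<^bsub>N\<^esub> (a \<odot>\<^bsub>N\<^esub> c)"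
        using fD(2,4) Cc ax by (simp add: N.smult_add_right)
      then show ?thesis using * h CD(5) gD(4) ax M.smult_in_carrier by simp
    qed
  qed
  moreover have "h (f x) = g x" if "x \<in> carrier M" for x
    using h[OF that CD(2)] fD(2)[OF that] by simp
  ultimately show ?thesis by blast
qed

text \<open>On a complement \<open>C\<close> of its kernel, \<open>\<phi>\<close> is injective. The
  inclusion of \<open>C\<close> into \<open>N\<close> therefore extends along the restriction of
  \<open>\<phi>\<close> to an endomorphism \<open>\<psi>\<close>, which inverts
  \<open>\<phi>\<close> on \<open>C\<close>; since \<open>\<phi>\<close> takes all its values on
  \<open>C\<close>, this gives \<open>\<phi> \<psi> \<phi> = \<phi>\<close>.\<close>

lemma endo_ring_von_neumann_regular:
  assumes N: "nonunital_module R N"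
    and min: "\<And>T. T \<in> \<T> \<Longrightarrow> nonunital_module.minimal_submodule R N T"
    and gen: "generate (add_monoid N) (\<Union>\<T>) = carrier N"
  shows "von_neumann_regular (endo_ring R N)"
  unfolding von_neumann_regular_def
proof
  interpret N: nonunital_module R N by (rule N)
  fix \<phi> assume "\<phi> \<in> carrier (endo_ring R N)"
  then have \<phi>: "\<phi> \<in> mod_homs R N N" by (simp add: endo_ring_def)
  note \<phi>D = mod_homsD[OF \<phi>]
  define K where "K = {x \<in> carrier N. \<phi> x = \<zero>\<^bsub>N\<^esub>}"
  have "submodule K R N" unfolding K_def by (rule mod_homs_kernel_submodule[OF N N \<phi>])
  then obtain C where C: "submodule C R N" "K \<inter> C = {\<zero>\<^bsub>N\<^esub>}"
    "\<And>x. x \<in> carrier N \<Longrightarrow> \<exists>h \<in> K. \<exists>c \<in> C. x = h \<oplus>\<^bsub>N\<^esub> c"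
    using N.complement[OF min gen] by blast
  note CD = N.submoduleD[OF C(1)]
  have Cc: "c \<in> carrier N" if "c \<in> C" for c using that CD(1) by blast
  let ?M = "N\<lparr>carrier := C\<rparr>"
  have M: "nonunital_module R ?M" by (rule N.submodule_is_nonunital_module[OF C(1)])
  have f: "restrict \<phi> C \<in> mod_homs R ?M N"
    using \<phi>D Cc CD by (intro mod_homsI) auto
  have g: "restrict (\<lambda>x. x) C \<in> mod_homs R ?M N"
    using Cc CD by (intro mod_homsI) auto
  have "inj_on (restrict \<phi> C) C"
  proof (rule inj_onI)
    fix x y assume xy: "x \<in> C" "y \<in> C" "restrict \<phi> C x = restrict \<phi> C y"
    then have "\<phi> (x \<ominus>\<^bsub>N\<^esub> y) = \<zero>\<^bsub>N\<^esub>"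
      using \<phi>D(2,3) Cc mod_homs_zero_minus(2)[OF N N \<phi>] by (simp add: a_minus_def N.r_neg)
    then have "x \<ominus>\<^bsub>N\<^esub> y = \<zero>\<^bsub>N\<^esub>" using C(2) CD(6) xy Cc unfolding K_def by blast
    then show "x = y" using xy Cc N.minus_eq_zeroD by blast
  qed
  then obtain \<psi> where \<psi>: "\<psi> \<in> mod_homs R N N" "\<And>c. c \<in> C \<Longrightarrow> \<psi> (\<phi> c) = c"
    using extend_mod_hom[OF M N N min gen f _ g] by auto
  have "\<phi> (\<psi> (\<phi> x)) = \<phi> x" if "x \<in> carrier N" for x
  proof -
    obtain k c where "k \<in> K" "c \<in> C" "x = k \<oplus>\<^bsub>N\<^esub> c" using C(3) \<open>x \<in> carrier N\<close> by blast
    then have "\<phi> x = \<phi> c" "\<psi> (\<phi> c) = c" using \<phi>D(2,3) Cc \<psi>(2) unfolding K_def by auto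
    then show ?thesis by simp
  qed
  then have "\<phi> = compose (carrier N) (compose (carrier N) \<phi> \<psi>) \<phi>"
    using \<phi>D(1,2) mod_homsD(2)[OF \<psi>(1)]
    by (intro extensionalityI[OF \<phi>D(1) compose_extensional]) (simp add: compose_def)
  then show "\<exists>b\<in>carrier (endo_ring R N). \<phi> = \<phi> \<otimes>\<^bsub>endo_ring R N\<^esub> b \<otimes>\<^bsub>endo_ring R N\<^esub> \<phi>"
    using \<psi>(1) unfolding endo_ring_def by auto
qed

lemma simple_submodule_minimal:
  assumes "nonunital_module R M" "simple_submodule R M S"
  shows "nonunital_module.minimal_submodule R M S"
  using assms unfolding simple_submodule_def nonunital_module.minimal_submodule_def[OF assms(1)]
  by blast

lemma semisimple_endo_ring_von_neumann_regular:
  assumes "nonunital_module R M" "semisimple_module R M"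
  shows "von_neumann_regular (endo_ring R M)"
  using assms endo_ring_von_neumann_regular[OF assms(1)] simple_submodule_minimal[OF assms(1)]
  unfolding semisimple_module_def by metis

lemma unitary_moduleI:
  assumes M: "nonunital_module R M"
    and div: "\<And>x. x \<in> carrier M \<Longrightarrow> \<exists>a \<in> carrier R. \<exists>y \<in> carrier M. x = a \<odot>\<^bsub>M\<^esub> y"
  shows "unitary_module R M"
proof -
  interpret nonunital_module R M by fact
  have "{a \<odot>\<^bsub>M\<^esub> x |a x. a \<in> carrier R \<and> x \<in> carrier M} = carrier M"
    using div smult_in_carrier by blast
  moreover have "span (carrier M) = carrier M"
    using M.add.generate_incl[of "carrier M"] generate.incl[of _ "carrier M" "add_monoid M"] by auto
  ultimately show ?thesis unfolding unitary_module_def using M by simp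
qed

section \<open>Rings without unit and their regular modules\<close>

locale nonunital_ring = abelian_group R for R (structure) +
  assumes mult_closed: "\<lbrakk>a \<in> carrier R; b \<in> carrier R\<rbrakk> \<Longrightarrow> a \<otimes> b \<in> carrier R"
    and mult_assoc: "\<lbrakk>a \<in> carrier R; b \<in> carrier R; c \<in> carrier R\<rbrakk>
      \<Longrightarrow> (a \<otimes> b) \<otimes> c = a \<otimes> (b \<otimes> c)"
    and mult_add_left: "\<lbrakk>a \<in> carrier R; b \<in> carrier R; c \<in> carrier R\<rbrakk>
      \<Longrightarrow> (a \<oplus> b) \<otimes> c = a \<otimes> c \<oplus> b \<otimes> c"
    and mult_add_right: "\<lbrakk>a \<in> carrier R; b \<in> carrier R; c \<in> carrier R\<rbrakk>
      \<Longrightarrow> a \<otimes> (b \<oplus> c) = a \<otimes> b \<oplus> a \<otimes> c"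
begin

lemma nonunital_ring_opp: "nonunital_ring (opp_ring R)"
proof -
  have "abelian_group (opp_ring R)"
    by (rule abelian_groupI) (auto simp: opp_ring_def a_ac intro: l_neg)
  then show ?thesis
    by (auto simp: nonunital_ring_def nonunital_ring_axioms_def opp_ring_def mult_closed
        mult_assoc mult_add_left mult_add_right)
qed

lemma nonunital_module_regular: "nonunital_module R (regular_module R)"
proof -
  have "abelian_group (regular_module R)"
    by (rule abelian_groupI) (auto simp: regular_module_def a_ac intro: l_neg)
  then show ?thesis
    by (auto simp: nonunital_module_def nonunital_module_axioms_def regular_module_def mult_closed
        mult_assoc mult_add_left mult_add_right)
qed

lemma smult_zero_minus_left:
  assumes "nonunital_module R N" "x \<in> carrier N"
  shows "\<zero> \<odot>\<^bsub>N\<^esub> x = \<zero>\<^bsub>N\<^esub>" "a \<in> carrier R \<Longrightarrow> (\<ominus> a) \<odot>\<^bsub>N\<^esub> x = \<ominus>\<^bsub>N\<^esub> (a \<odot>\<^bsub>N\<^esub> x)"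
proof -
  interpret N: nonunital_module R N by fact
  show 0: "\<zero> \<odot>\<^bsub>N\<^esub> x = \<zero>\<^bsub>N\<^esub>"
    using N.smult_add_left[of \<zero> \<zero> x] N.smult_in_carrier[of \<zero> x] assms(2) N.add.r_cancel_one'
    by fastforce
  assume a: "a \<in> carrier R"
  then have "(\<ominus> a) \<odot>\<^bsub>N\<^esub> x \<oplus>\<^bsub>N\<^esub> a \<odot>\<^bsub>N\<^esub> x = \<zero>\<^bsub>N\<^esub>"
    using N.smult_add_left[of "\<ominus> a" a x] assms(2) 0 by (simp add: l_neg)
  then show "(\<ominus> a) \<odot>\<^bsub>N\<^esub> x = \<ominus>\<^bsub>N\<^esub> (a \<odot>\<^bsub>N\<^esub> x)"
    using a assms(2) by (simp add: N.minus_equality N.smult_in_carrier)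
qed

lemma unitary_regular_module:
  assumes "\<And>a. a \<in> carrier R \<Longrightarrow> \<exists>u \<in> carrier R. u \<otimes> a = a"
  shows "unitary_module R (regular_module R)"
proof (rule unitary_moduleI[OF nonunital_module_regular])
  fix x assume "x \<in> carrier (regular_module R)"
  then have "x \<in> carrier R" by (simp add: regular_module_def)
  moreover with assms obtain u where "u \<in> carrier R" "x = u \<otimes> x" by metis
  ultimately show "\<exists>a \<in> carrier R. \<exists>y \<in> carrier (regular_module R). x = a \<odot>\<^bsub>regular_module R\<^esub> y"
    by (auto simp: regular_module_def)
qed

text \<open>Right multiplication by \<open>a\<close> is an endomorphism \<open>\<phi>\<close> of the
  left regular module, and a local unit \<open>u\<close> of \<open>a\<close> stands in for
  \<open>1\<close>: evaluating \<open>\<phi> = \<phi> \<psi> \<phi>\<close> at \<open>u\<close>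
  gives \<open>a = \<psi>(a) a\<close>, while \<open>\<psi>(a) = \<psi>(a u) = a \<psi>(u)\<close>.
  So \<open>b = \<psi>(u)\<close> works.\<close>

lemma von_neumann_regular_if_endo_ring:
  assumes units: "\<And>a. a \<in> carrier R \<Longrightarrow> \<exists>u \<in> carrier R. u \<otimes> a = a \<and> a \<otimes> u = a"
    and reg: "von_neumann_regular (endo_ring R (regular_module R))"
  shows "von_neumann_regular R"
  unfolding von_neumann_regular_def
proof
  fix a assume a: "a \<in> carrier R"
  then obtain u where u: "u \<in> carrier R" "u \<otimes> a = a" "a \<otimes> u = a" using units by blast
  define \<phi> where "\<phi> = (\<lambda>x \<in> carrier R. x \<otimes> a)"
  have "\<phi> \<in> mod_homs R (regular_module R) (regular_module R)"
    using a by (intro mod_homsI)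
      (auto simp: \<phi>_def regular_module_def mult_closed mult_add_left mult_assoc)
  then obtain \<psi> where \<psi>: "\<psi> \<in> mod_homs R (regular_module R) (regular_module R)"
    "\<phi> = compose (carrier R) (compose (carrier R) \<phi> \<psi>) \<phi>"
    using reg unfolding von_neumann_regular_def endo_ring_def
    by (auto simp: regular_module_def)
  have \<psi>u: "\<psi> u \<in> carrier R" "\<psi> (a \<otimes> u) = a \<otimes> \<psi> u"
    using mod_homsD(2)[OF \<psi>(1), of u] mod_homsD(4)[OF \<psi>(1), of a u] a u(1)
    by (simp_all add: regular_module_def)
  have \<psi>a: "\<psi> a = a \<otimes> \<psi> u" using \<psi>u(2) u(3) by simp
  have \<phi>u: "\<phi> u = a" using u by (simp add: \<phi>_def)
  have "a = compose (carrier R) (compose (carrier R) \<phi> \<psi>) \<phi> u" using \<phi>u \<psi>(2) by metis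
  also have "\<dots> = \<phi> (\<psi> a)" using \<phi>u u(1) a by (simp add: compose_def)
  also have "\<dots> = (a \<otimes> \<psi> u) \<otimes> a"
    using a \<psi>a \<psi>u(1) by (simp add: \<phi>_def mult_closed)
  finally show "\<exists>b \<in> carrier R. a = a \<otimes> b \<otimes> a" using \<psi>u by blast
qed

end

text \<open>
  For \<open>q \<in> Q\<close> and \<open>x\<close> in a module, the submodule generated by \<open>q x\<close> is minimal or zero, and the last
  axiom makes every unitary module the sum of these submodules.
\<close>

locale atomic_ring = nonunital_ring +
  fixes Q :: "'a set"
  assumes Q_carrier: "Q \<subseteq> carrier R"
    and Q_idem: "q \<in> Q \<Longrightarrow> q \<otimes> q = q"
    and Q_atomic: "\<lbrakk>q \<in> Q; r \<in> carrier R\<rbrakk> \<Longrightarrow> r \<otimes> q = \<zero> \<or> (\<exists>s \<in> carrier R. s \<otimes> (r \<otimes> q) = q)"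
    and Q_generate: "carrier R \<subseteq> generate (add_monoid R) {q \<otimes> a |q a. q \<in> Q \<and> a \<in> carrier R}"
begin

definition atoms :: "('a, 'm) module \<Rightarrow> 'm set set" where
  "atoms N = {(\<lambda>r. r \<odot>\<^bsub>N\<^esub> (q \<odot>\<^bsub>N\<^esub> x)) ` carrier R |q x. q \<in> Q \<and> x \<in> carrier N}"

lemma atom_contains:
  assumes "nonunital_module R N" "q \<in> Q" "x \<in> carrier N"
  shows "q \<odot>\<^bsub>N\<^esub> x \<in> (\<lambda>r. r \<odot>\<^bsub>N\<^esub> (q \<odot>\<^bsub>N\<^esub> x)) ` carrier R"
proof -
  interpret N: nonunital_module R N by fact
  show ?thesis
    using assms N.smult_mult[of q q x] Q_idem[of q] Q_carrier by (intro image_eqI[of _ _ q]) auto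
qed

text \<open>A nonzero element of the submodule has the form \<open>h = (r q) x\<close> with
  \<open>r q\<close> nonzero. Then \<open>s (r q) = q\<close> for some \<open>s\<close>, so
  \<open>s h = q x\<close>, and \<open>h\<close> generates the whole submodule.\<close>

lemma atoms_minimal:
  assumes N: "nonunital_module R N" and T: "T \<in> atoms N"
  shows "nonunital_module.minimal_submodule R N T"
proof -
  interpret N: nonunital_module R N by fact
  obtain q x where qx: "q \<in> Q" "x \<in> carrier N" "T = (\<lambda>r. r \<odot>\<^bsub>N\<^esub> (q \<odot>\<^bsub>N\<^esub> x)) ` carrier R"
    using T unfolding atoms_def by blast
  define y where "y = q \<odot>\<^bsub>N\<^esub> x"
  have qc: "q \<in> carrier R" using qx Q_carrier by blast
  have y: "y \<in> carrier N" unfolding y_def using qx qc N.smult_in_carrier by blast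
  have T: "T = (\<lambda>r. r \<odot>\<^bsub>N\<^esub> y) ` carrier R" using qx(3) y_def by simp
  have "submodule T R N"
  proof (rule N.submoduleI)
    show "T \<subseteq> carrier N" unfolding T using y N.smult_in_carrier by blast
    show "\<zero>\<^bsub>N\<^esub> \<in> T" unfolding T using smult_zero_minus_left(1)[OF N y] by (metis imageI zero_closed)
    show "a \<oplus>\<^bsub>N\<^esub> b \<in> T" if "a \<in> T" "b \<in> T" for a b
      using that y N.smult_add_left[symmetric] unfolding T by auto
    show "\<ominus>\<^bsub>N\<^esub> a \<in> T" if "a \<in> T" for a
      using that smult_zero_minus_left(2)[OF N y, symmetric] unfolding T by auto
    show "r \<odot>\<^bsub>N\<^esub> a \<in> T" if "r \<in> carrier R" "a \<in> T" for r a
      using that y N.smult_mult[symmetric] mult_closed unfolding T by auto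
  qed
  moreover have "H = {\<zero>\<^bsub>N\<^esub>} \<or> H = T" if H: "submodule H R N" "H \<subseteq> T" for H
  proof (rule disjCI)
    note HD = N.submoduleD[OF H(1)]
    assume "H \<noteq> T"
    then have nT: "\<not> T \<subseteq> H" using H by blast
    have "h = \<zero>\<^bsub>N\<^esub>" if h: "h \<in> H" for h
    proof -
      obtain r where r: "r \<in> carrier R" "h = r \<odot>\<^bsub>N\<^esub> y" using h H T by blast
      then have hr: "h = (r \<otimes> q) \<odot>\<^bsub>N\<^esub> x" unfolding y_def using qx qc by (simp add: N.smult_mult)
      consider "r \<otimes> q = \<zero>" | s where "s \<in> carrier R" "s \<otimes> (r \<otimes> q) = q"
        using Q_atomic[OF qx(1) r(1)] by blast
      then show ?thesis
      proof cases
        case 1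
        then show ?thesis using hr smult_zero_minus_left(1)[OF N qx(2)] by simp
      next
        case 2
        then have "y = s \<odot>\<^bsub>N\<^esub> h"
          unfolding y_def hr using qx qc r by (simp add: N.smult_mult[symmetric] mult_closed)
        then have "y \<in> H" using HD(5) h 2 by blast
        then have "T \<subseteq> H" unfolding T using HD(5) by blast
        then show ?thesis using nT by blast
      qed
    qed
    then show "H = {\<zero>\<^bsub>N\<^esub>}" using HD(2) by blast
  qed
  ultimately show ?thesis unfolding N.minimal_submodule_def by blast
qed

text \<open>\<open>R N\<close> generates \<open>N\<close>, the products \<open>q a\<close> generate
  \<open>R\<close>, and \<open>(q a) x = q (a x)\<close> lies in an atom.\<close>

lemma atoms_generate:
  assumes N: "unitary_module R N"
  shows "generate (add_monoid N) (\<Union>(atoms N)) = carrier N"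
proof -
  interpret N: nonunital_module R N using N unfolding unitary_module_def by blast
  have Nm: "nonunital_module R N" by unfold_locales
  let ?G = "N.span (\<Union>(atoms N))"
  have G: "submodule ?G R N"
    using atoms_minimal[OF Nm] unfolding N.minimal_submodule_def
    by (intro N.span_Union_submodule) blast
  note GD = N.submoduleD[OF G]
  let ?Y = "{q \<otimes> a |q a. q \<in> Q \<and> a \<in> carrier R}"
  have Y: "?Y \<subseteq> carrier R" using Q_carrier mult_closed by blast
  have qa: "(q \<otimes> a) \<odot>\<^bsub>N\<^esub> x \<in> ?G" if "q \<in> Q" "a \<in> carrier R" "x \<in> carrier N" for q a x
  proof -
    have "(q \<otimes> a) \<odot>\<^bsub>N\<^esub> x = q \<odot>\<^bsub>N\<^esub> (a \<odot>\<^bsub>N\<^esub> x)" using that Q_carrier N.smult_mult by blast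
    moreover have "q \<odot>\<^bsub>N\<^esub> (a \<odot>\<^bsub>N\<^esub> x) \<in> \<Union>(atoms N)"
      using atom_contains[OF Nm \<open>q \<in> Q\<close>, of "a \<odot>\<^bsub>N\<^esub> x"] that N.smult_in_carrier
      unfolding atoms_def by blast
    ultimately show ?thesis by (simp add: generate.incl)
  qed
  have "r \<odot>\<^bsub>N\<^esub> x \<in> ?G" if x: "x \<in> carrier N" and r: "r \<in> generate (add_monoid R) ?Y" for r x
    using r
  proof (induction rule: generate.induct)
    case one
    then show ?case using smult_zero_minus_left(1)[OF Nm x] GD(2) by simp
  next
    case (incl h)
    then show ?case using qa x by blast
  next
    case (inv h)
    then have "h \<in> carrier R" "h \<odot>\<^bsub>N\<^esub> x \<in> ?G" using qa x Y by blast+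
    then show ?case using smult_zero_minus_left(2)[OF Nm x] GD(4)
      by (simp add: a_inv_def[symmetric])
  next
    case (eng h1 h2)
    then have "h1 \<in> carrier R" "h2 \<in> carrier R" using add.generate_in_carrier[OF Y] by auto
    then show ?case using eng GD(3) N.smult_add_left x by simp
  qed
  then have "{r \<odot>\<^bsub>N\<^esub> x |r x. r \<in> carrier R \<and> x \<in> carrier N} \<subseteq> ?G"
    using Q_generate by blast
  then have "N.span {r \<odot>\<^bsub>N\<^esub> x |r x. r \<in> carrier R \<and> x \<in> carrier N} \<subseteq> ?G"
    by (rule N.span_minimal[OF G])
  then have "carrier N \<subseteq> ?G"
    using N unfolding unitary_module_def by simp
  then show ?thesis using GD(1) by blast
qed

text \<open>The zero submodule extends to an independent generating family of atoms and is then
  dropped. A nonzero atom is the image of \<open>r \<mapsto> r (q x)\<close>, so \<open>R\<close>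
  acts nontrivially on it, as \<open>simple_submodule\<close> demands.\<close>

lemma semisimple_if_unitary:
  assumes N: "unitary_module R N"
  shows "semisimple_module R N"
proof -
  interpret N: nonunital_module R N using N unfolding unitary_module_def by blast
  have Nm: "nonunital_module R N" by unfold_locales
  obtain \<S> where S: "{\<zero>\<^bsub>N\<^esub>} \<in> \<S>" "\<S> \<subseteq> insert {\<zero>\<^bsub>N\<^esub>} (atoms N)" "N.independent \<S>"
    "N.span (\<Union>\<S>) = carrier N"
    using N.independent_extension[OF atoms_minimal[OF Nm] atoms_generate[OF N] N.submodule_zero] .
  let ?S = "\<S> - {{\<zero>\<^bsub>N\<^esub>}}"
  have min: "N.minimal_submodule S" if "S \<in> ?S" for S using that S(2) atoms_minimal[OF Nm] by blast
  have sub: "submodule S R N" if "S \<in> \<S>" for S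
    using that min N.submodule_zero unfolding N.minimal_submodule_def by blast
  have "simple_submodule R N S" if S': "S \<in> ?S" for S
  proof -
    obtain q x where qx: "q \<in> Q" "x \<in> carrier N" "S = (\<lambda>r. r \<odot>\<^bsub>N\<^esub> (q \<odot>\<^bsub>N\<^esub> x)) ` carrier R"
      using S' S(2) unfolding atoms_def by blast
    have "q \<odot>\<^bsub>N\<^esub> x \<in> S" using atom_contains[OF Nm qx(1,2)] qx(3) by simp
    moreover have "\<exists>a \<in> carrier R. a \<odot>\<^bsub>N\<^esub> (q \<odot>\<^bsub>N\<^esub> x) \<noteq> \<zero>\<^bsub>N\<^esub>"
      using S' qx(3) N.submoduleD(2)[OF sub, of S] by auto
    ultimately show ?thesis
      using min[OF S'] unfolding simple_submodule_def N.minimal_submodule_def by blast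
  qed
  moreover have "carrier N \<subseteq> N.span (\<Union>?S)"
  proof -
    have "submodule (N.span (\<Union>?S)) R N" using sub by (intro N.span_Union_submodule) auto
    moreover have "\<Union>\<S> \<subseteq> N.span (\<Union>?S)"
      using N.zero_in_span by (auto intro: generate.incl)
    ultimately show ?thesis using N.span_minimal S(4) by blast
  qed
  then have "N.span (\<Union>?S) = carrier N"
    using N.submoduleD(1)[OF N.span_Union_submodule[of ?S]] sub by blast
  moreover have "N.independent ?S" using N.independent_mono[OF S(3) _ sub] by blast
  ultimately show ?thesis
    unfolding semisimple_module_def N.independent_def by blast
qed

text \<open>The complement needed for the extension exists in the test module \<open>N\<close>,
  which is a sum of its atoms because it is unitary.\<close>

lemma injective_if_unitary:
  assumes P: "unitary_module R P"
  shows "injective_module TYPE('m) R P"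
  unfolding injective_module_def
proof (intro conjI allI impI ballI P)
  fix M N :: "('a, 'a + 'm) module" and f g
  assume *: "unitary_module R M" "unitary_module R N" "f \<in> mod_homs R M N"
    "inj_on f (carrier M)" "g \<in> mod_homs R M P"
  show "\<exists>h\<in>mod_homs R N P. \<forall>x\<in>carrier M. h (f x) = g x"
  proof (rule extend_mod_hom[where \<T> = "atoms N"])
    show "\<And>T. T \<in> atoms N \<Longrightarrow> nonunital_module.minimal_submodule R N T"
      using atoms_minimal * unfolding unitary_module_def by blast
    show "generate (add_monoid N) (\<Union> (atoms N)) = carrier N" by (rule atoms_generate[OF *(2)])
  qed (use * P in \<open>auto simp: unitary_module_def\<close>)
qed

end

text \<open>
  Test modules in \<^const>\<open>injective_module\<close> have their elements in a sum type, into which a module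
  over the ring's own type is embedded by \<^const>\<open>Inl\<close>.
\<close>

definition inl_module :: "('a, 'b) module \<Rightarrow> ('a, 'b + 'c) module" where
  "inl_module M = \<lparr>carrier = Inl ` carrier M, mult = (\<lambda>x y. x), one = Inl \<one>\<^bsub>M\<^esub>, zero = Inl \<zero>\<^bsub>M\<^esub>,
     add = (\<lambda>x y. Inl (projl x \<oplus>\<^bsub>M\<^esub> projl y)), smult = (\<lambda>a x. Inl (a \<odot>\<^bsub>M\<^esub> projl x))\<rparr>"

lemma nonunital_module_inl:
  assumes "nonunital_module R M"
  shows "nonunital_module R (inl_module M)"
proof -
  interpret nonunital_module R M by fact
  have "abelian_group (inl_module M)"
  proof (rule abelian_groupI)
    fix x assume "x \<in> carrier (inl_module M)"
    then show "\<exists>y \<in> carrier (inl_module M). y \<oplus>\<^bsub>inl_module M\<^esub> x = \<zero>\<^bsub>inl_module M\<^esub>"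
      by (intro bexI[of _ "Inl (\<ominus>\<^bsub>M\<^esub> projl x)"]) (auto simp: inl_module_def M.l_neg)
  qed (auto simp: inl_module_def M.a_ac)
  then show ?thesis
    by (auto simp: nonunital_module_def nonunital_module_axioms_def inl_module_def smult_in_carrier
        smult_add_left smult_add_right smult_mult)
qed

text \<open>Injectivity in the form used below, for a submodule \<open>D\<close> of
  \<open>N\<close>. The copies of \<open>D\<close> and \<open>N\<close> under \<open>Inl\<close>
  form a test pair, made unitary by \<open>div\<close> and \<open>divN\<close>; the extension is
  carried back along \<open>Inl\<close>.\<close>

lemma injective_module_extend:
  fixes N :: "('a, 'a) module"
  assumes inj: "injective_module TYPE('m) R P" and N: "nonunital_module R N"
    and D: "submodule D R N" and g: "g \<in> mod_homs R (N\<lparr>carrier := D\<rparr>) P"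
    and div: "\<And>x. x \<in> D \<Longrightarrow> \<exists>a \<in> carrier R. \<exists>y \<in> D. x = a \<odot>\<^bsub>N\<^esub> y"
    and divN: "\<And>x. x \<in> carrier N \<Longrightarrow> \<exists>a \<in> carrier R. \<exists>y \<in> carrier N. x = a \<odot>\<^bsub>N\<^esub> y"
  shows "\<exists>h \<in> mod_homs R N P. \<forall>x \<in> D. h x = g x"
proof -
  interpret N: nonunital_module R N by fact
  note DD = N.submoduleD[OF D]
  let ?M' = "inl_module (N\<lparr>carrier := D\<rparr>) :: ('a, 'a + 'm) module"
  let ?N' = "inl_module N :: ('a, 'a + 'm) module"
  have M': "unitary_module R ?M'"
    by (rule unitary_moduleI[OF nonunital_module_inl[OF N.submodule_is_nonunital_module[OF D]]])
      (use div in \<open>force simp: inl_module_def\<close>)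
  have N': "unitary_module R ?N'"
    by (rule unitary_moduleI[OF nonunital_module_inl[OF N]]) (use divN in \<open>force simp: inl_module_def\<close>)
  have f: "restrict (\<lambda>x. x) (Inl ` D) \<in> mod_homs R ?M' ?N'"
    using DD by (intro mod_homsI) (auto simp: inl_module_def)
  have g': "restrict (\<lambda>x. g (projl x)) (Inl ` D) \<in> mod_homs R ?M' P"
    using mod_homsD[OF g] DD by (intro mod_homsI) (auto simp: inl_module_def)
  have "inj_on (restrict (\<lambda>x. x) (Inl ` D)) (carrier ?M')"
    by (auto simp: inj_on_def inl_module_def)
  then obtain h where h: "h \<in> mod_homs R ?N' P"
    "\<forall>x \<in> carrier ?M'. h (restrict (\<lambda>x. x) (Inl ` D) x) = restrict (\<lambda>x. g (projl x)) (Inl ` D) x"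
    using inj M' N' f g' unfolding injective_module_def by blast
  have hD: "h (Inl x) \<in> carrier P" if "x \<in> carrier N" for x
    using mod_homsD(2)[OF h(1), of "Inl x"] that by (simp add: inl_module_def)
  have hadd: "h (Inl (x \<oplus>\<^bsub>N\<^esub> y)) = h (Inl x) \<oplus>\<^bsub>P\<^esub> h (Inl y)" if "x \<in> carrier N" "y \<in> carrier N" for x y
    using mod_homsD(3)[OF h(1), of "Inl x" "Inl y"] that by (simp add: inl_module_def)
  have hsm: "h (Inl (a \<odot>\<^bsub>N\<^esub> x)) = a \<odot>\<^bsub>P\<^esub> h (Inl x)" if "a \<in> carrier R" "x \<in> carrier N" for a x
    using mod_homsD(4)[OF h(1), of a "Inl x"] that by (simp add: inl_module_def)
  have "restrict (\<lambda>x. h (Inl x)) (carrier N) \<in> mod_homs R N P"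
    using hD hadd hsm N.smult_in_carrier by (intro mod_homsI) auto
  moreover have "h (Inl x) = g x" if "x \<in> D" for x
    using h(2) that by (force simp: inl_module_def)
  ultimately show ?thesis using DD(1) by (intro bexI) auto
qed

subsection \<open>Limits of left multiplications\<close>

text \<open>
  A sequence \<open>s\<close> represents its formal limit, which acts from the left on those \<open>x\<close> for which
  \<open>s n \<otimes> x\<close> is eventually constant.
\<close>

context nonunital_ring
begin

definition stable :: "(nat \<Rightarrow> 'a) \<Rightarrow> 'a set" where
  "stable s = {x \<in> carrier R. \<exists>y. \<forall>\<^sub>F n in sequentially. s n \<otimes> x = y}"

definition stable_value :: "(nat \<Rightarrow> 'a) \<Rightarrow> 'a \<Rightarrow> 'a" where
  "stable_value s x = (THE y. \<forall>\<^sub>F n in sequentially. s n \<otimes> x = y)"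

lemma stable_value_eq:
  assumes "\<forall>\<^sub>F n in sequentially. s n \<otimes> x = y"
  shows "stable_value s x = y"
  unfolding stable_value_def
proof (rule the_equality)
  show "\<forall>\<^sub>F n in sequentially. s n \<otimes> x = y" by (rule assms)
next
  fix y' assume "\<forall>\<^sub>F n in sequentially. s n \<otimes> x = y'"
  with assms have "\<forall>\<^sub>F n in sequentially. y' = y" by eventually_elim simp
  then show "y' = y" by simp
qed

lemma stable_value_eventually:
  assumes "x \<in> stable s"
  shows "\<forall>\<^sub>F n in sequentially. s n \<otimes> x = stable_value s x"
  using assms stable_value_eq unfolding stable_def by blast

lemma stable_value_obtain:
  assumes "x \<in> stable s"
  obtains N where "\<And>n. n \<ge> N \<Longrightarrow> s n \<otimes> x = stable_value s x"
  using stable_value_eventually[OF assms] unfolding eventually_sequentially by blast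

lemma mult_zero_minus:
  assumes "a \<in> carrier R"
  shows "a \<otimes> \<zero> = \<zero>" "\<zero> \<otimes> a = \<zero>" "x \<in> carrier R \<Longrightarrow> a \<otimes> (\<ominus> x) = \<ominus> (a \<otimes> x)"
proof -
  interpret N: nonunital_module R "regular_module R" by (rule nonunital_module_regular)
  show "a \<otimes> \<zero> = \<zero>" using N.smult_zero_right[OF assms] by (simp add: regular_module_def)
  show "\<zero> \<otimes> a = \<zero>" using smult_zero_minus_left(1)[OF nonunital_module_regular, of a] assms
    by (simp add: regular_module_def)
  show "a \<otimes> (\<ominus> x) = \<ominus> (a \<otimes> x)" if "x \<in> carrier R"
    using N.smult_minus_right[OF assms, of x] that
      by (simp add: regular_module_def a_inv_def m_inv_def)
qed

lemma stable_operations: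
  assumes s: "\<And>n. s n \<in> carrier R"
  shows "\<zero> \<in> stable s"
    and "\<lbrakk>x \<in> stable s; y \<in> stable s\<rbrakk> \<Longrightarrow> x \<oplus> y \<in> stable s \<and>
      stable_value s (x \<oplus> y) = stable_value s x \<oplus> stable_value s y"
    and "x \<in> stable s \<Longrightarrow> \<ominus> x \<in> stable s"
    and "\<lbrakk>x \<in> stable s; a \<in> carrier R\<rbrakk> \<Longrightarrow> x \<otimes> a \<in> stable s \<and> stable_value s (x \<otimes> a) = stable_value s x \<otimes> a"
    and "x \<in> stable s \<Longrightarrow> stable_value s x \<in> carrier R"
proof -
  have c: "x \<in> carrier R" if "x \<in> stable s" for x using that unfolding stable_def by blast
  show "\<zero> \<in> stable s" using s unfolding stable_def by (auto simp: mult_zero_minus)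
  show "x \<oplus> y \<in> stable s \<and> stable_value s (x \<oplus> y) = stable_value s x \<oplus> stable_value s y"
    if xy: "x \<in> stable s" "y \<in> stable s"
  proof -
    have "\<forall>\<^sub>F n in sequentially. s n \<otimes> (x \<oplus> y) = stable_value s x \<oplus> stable_value s y"
      using stable_value_eventually[OF xy(1)] stable_value_eventually[OF xy(2)]
      by eventually_elim (simp add: mult_add_right s c xy)
    then show ?thesis using stable_value_eq c xy unfolding stable_def by blast
  qed
  show "\<ominus> x \<in> stable s" if x: "x \<in> stable s"
  proof -
    have "\<forall>\<^sub>F n in sequentially. s n \<otimes> (\<ominus> x) = \<ominus> stable_value s x"
      using stable_value_eventually[OF x] by eventually_elim (simp add: mult_zero_minus s c x)
    then show ?thesis using c x unfolding stable_def by blast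
  qed
  show "x \<otimes> a \<in> stable s \<and> stable_value s (x \<otimes> a) = stable_value s x \<otimes> a"
    if xa: "x \<in> stable s" "a \<in> carrier R"
  proof -
    have "\<forall>\<^sub>F n in sequentially. s n \<otimes> (x \<otimes> a) = stable_value s x \<otimes> a"
      using stable_value_eventually[OF xa(1)]
      by eventually_elim (simp add: mult_assoc[symmetric] s c xa)
    then show ?thesis using stable_value_eq c[OF xa(1)] xa mult_closed unfolding stable_def by blast
  qed
  show "stable_value s x \<in> carrier R" if x: "x \<in> stable s"
    by (rule stable_value_obtain[OF x]) (metis order_refl mult_closed s c[OF x])
qed

abbreviation right_module :: "('a, 'a) module" where
  "right_module \<equiv> regular_module (opp_ring R)"

lemma right_module_simps:
  "carrier right_module = carrier R" "\<zero>\<^bsub>right_module\<^esub> = \<zero>"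
  "x \<oplus>\<^bsub>right_module\<^esub> y = x \<oplus> y" "a \<odot>\<^bsub>right_module\<^esub> x = x \<otimes> a"
  "\<ominus>\<^bsub>right_module\<^esub> x = \<ominus> x" "carrier (opp_ring R) = carrier R"
  by (simp_all add: regular_module_def opp_ring_def a_inv_def m_inv_def)

lemma nonunital_right_module: "nonunital_module (opp_ring R) right_module"
  by (rule nonunital_ring.nonunital_module_regular[OF nonunital_ring_opp])

text \<open>Left multiplications commute with the right action, so the elements on which a sequence
  of them stabilises form a right ideal.\<close>

lemma stable_submodule:
  assumes s: "\<And>n. s n \<in> carrier R"
  shows "submodule (stable s) (opp_ring R) right_module"
  using stable_operations[of s, OF s]
  by (intro nonunital_module.submoduleI[OF nonunital_right_module])
    (auto simp: right_module_simps stable_def)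

lemma stable_value_hom:
  assumes s: "\<And>n. s n \<in> carrier R"
  shows "restrict (stable_value s) (stable s) \<in>
    mod_homs (opp_ring R) (right_module\<lparr>carrier := stable s\<rparr>) right_module"
  using stable_operations[of s, OF s] by (intro mod_homsI) (simp_all add: right_module_simps)

end

section \<open>Calculations in Leavitt path algebras\<close>

lemma poly_mapping_sum_single:
  fixes p :: "'a \<Rightarrow>\<^sub>0 'b::comm_monoid_add"
  shows "p = (\<Sum>w \<in> Poly_Mapping.keys p. Poly_Mapping.single w (Poly_Mapping.lookup p w))"
proof (rule poly_mapping_eqI)
  fix k
  have "(\<Sum>w \<in> Poly_Mapping.keys p. (Poly_Mapping.lookup p w when w = k)) =
    (\<Sum>w \<in> Poly_Mapping.keys p. if w = k then Poly_Mapping.lookup p w else 0)"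
    by (simp add: when_def)
  also have "\<dots> = Poly_Mapping.lookup p k"
    by (simp add: sum.delta' in_keys_iff)
  finally show "Poly_Mapping.lookup p k =
    Poly_Mapping.lookup (\<Sum>w \<in> Poly_Mapping.keys p. Poly_Mapping.single w (Poly_Mapping.lookup p w)) k"
    by (simp add: lookup_sum lookup_single)
qed

lemma poly_mapping_induct_keys:
  fixes p :: "'a \<Rightarrow>\<^sub>0 'b::comm_monoid_add"
  assumes "\<And>w. w \<in> Poly_Mapping.keys p \<Longrightarrow> A w"
    and "P 0" "\<And>w c. A w \<Longrightarrow> P (Poly_Mapping.single w c)" "\<And>p q. \<lbrakk>P p; P q\<rbrakk> \<Longrightarrow> P (p + q)"
  shows "P p"
proof -
  have "P (\<Sum>w \<in> S. Poly_Mapping.single w (Poly_Mapping.lookup p w))"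
    if "finite S" "S \<subseteq> Poly_Mapping.keys p" for S
    using that by (induction S rule: finite_induct) (use assms in auto)
  then show ?thesis
    using poly_mapping_sum_single[of p] by (metis finite_keys subset_refl)
qed

text \<open>\<open>L\<close> carries a ring structure only. A scalar acts as a multiple of the empty
  word, a central element of the ambient unital algebra.\<close>

abbreviation scalar :: "'k::zero \<Rightarrow> ('w::monoid_add \<Rightarrow>\<^sub>0 'k)" where
  "scalar c \<equiv> Poly_Mapping.single 0 c"

lemma scalar_commute:
  fixes c :: "'k::comm_semiring_1"
  shows "scalar c * p = p * scalar c"
  by (rule poly_mapping_induct_keys[of p "\<lambda>_. True"])
    (simp_all add: mult_single distrib_left distrib_right mult.commute)

definition linear_extension :: "('b \<Rightarrow> ('w::monoid_add \<Rightarrow>\<^sub>0 'k::comm_ring_1)) \<Rightarrow> ('b \<Rightarrow>\<^sub>0 'k) \<Rightarrow> ('w \<Rightarrow>\<^sub>0 'k)" where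
  "linear_extension \<phi> k = (\<Sum>b \<in> Poly_Mapping.keys k. scalar (Poly_Mapping.lookup k b) * \<phi> b)"

lemma linear_extension_zero [simp]: "linear_extension \<phi> 0 = 0"
  unfolding linear_extension_def by simp

lemma linear_extension_add:
  "linear_extension \<phi> (k + l) = linear_extension \<phi> k + linear_extension \<phi> l"
  unfolding linear_extension_def
  by (rule setsum_keys_plus_distrib) (simp_all add: single_add distrib_right)

lemma linear_extension_single [simp]:
  "linear_extension \<phi> (Poly_Mapping.single b c) = scalar c * \<phi> b"
  unfolding linear_extension_def by simp

lemma linear_extension_sum:
  "linear_extension \<phi> (\<Sum>i \<in> S. f i) = (\<Sum>i \<in> S. linear_extension \<phi> (f i))"
  by (induction S rule: infinite_finite_induct) (auto simp: linear_extension_add)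

lemma carrier_free_algebra:
  "p \<in> carrier (free_algebra E) \<longleftrightarrow> (\<forall>w \<in> Poly_Mapping.keys p. set (letters w) \<subseteq> lpa_gens E)"
  by (simp add: free_algebra_def)

lemma carrier_free_algebra_add:
  "\<lbrakk>p \<in> carrier (free_algebra E); q \<in> carrier (free_algebra E)\<rbrakk> \<Longrightarrow> p + q \<in> carrier (free_algebra E)"
  using keys_add[of p q] by (auto simp: carrier_free_algebra)

lemma carrier_free_algebra_mult:
  "\<lbrakk>p \<in> carrier (free_algebra E); q \<in> carrier (free_algebra E)\<rbrakk> \<Longrightarrow> p * q \<in> carrier (free_algebra E)"
  using keys_mult[of p q] by (fastforce simp: carrier_free_algebra plus_free_word_def)

lemma keys_uminus_subset: "Poly_Mapping.keys (- p) \<subseteq> Poly_Mapping.keys p"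
  by (auto simp: in_keys_iff)

lemma carrier_free_algebra_uminus:
  "p \<in> carrier (free_algebra E) \<Longrightarrow> - p \<in> carrier (free_algebra E)"
  using keys_uminus_subset[of p] by (auto simp: carrier_free_algebra)

lemma free_algebra_simps [simp]:
  "mult (free_algebra E) = (*)" "one (free_algebra E) = 1"
  "zero (free_algebra E) = 0" "add (free_algebra E) = (+)"
  by (simp_all add: free_algebra_def)

lemma one_in_carrier: "1 \<in> carrier (free_algebra E)"
  by (simp add: carrier_free_algebra zero_free_word_def)

lemma ring_free_algebra: "ring (free_algebra E)"
proof (rule ringI)
  show "abelian_group (free_algebra E)"
  proof (rule abelian_groupI)
    fix x assume "x \<in> carrier (free_algebra E)"
    then show "\<exists>y\<in>carrier (free_algebra E). y \<oplus>\<^bsub>free_algebra E\<^esub> x = \<zero>\<^bsub>free_algebra E\<^esub>"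
      by (intro bexI[of _ "- x"]) (auto simp: carrier_free_algebra_uminus)
  qed (auto simp: carrier_free_algebra_add add_ac, simp add: carrier_free_algebra)
  show "Group.monoid (free_algebra E)"
    by (rule monoidI) (auto simp: carrier_free_algebra_mult mult.assoc one_in_carrier)
qed (auto simp: algebra_simps)

lemma a_inv_free_algebra [simp]:
  assumes "p \<in> carrier (free_algebra E)"
  shows "\<ominus>\<^bsub>free_algebra E\<^esub> p = - p"
proof -
  interpret ring "free_algebra E" by (rule ring_free_algebra)
  show ?thesis using minus_equality[of "- p" p] assms carrier_free_algebra_uminus[OF assms] by simp
qed

lemma free_nonunital_iff:
  "p \<in> free_nonunital E \<longleftrightarrow>
    (\<forall>w \<in> Poly_Mapping.keys p. set (letters w) \<subseteq> lpa_gens E \<and> letters w \<noteq> [])"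
proof -
  have "Poly_Mapping.lookup p (Word []) = 0 \<longleftrightarrow> (\<forall>w \<in> Poly_Mapping.keys p. letters w \<noteq> [])"
    by (metis free_word.collapse free_word.sel in_keys_iff)
  then show ?thesis unfolding free_nonunital_def carrier_free_algebra by blast
qed

definition monomial :: "('v, 'e) lpa_gen list \<Rightarrow> ('v, 'e, 'k::field) lpa_free" where
  "monomial xs = Poly_Mapping.single (Word xs) 1"

lemma monomial_mult: "monomial xs * monomial ys = monomial (xs @ ys)"
  unfolding monomial_def by (simp add: mult_single plus_free_word_def)

lemma monomial_Nil: "monomial [] = 1"
  unfolding monomial_def by (simp add: zero_free_word_def[symmetric])

lemma vx_monomial: "vx v = monomial [Vertex v]"
  and ed_monomial: "ed e = monomial [Edge e]"
  and gh_monomial: "gh e = monomial [Ghost e]"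
  by (simp_all add: vx_def ed_def gh_def monomial_def)

lemma single_eq_scalar_monomial:
  "Poly_Mapping.single w (c::'k::field) = scalar c * monomial (letters w)"
  unfolding monomial_def by (simp add: mult_single)

definition epath :: "'e list \<Rightarrow> ('v, 'e, 'k::field) lpa_free" where
  "epath a = monomial (map Edge a)"

definition gpath :: "'e list \<Rightarrow> ('v, 'e, 'k::field) lpa_free" where
  "gpath a = monomial (map Ghost (rev a))"

lemma epath_simps: "epath [] = 1" "epath (e # a) = ed e * epath a" "epath (a @ b) = epath a * epath b"
  by (simp_all add: epath_def ed_monomial monomial_mult monomial_Nil)

lemma gpath_simps: "gpath [] = 1" "gpath (e # a) = gpath a * gh e" "gpath (a @ b) = gpath b * gpath a"
  by (simp_all add: gpath_def gh_monomial monomial_mult monomial_Nil)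

section \<open>Congruence modulo the defining relations\<close>

locale lpa = wf_digraph E for E :: "('v, 'e) pre_digraph" +
  fixes K :: "'k::field itself"
begin

abbreviation F :: "('v, 'e, 'k) lpa_free ring" where
  "F \<equiv> free_algebra E"

abbreviation I :: "('v, 'e, 'k) lpa_free set" where
  "I \<equiv> lpa_ideal E"

lemma monomial_closed: "set xs \<subseteq> lpa_gens E \<Longrightarrow> monomial xs \<in> carrier F"
  by (auto simp: monomial_def carrier_free_algebra)

lemma vx_closed [simp]: "v \<in> verts E \<Longrightarrow> vx v \<in> carrier F"
  and ed_closed [simp]: "e \<in> arcs E \<Longrightarrow> ed e \<in> carrier F"
  and gh_closed [simp]: "e \<in> arcs E \<Longrightarrow> gh e \<in> carrier F"
  by (auto simp: vx_monomial ed_monomial gh_monomial lpa_gens_def intro!: monomial_closed)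

lemma epath_closed [simp]: "set a \<subseteq> arcs E \<Longrightarrow> epath a \<in> carrier F"
  and gpath_closed [simp]: "set a \<subseteq> arcs E \<Longrightarrow> gpath a \<in> carrier F"
  unfolding epath_def gpath_def lpa_gens_def[of E]
  by (rule monomial_closed, force simp: lpa_gens_def)+

lemma scalar_closed [simp]: "scalar c \<in> carrier F"
  by (auto simp: carrier_free_algebra zero_free_word_def)

lemma zero_one_closed [simp]: "0 \<in> carrier F" "1 \<in> carrier F"
  by (auto simp: carrier_free_algebra zero_free_word_def)

lemma add_closed [simp]: "\<lbrakk>p \<in> carrier F; q \<in> carrier F\<rbrakk> \<Longrightarrow> p + q \<in> carrier F"
  by (rule carrier_free_algebra_add)

lemma mult_closed [simp]: "\<lbrakk>p \<in> carrier F; q \<in> carrier F\<rbrakk> \<Longrightarrow> p * q \<in> carrier F"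
  by (rule carrier_free_algebra_mult)

lemma uminus_closed [simp]: "p \<in> carrier F \<Longrightarrow> - p \<in> carrier F"
  by (rule carrier_free_algebra_uminus)

lemma diff_closed [simp]: "\<lbrakk>p \<in> carrier F; q \<in> carrier F\<rbrakk> \<Longrightarrow> p - q \<in> carrier F"
  using add_closed[of p "- q"] by simp

lemma sum_closed [simp]: "(\<And>i. i \<in> S \<Longrightarrow> f i \<in> carrier F) \<Longrightarrow> sum f S \<in> carrier F"
  by (induction S rule: infinite_finite_induct) auto

lemma relations_closed: "lpa_relations E \<subseteq> carrier F"
  unfolding lpa_relations_def
  by (auto simp: regular_vertex_def intro!: diff_closed sum_closed)

lemma ideal_I: "ideal I F"
  unfolding lpa_ideal_def by (rule ring.genideal_ideal[OF ring_free_algebra relations_closed])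

lemma relations_subset: "lpa_relations E \<subseteq> I"
  unfolding lpa_ideal_def by (rule ring.genideal_self[OF ring_free_algebra relations_closed])

lemma I_minimal: "\<lbrakk>ideal J F; lpa_relations E \<subseteq> J\<rbrakk> \<Longrightarrow> I \<subseteq> J"
  unfolding lpa_ideal_def by (rule ring.genideal_minimal[OF ring_free_algebra])

lemma I_zero: "0 \<in> I"
  using additive_subgroup.zero_closed[OF ideal.axioms(1)[OF ideal_I]] by simp

lemma I_add: "\<lbrakk>p \<in> I; q \<in> I\<rbrakk> \<Longrightarrow> p + q \<in> I"
  using additive_subgroup.a_closed[OF ideal.axioms(1)[OF ideal_I]] by simp

lemma I_mult: "\<lbrakk>p \<in> I; q \<in> carrier F\<rbrakk> \<Longrightarrow> q * p \<in> I" "\<lbrakk>p \<in> I; q \<in> carrier F\<rbrakk> \<Longrightarrow> p * q \<in> I"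
  using ideal.I_l_closed[OF ideal_I] ideal.I_r_closed[OF ideal_I] by simp_all

lemma I_uminus: "p \<in> I \<Longrightarrow> - p \<in> I"
  using I_mult(1)[of p "- 1"] by simp

text \<open>Calculations take place in \<open>F\<close>, whose operations are those of a type,
  rather than with cosets. Membership in the carrier is built in, so that each congruence brings its
  closure facts along.\<close>

definition cong :: "('v, 'e, 'k) lpa_free \<Rightarrow> ('v, 'e, 'k) lpa_free \<Rightarrow> bool" (infix \<open>\<approx>\<close> 50) where
  "p \<approx> q \<longleftrightarrow> p \<in> carrier F \<and> q \<in> carrier F \<and> p - q \<in> I"

lemma cong_refl [simp]: "p \<in> carrier F \<Longrightarrow> p \<approx> p"
  unfolding cong_def by (simp add: I_zero)

lemma cong_sym: "p \<approx> q \<Longrightarrow> q \<approx> p"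
  unfolding cong_def using I_uminus[of "p - q"] by simp

lemma cong_trans [trans]: "\<lbrakk>p \<approx> q; q \<approx> r\<rbrakk> \<Longrightarrow> p \<approx> r"
  unfolding cong_def using I_add[of "p - q" "q - r"] by simp

lemma cong_add: "\<lbrakk>p \<approx> q; p' \<approx> q'\<rbrakk> \<Longrightarrow> p + p' \<approx> q + q'"
  unfolding cong_def using I_add[of "p - q" "p' - q'"] by (simp add: algebra_simps)

lemma cong_mult: "\<lbrakk>p \<approx> q; p' \<approx> q'\<rbrakk> \<Longrightarrow> p * p' \<approx> q * q'"
  unfolding cong_def
  using I_add[of "(p - q) * p'" "q * (p' - q')"] I_mult(2)[of "p - q" p'] I_mult(1)[of "p' - q'" q]
  by (auto simp: algebra_simps)

lemma cong_left: "\<lbrakk>p \<approx> q; x \<in> carrier F\<rbrakk> \<Longrightarrow> x * p \<approx> x * q"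
  and cong_right: "\<lbrakk>p \<approx> q; y \<in> carrier F\<rbrakk> \<Longrightarrow> p * y \<approx> q * y"
  and cong_middle: "\<lbrakk>p \<approx> q; x \<in> carrier F; y \<in> carrier F\<rbrakk> \<Longrightarrow> x * p * y \<approx> x * q * y"
  by (simp_all add: cong_mult)

lemma cong_sum: "(\<And>i. i \<in> S \<Longrightarrow> f i \<approx> g i) \<Longrightarrow> sum f S \<approx> sum g S"
  by (induction S rule: infinite_finite_induct) (auto intro: cong_add)

lemma cong_relation: "\<lbrakk>p - q \<in> lpa_relations E; p \<in> carrier F; q \<in> carrier F\<rbrakk> \<Longrightarrow> p \<approx> q"
  using relations_subset unfolding cong_def by blast

lemma cong_relation_zero: "p \<in> lpa_relations E \<Longrightarrow> p \<approx> 0"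
  using relations_subset relations_closed unfolding cong_def by auto

lemma vx_idem: "v \<in> verts E \<Longrightarrow> vx v * vx v \<approx> vx v"
  by (rule cong_relation, unfold lpa_relations_def, blast) simp_all

lemma vx_orth: "\<lbrakk>v \<in> verts E; w \<in> verts E; v \<noteq> w\<rbrakk> \<Longrightarrow> vx v * vx w \<approx> 0"
  by (rule cong_relation_zero, unfold lpa_relations_def, blast)

lemma tail_ed: "e \<in> arcs E \<Longrightarrow> vx (tail E e) * ed e \<approx> ed e"
  by (rule cong_relation, unfold lpa_relations_def, blast) simp_all

lemma ed_head: "e \<in> arcs E \<Longrightarrow> ed e * vx (head E e) \<approx> ed e"
  by (rule cong_relation, unfold lpa_relations_def, blast) simp_all

lemma head_gh: "e \<in> arcs E \<Longrightarrow> vx (head E e) * gh e \<approx> gh e"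
  by (rule cong_relation, unfold lpa_relations_def, blast) simp_all

lemma gh_tail: "e \<in> arcs E \<Longrightarrow> gh e * vx (tail E e) \<approx> gh e"
  by (rule cong_relation, unfold lpa_relations_def, blast) simp_all

lemma gh_ed_same: "e \<in> arcs E \<Longrightarrow> gh e * ed e \<approx> vx (head E e)"
  by (rule cong_relation, unfold lpa_relations_def, blast) simp_all

lemma gh_ed_diff: "\<lbrakk>e \<in> arcs E; f \<in> arcs E; e \<noteq> f\<rbrakk> \<Longrightarrow> gh e * ed f \<approx> 0"
  by (rule cong_relation_zero, unfold lpa_relations_def, blast)

text \<open>Relation (4) with the head of each edge inserted, where the expansion of that vertex can
  later be substituted.\<close>

lemma vx_expand:
  assumes "regular_vertex E v"
  shows "vx v \<approx> (\<Sum>e \<in> out_arcs E v. ed e * vx (head E e) * gh e)"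
proof -
  have "vx v \<approx> (\<Sum>e \<in> out_arcs E v. ed e * gh e)"
    using assms unfolding regular_vertex_def
    by (intro cong_relation, unfold lpa_relations_def regular_vertex_def, blast)
      (auto intro!: sum_closed)
  also have "\<dots> \<approx> (\<Sum>e \<in> out_arcs E v. ed e * vx (head E e) * gh e)"
    by (intro cong_sum cong_right cong_sym[OF ed_head]) auto
  finally show ?thesis .
qed

lemma awalkD:
  assumes "awalk u a w"
  shows "set a \<subseteq> arcs E" "u \<in> verts E" "w \<in> verts E"
  using assms awalk_last_in_verts[OF assms] unfolding awalk_def by auto

text \<open>The factor \<open>vx w\<close> takes care of the empty path, for which
  \<open>epath []\<close> is the unit of \<open>F\<close> and not a vertex.\<close>

lemma vx_epath:
  assumes "awalk u a w"
  shows "vx u * (epath a * vx w) \<approx> epath a * vx w"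
proof (cases a)
  case Nil
  then show ?thesis using assms vx_idem by (auto simp: awalk_Nil_iff epath_simps)
next
  case (Cons e b)
  then have "e \<in> arcs E" "u = tail E e" "awalk (head E e) b w"
    using assms by (auto simp: awalk_Cons_iff)
  then show ?thesis
    using cong_right[OF tail_ed, of e "epath b * vx w"] awalkD[of "head E e" b w]
    by (simp add: Cons epath_simps mult.assoc)
qed

lemma gpath_vx:
  assumes "awalk u b w"
  shows "vx w * gpath b * vx u \<approx> vx w * gpath b"
proof (cases b)
  case Nil
  then show ?thesis using assms vx_idem by (auto simp: awalk_Nil_iff gpath_simps)
next
  case (Cons e c)
  then have "e \<in> arcs E" "u = tail E e" "awalk (head E e) c w"
    using assms by (auto simp: awalk_Cons_iff)
  then show ?thesis
    using cong_left[OF gh_tail, of e "vx w * gpath c"] awalkD[of "head E e" c w]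
    by (simp add: Cons gpath_simps mult.assoc)
qed

text \<open>The innermost pair \<open>e* e\<close> collapses to the head of \<open>e\<close>, which
  the neighbouring factor absorbs.\<close>

lemma gpath_epath_same:
  assumes "awalk u b w"
  shows "vx w * gpath b * (epath b * vx w) \<approx> vx w"
  using assms
proof (induction b arbitrary: u)
  case Nil
  then show ?case using vx_idem by (auto simp: awalk_Nil_iff gpath_simps epath_simps)
next
  case (Cons e b)
  then have e: "e \<in> arcs E" "awalk (head E e) b w" by (auto simp: awalk_Cons_iff)
  note [simp] = e(1) awalkD[OF e(2)]
  have "vx w * gpath (e # b) * (epath (e # b) * vx w) =
      (vx w * gpath b) * (gh e * ed e) * (epath b * vx w)"
    by (simp add: gpath_simps epath_simps mult.assoc)
  also have "\<dots> \<approx> (vx w * gpath b) * vx (head E e) * (epath b * vx w)"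
    by (intro cong_middle gh_ed_same) simp_all
  also have "\<dots> \<approx> (vx w * gpath b) * (epath b * vx w)"
    by (intro cong_right gpath_vx[OF e(2)]) simp_all
  also have "\<dots> \<approx> vx w" by (rule Cons.IH[OF e(2)])
  finally show ?case .
qed

text \<open>After their common initial part the two paths continue with different edges
  \<open>e\<close> and \<open>f\<close>, and these meet in a factor \<open>e* f = 0\<close>. The
  prefix hypotheses exclude that one path ends before this happens.\<close>

lemma gpath_epath_diff:
  assumes "awalk u b w" "awalk u' b' w'" "\<nexists>c. b' = b @ c" "\<nexists>c. b = b' @ c"
  shows "vx w * gpath b * (epath b' * vx w') \<approx> 0"
  using assms
proof (induction b arbitrary: u b' u')
  case Nil
  then show ?case by simp
next
  case (Cons e b)
  then obtain f d where b': "b' = f # d" by (cases b') auto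
  have e: "e \<in> arcs E" "awalk (head E e) b w" and f: "f \<in> arcs E" "awalk (head E f) d w'"
    using Cons.prems b' by (auto simp: awalk_Cons_iff)
  note [simp] = e(1) awalkD[OF e(2)] f(1) awalkD[OF f(2)]
  have eq: "vx w * gpath (e # b) * (epath b' * vx w') =
      (vx w * gpath b) * (gh e * ed f) * (epath d * vx w')"
    by (simp add: gpath_simps epath_simps mult.assoc b')
  show ?case
  proof (cases "e = f")
    case True
    have "(vx w * gpath b) * (gh e * ed f) * (epath d * vx w') \<approx>
        (vx w * gpath b) * vx (head E e) * (epath d * vx w')"
      unfolding True[symmetric] by (intro cong_middle gh_ed_same) (simp_all add: awalkD[OF f(2)])
    also have "\<dots> \<approx> (vx w * gpath b) * (epath d * vx w')"
      by (intro cong_right gpath_vx[OF e(2)]) simp_all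
    also have "\<dots> \<approx> 0"
      using Cons.prems b' True by (intro Cons.IH[OF e(2) f(2)]) auto
    finally show ?thesis unfolding eq .
  next
    case False
    have "(vx w * gpath b) * (gh e * ed f) * (epath d * vx w') \<approx>
        (vx w * gpath b) * 0 * (epath d * vx w')"
      using False by (intro cong_middle gh_ed_diff) simp_all
    then show ?thesis unfolding eq by simp
  qed
qed

text \<open>The element \<open>a b*\<close> of the algebra, for paths \<open>a\<close> and
  \<open>b\<close> ending at \<open>w\<close>. The vertex in the middle keeps it in the nonunital
  algebra when both paths are empty.\<close>

definition path_monomial :: "'e list \<Rightarrow> 'v \<Rightarrow> 'e list \<Rightarrow> ('v, 'e, 'k) lpa_free" where
  "path_monomial a w b = epath a * vx w * gpath b"

lemma path_monomial_closed:
  "\<lbrakk>awalk u a w; awalk u' b w\<rbrakk> \<Longrightarrow> path_monomial a w b \<in> carrier F"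
  unfolding path_monomial_def using awalkD by simp

lemma vx_path_monomial:
  assumes "awalk u a w" "awalk u' b w"
  shows "vx u * path_monomial a w b \<approx> path_monomial a w b"
    and "path_monomial a w b * vx u' \<approx> path_monomial a w b"
  using cong_right[OF vx_epath[OF assms(1)], of "gpath b"] awalkD[OF assms(2)]
    cong_left[OF gpath_vx[OF assms(2)], of "epath a"] awalkD[OF assms(1)]
  by (simp_all add: path_monomial_def mult.assoc)

text \<open>An edge lengthens \<open>a\<close> at the front. A ghost edge cancels the first edge of
  \<open>a\<close>; if \<open>a\<close> is empty it lengthens \<open>b\<close> at the end, as
  \<open>e* b* = (b e)*\<close>. Generators that do not fit give zero.\<close>

lemma gen_path_monomial:
  assumes g: "g \<in> lpa_gens E" and walks: "awalk u a w" "awalk u' b w"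
  shows "monomial [g] * path_monomial a w b \<approx> 0 \<or>
    (\<exists>a' w' b' v v'. awalk v a' w' \<and> awalk v' b' w' \<and>
      monomial [g] * path_monomial a w b \<approx> path_monomial a' w' b')"
proof -
  let ?m = "path_monomial a w b"
  note [simp] = awalkD[OF walks(1)] awalkD[OF walks(2)] path_monomial_closed[OF walks]
  have other: "vx v * ?m \<approx> 0" if "v \<in> verts E" "v \<noteq> u" for v
  proof -
    have "vx v * ?m \<approx> vx v * (vx u * ?m)"
      using that by (intro cong_left cong_sym[OF vx_path_monomial(1)[OF walks]]) simp_all
    also have "\<dots> = (vx v * vx u) * ?m" by (simp add: mult.assoc)
    also have "\<dots> \<approx> 0 * ?m" using that by (intro cong_right vx_orth) simp_all
    finally show ?thesis by simp
  qed
  from g consider v where "g = Vertex v" "v \<in> verts E" | e where "g = Edge e" "e \<in> arcs E"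
    | e where "g = Ghost e" "e \<in> arcs E"
    unfolding lpa_gens_def by blast
  then show ?thesis
  proof cases
    case 1
    then show ?thesis
      using other[of v] vx_path_monomial(1)[OF walks] walks by (cases "v = u")
        (auto simp: vx_monomial)
  next
    case 2
    note [simp] = 2(2)
    have *: "ed e * ?m \<approx> ed e * (vx (head E e) * ?m)"
      using cong_right[OF cong_sym[OF ed_head], of e ?m] by (simp add: mult.assoc)
    show ?thesis
    proof (cases "head E e = u")
      case True
      then have "awalk (tail E e) (e # a) w" using walks by (simp add: awalk_Cons_iff)
      moreover have "ed e * ?m = path_monomial (e # a) w b"
        by (simp add: path_monomial_def epath_simps mult.assoc)
      ultimately have "monomial [g] * ?m \<approx> path_monomial (e # a) w b"
        using cong_refl[OF path_monomial_closed] walks(2) 2(1) by (simp add: ed_monomial)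
      then show ?thesis using \<open>awalk (tail E e) (e # a) w\<close> walks(2) by blast
    next
      case False
      have "ed e * (vx (head E e) * ?m) \<approx> ed e * 0"
        using False by (intro cong_left other) simp_all
      then show ?thesis using cong_trans[OF *] 2 by (simp add: ed_monomial)
    qed
  next
    case 3
    note [simp] = 3(2)
    show ?thesis
    proof (cases a)
      case Nil
      then have wu: "w = u" using walks(1) by (simp add: awalk_Nil_iff)
      show ?thesis
      proof (cases "tail E e = u")
        case True
        have "gh e * ?m = (gh e * vx (tail E e)) * gpath b"
          using True wu by (simp add: path_monomial_def Nil epath_simps mult.assoc)
        also have "\<dots> \<approx> gh e * gpath b" by (intro cong_right gh_tail) simp_all
        also have "\<dots> \<approx> (vx (head E e) * gh e) * gpath b"
          by (intro cong_right cong_sym[OF head_gh]) simp_all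
        also have "\<dots> = path_monomial [] (head E e) (b @ [e])"
          by (simp add: path_monomial_def epath_simps gpath_simps mult.assoc)
        finally have "gh e * ?m \<approx> path_monomial [] (head E e) (b @ [e])" .
        moreover have "awalk (head E e) [] (head E e)" by (simp add: awalk_Nil_iff)
        moreover have "awalk u' (b @ [e]) (head E e)"
          using walks(2) True wu by (intro awalk_appendI[of u' b w])
            (auto simp: awalk_Cons_iff awalk_Nil_iff)
        ultimately show ?thesis unfolding 3(1) gh_monomial[symmetric] by blast
      next
        case False
        have "gh e * ?m \<approx> gh e * vx (tail E e) * ?m"
          by (intro cong_right cong_sym[OF gh_tail]) simp_all
        also have "\<dots> = gh e * (vx (tail E e) * ?m)" by (simp add: mult.assoc)
        also have "\<dots> \<approx> gh e * 0" using False by (intro cong_left other) simp_all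
        finally show ?thesis using 3 by (simp add: gh_monomial)
      qed
    next
      case (Cons f c)
      then have f: "f \<in> arcs E" "awalk (head E f) c w" using walks(1) by (auto simp: awalk_Cons_iff)
      note [simp] = f(1) path_monomial_closed[OF f(2) walks(2)]
      have eq: "gh e * ?m = (gh e * ed f) * path_monomial c w b"
        by (simp add: path_monomial_def Cons epath_simps mult.assoc)
      show ?thesis
      proof (cases "e = f")
        case True
        have "(gh e * ed f) * path_monomial c w b \<approx> vx (head E f) * path_monomial c w b"
          unfolding True by (intro cong_right gh_ed_same) simp_all
        also have "\<dots> \<approx> path_monomial c w b" by (rule vx_path_monomial(1)[OF f(2) walks(2)])
        finally show ?thesis
          unfolding 3(1) gh_monomial[symmetric] eq using f(2) walks(2) by blast
      next
        case False
        have "(gh e * ed f) * path_monomial c w b \<approx> 0 * path_monomial c w b"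
          using False by (intro cong_right gh_ed_diff) simp_all
        then show ?thesis using eq 3 by (simp add: gh_monomial)
      qed
    qed
  qed
qed

text \<open>Hence the elements \<open>a b*\<close> span \<open>L\<close>. The word is built up from
  the right, one generator at a time being multiplied on the left.\<close>

lemma monomial_reduce:
  assumes "xs \<noteq> []" "set xs \<subseteq> lpa_gens E"
  shows "monomial xs \<approx> 0 \<or>
    (\<exists>a w b u u'. awalk u a w \<and> awalk u' b w \<and> monomial xs \<approx> path_monomial a w b)"
  using assms
proof (induction xs rule: list_nonempty_induct)
  case (single g)
  then have "g \<in> lpa_gens E" by simp
  then consider v where "g = Vertex v" "v \<in> verts E" | e where "g = Edge e" "e \<in> arcs E"
    | e where "g = Ghost e" "e \<in> arcs E"
    unfolding lpa_gens_def by blast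
  then show ?case
  proof cases
    case 1
    then have "monomial [g] \<approx> path_monomial [] v []"
      by (simp add: path_monomial_def epath_simps gpath_simps vx_monomial[symmetric])
    moreover have "awalk v [] v" using 1 by (simp add: awalk_Nil_iff)
    ultimately show ?thesis by blast
  next
    case 2
    then have "monomial [g] \<approx> path_monomial [e] (head E e) []"
      using cong_sym[OF ed_head[of e]]
      by (simp add: path_monomial_def epath_simps gpath_simps ed_monomial[symmetric])
    moreover have "awalk (tail E e) [e] (head E e)" "awalk (head E e) [] (head E e)"
      using 2 by (simp_all add: awalk_Nil_iff awalk_Cons_iff)
    ultimately show ?thesis by blast
  next
    case 3
    then have "monomial [g] \<approx> path_monomial [] (head E e) [e]"
      using cong_sym[OF head_gh[of e]]
      by (simp add: path_monomial_def epath_simps gpath_simps gh_monomial[symmetric])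
    moreover have "awalk (tail E e) [e] (head E e)" "awalk (head E e) [] (head E e)"
      using 3 by (simp_all add: awalk_Nil_iff awalk_Cons_iff)
    ultimately show ?thesis by blast
  qed
next
  case (cons g xs)
  have g: "monomial [g] \<in> carrier F" "g \<in> lpa_gens E"
    using cons.prems by (auto intro: monomial_closed)
  have eq: "(monomial (g # xs) :: ('v, 'e, 'k) lpa_free) = monomial [g] * monomial xs"
    by (simp add: monomial_mult)
  have "set xs \<subseteq> lpa_gens E" using cons.prems by simp
  from cons.IH[OF this] consider "monomial xs \<approx> 0" | a w b u u' where "awalk u a w" "awalk u' b w"
    "monomial xs \<approx> path_monomial a w b" by blast
  then show ?case
  proof cases
    case 1
    then show ?thesis using cong_left[OF 1 g(1)] eq by simp
  next
    case 2
    then show ?thesis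
      using cong_trans[OF cong_left[OF 2(3) g(1)]] gen_path_monomial[OF g(2) 2(1,2)]
      unfolding eq by blast
  qed
qed

lemma nonunital_induct [consumes 1, case_names zero monomial add]:
  fixes p :: "('v, 'e, 'k) lpa_free"
  assumes p: "p \<in> free_nonunital E" and "P 0"
    and mono: "\<And>xs c. \<lbrakk>xs \<noteq> []; set xs \<subseteq> lpa_gens E\<rbrakk> \<Longrightarrow> P (scalar c * monomial xs)"
    and "\<And>p q. \<lbrakk>P p; P q\<rbrakk> \<Longrightarrow> P (p + q)"
  shows "P p"
proof (rule poly_mapping_induct_keys[of p "\<lambda>w. set (letters w) \<subseteq> lpa_gens E \<and> letters w \<noteq> []"])
  show "\<And>w. w \<in> Poly_Mapping.keys p \<Longrightarrow> set (letters w) \<subseteq> lpa_gens E \<and> letters w \<noteq> []"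
    using p unfolding free_nonunital_iff by blast
  fix w c assume "set (letters w) \<subseteq> lpa_gens E \<and> letters w \<noteq> []"
  then show "P (Poly_Mapping.single w c)"
    using single_eq_scalar_monomial[of w c] mono[of "letters w" c] by simp
qed fact+

section \<open>The ring \<open>L\<close> of cosets and its local units\<close>

definition cl :: "('v, 'e, 'k) lpa_free \<Rightarrow> ('v, 'e, 'k) lpa_elem" where
  "cl p = I +>\<^bsub>F\<^esub> p"

abbreviation NU :: "('v, 'e, 'k) lpa_free set" where
  "NU \<equiv> free_nonunital E"

abbreviation L :: "('v, 'e, 'k) lpa_elem ring" where
  "L \<equiv> leavitt_path_algebra E"

lemma cl_eq_iff:
  assumes "p \<in> carrier F" "q \<in> carrier F"
  shows "cl p = cl q \<longleftrightarrow> p \<approx> q"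
proof -
  interpret ideal I F by (rule ideal_I)
  have "p \<ominus>\<^bsub>F\<^esub> q = p - q" using assms by (simp add: a_minus_def)
  then show ?thesis
    using quotient_eq_iff_same_a_r_cos[OF ideal_I assms] assms unfolding cl_def cong_def by simp
qed

lemma L_carrier: "carrier L = cl ` NU"
  unfolding leavitt_path_algebra_def cl_def[abs_def] by simp

lemma L_mult: "\<lbrakk>p \<in> carrier F; q \<in> carrier F\<rbrakk> \<Longrightarrow> cl p \<otimes>\<^bsub>L\<^esub> cl q = cl (p * q)"
  unfolding leavitt_path_algebra_def cl_def FactRing_def
  using ideal.rcoset_mult_add[OF ideal_I] by simp

lemma L_add: "\<lbrakk>p \<in> carrier F; q \<in> carrier F\<rbrakk> \<Longrightarrow> cl p \<oplus>\<^bsub>L\<^esub> cl q = cl (p + q)"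
  unfolding leavitt_path_algebra_def cl_def FactRing_def
  using abelian_subgroup.a_rcos_sum[OF ideal.axioms(1)[OF ideal_I, THEN abelian_subgroupI3]]
    ring.is_abelian_group[OF ring_free_algebra[of E]] by simp

lemma L_zero: "\<zero>\<^bsub>L\<^esub> = cl 0"
proof -
  have "cl 0 = I"
    unfolding cl_def
    using ring.a_rcos_zero[OF ring_free_algebra ideal_I] I_zero by simp
  then show ?thesis unfolding leavitt_path_algebra_def FactRing_def by simp
qed

lemma NU_closed: "p \<in> NU \<Longrightarrow> p \<in> carrier F"
  unfolding free_nonunital_def by simp

lemma NU_zero: "0 \<in> NU"
  by (simp add: free_nonunital_iff)

lemma NU_add: "\<lbrakk>p \<in> NU; q \<in> NU\<rbrakk> \<Longrightarrow> p + q \<in> NU"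
  using keys_add[of p q] by (auto simp: free_nonunital_iff)

lemma NU_uminus: "p \<in> NU \<Longrightarrow> - p \<in> NU"
  using keys_uminus_subset[of p] by (auto simp: free_nonunital_iff)

lemma NU_mult: "\<lbrakk>p \<in> NU; q \<in> carrier F\<rbrakk> \<Longrightarrow> p * q \<in> NU" "\<lbrakk>p \<in> carrier F; q \<in> NU\<rbrakk> \<Longrightarrow> p * q \<in> NU"
  using keys_mult[of p q]
  by (fastforce simp: free_nonunital_iff carrier_free_algebra plus_free_word_def)+

lemma NU_sum: "(\<And>i. i \<in> S \<Longrightarrow> f i \<in> NU) \<Longrightarrow> sum f S \<in> NU"
  by (induction S rule: infinite_finite_induct) (auto simp: NU_zero NU_add)

lemma NU_monomial: "\<lbrakk>xs \<noteq> []; set xs \<subseteq> lpa_gens E\<rbrakk> \<Longrightarrow> monomial xs \<in> NU"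
  by (auto simp: monomial_def free_nonunital_iff)

lemma NU_vx: "v \<in> verts E \<Longrightarrow> vx v \<in> NU"
  by (auto simp: vx_monomial lpa_gens_def intro!: NU_monomial)

lemma NU_path_monomial: "\<lbrakk>awalk u a w; awalk u' b w\<rbrakk> \<Longrightarrow> path_monomial a w b \<in> NU"
  unfolding path_monomial_def using awalkD[of u a w] awalkD[of u' b w] by (intro NU_mult NU_vx) auto

lemma nonunital_ring_L: "nonunital_ring L"
proof -
  have "abelian_group L"
  proof (rule abelian_groupI)
    fix x assume "x \<in> carrier L"
    then obtain p where p: "p \<in> NU" "x = cl p" unfolding L_carrier by blast
    then show "\<exists>y\<in>carrier L. y \<oplus>\<^bsub>L\<^esub> x = \<zero>\<^bsub>L\<^esub>"
      by (intro bexI[of _ "cl (- p)"]) (auto simp: L_carrier L_add L_zero NU_closed NU_uminus)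
  qed (auto simp: L_carrier L_add L_zero NU_closed NU_add NU_zero add_ac)
  then show ?thesis
    by (auto simp: nonunital_ring_def nonunital_ring_axioms_def L_carrier L_add L_mult L_zero
        NU_closed NU_mult mult.assoc distrib_left distrib_right)
qed

lemma local_unit_words:
  assumes "xs \<noteq> []" "set xs \<subseteq> lpa_gens E"
  shows "\<exists>u \<in> verts E. vx u * monomial xs \<approx> monomial xs"
    "\<exists>u \<in> verts E. monomial xs * vx u \<approx> monomial xs"
proof -
  have gen: "\<exists>u \<in> verts E. vx u * monomial [g] \<approx> monomial [g]"
    "\<exists>u \<in> verts E. monomial [g] * vx u \<approx> monomial [g]" if "g \<in> lpa_gens E" for g
    using that vx_idem tail_ed ed_head head_gh gh_tail
    unfolding lpa_gens_def vx_monomial ed_monomial gh_monomial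
    using tail_in_verts head_in_verts by blast+
  show "\<exists>u \<in> verts E. vx u * monomial xs \<approx> monomial xs"
  proof -
    obtain g ys where xs: "xs = g # ys" using assms(1) by (cases xs) auto
    then have g: "g \<in> lpa_gens E" and c: "monomial ys \<in> carrier F"
      using assms(2) by (auto intro: monomial_closed)
    have eq: "(monomial xs :: ('v, 'e, 'k) lpa_free) = monomial [g] * monomial ys"
      by (simp add: monomial_mult xs)
    show ?thesis using gen(1)[OF g] cong_right[OF _ c] unfolding eq mult.assoc[symmetric] by blast
  qed
  show "\<exists>u \<in> verts E. monomial xs * vx u \<approx> monomial xs"
  proof -
    obtain g ys where xs: "xs = ys @ [g]" using assms(1) by (cases xs rule: rev_cases) auto
    then have g: "g \<in> lpa_gens E" and c: "monomial ys \<in> carrier F"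
      using assms(2) by (auto intro: monomial_closed)
    have eq: "(monomial xs :: ('v, 'e, 'k) lpa_free) = monomial ys * monomial [g]"
      by (simp add: monomial_mult xs)
    show ?thesis using gen(2)[OF g] cong_left[OF _ c] unfolding eq mult.assoc by blast
  qed
qed

lemma vx_sum_absorb:
  assumes "u \<in> G" "finite G" "G \<subseteq> verts E"
  shows "(\<Sum>v \<in> G. vx v) * vx u \<approx> vx u" "vx u * (\<Sum>v \<in> G. vx v) \<approx> vx u"
proof -
  have u: "u \<in> verts E" using assms by blast
  have "(\<Sum>v \<in> G. vx v * vx u) \<approx> (\<Sum>v \<in> G. if v = u then vx u else 0)"
    using assms vx_orth vx_idem by (intro cong_sum) (auto simp: subset_iff)
  moreover have "(\<Sum>v \<in> G. vx u * vx v) \<approx> (\<Sum>v \<in> G. if v = u then vx u else 0)"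
    using assms vx_orth vx_idem by (intro cong_sum) (auto simp: subset_iff)
  ultimately show "(\<Sum>v \<in> G. vx v) * vx u \<approx> vx u" "vx u * (\<Sum>v \<in> G. vx v) \<approx> vx u"
    using assms by (simp_all add: sum_distrib_left sum_distrib_right)
qed

text \<open>Claiming the property for every finite \<open>G\<close> above \<open>V\<close>, and not
  for \<open>V\<close> alone, lets it pass to sums: the union of the two vertex sets serves both
  summands.\<close>

lemma local_units:
  assumes "p \<in> NU"
  obtains V where "finite V" "V \<subseteq> verts E"
    "\<And>G. \<lbrakk>finite G; V \<subseteq> G; G \<subseteq> verts E\<rbrakk> \<Longrightarrow> (\<Sum>v \<in> G. vx v) * p \<approx> p \<and> p * (\<Sum>v \<in> G. vx v) \<approx> p"
proof -
  let ?P = "\<lambda>p. p \<in> carrier F \<and> (\<exists>V. finite V \<and> V \<subseteq> verts E \<and>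
    (\<forall>G. finite G \<longrightarrow> V \<subseteq> G \<longrightarrow> G \<subseteq> verts E \<longrightarrow> (\<Sum>v \<in> G. vx v) * p \<approx> p \<and> p * (\<Sum>v \<in> G. vx v) \<approx> p))"
  have "?P p"
    using assms
  proof (induction rule: nonunital_induct)
    case zero
    show ?case by auto
  next
    case (monomial xs c)
    let ?m = "monomial xs :: ('v, 'e, 'k) lpa_free"
    have m: "?m \<in> carrier F" using monomial by (intro monomial_closed)
    obtain u u' where u: "u \<in> verts E" "vx u * ?m \<approx> ?m" "u' \<in> verts E" "?m * vx u' \<approx> ?m"
      using local_unit_words[OF monomial] by blast
    have "(\<Sum>v \<in> G. vx v) * (scalar c * ?m) \<approx> scalar c * ?m \<and>
        (scalar c * ?m) * (\<Sum>v \<in> G. vx v) \<approx> scalar c * ?m"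
      if G: "finite G" "{u, u'} \<subseteq> G" "G \<subseteq> verts E" for G
    proof -
      let ?s = "(\<Sum>v \<in> G. vx v) :: ('v, 'e, 'k) lpa_free"
      have s: "?s \<in> carrier F" using G by (intro sum_closed) auto
      note [simp] = s m u(1,3)
      have "?s * ?m \<approx> ?s * (vx u * ?m)" using u by (intro cong_left cong_sym[OF u(2)]) simp
      also have "\<dots> = (?s * vx u) * ?m" by (simp add: mult.assoc)
      also have "\<dots> \<approx> vx u * ?m" using G by (intro cong_right vx_sum_absorb) auto
      also have "\<dots> \<approx> ?m" by (rule u(2))
      finally have 1: "?s * ?m \<approx> ?m" .
      have "?m * ?s \<approx> (?m * vx u') * ?s" by (intro cong_right cong_sym[OF u(4)]) simp
      also have "\<dots> = ?m * (vx u' * ?s)" by (simp add: mult.assoc)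
      also have "\<dots> \<approx> ?m * vx u'" using G by (intro cong_left vx_sum_absorb) auto
      also have "\<dots> \<approx> ?m" by (rule u(4))
      finally have 2: "?m * ?s \<approx> ?m" .
      have "?s * (scalar c * ?m) = scalar c * (?s * ?m)"
        by (metis mult.assoc scalar_commute)
      then show ?thesis using cong_left[OF 1, of "scalar c"] cong_left[OF 2, of "scalar c"]
        by (simp add: mult.assoc)
    qed
    then show ?case using u m by (intro conjI exI[of _ "{u, u'}"]) auto
  next
    case (add p q)
    then obtain V V' where "finite V" "V \<subseteq> verts E" "finite V'" "V' \<subseteq> verts E"
      and V: "\<And>G. \<lbrakk>finite G; V \<subseteq> G; G \<subseteq> verts E\<rbrakk> \<Longrightarrow> (\<Sum>v \<in> G. vx v) * p \<approx> p \<and> p * (\<Sum>v \<in> G. vx v) \<approx> p"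
      and V': "\<And>G. \<lbrakk>finite G; V' \<subseteq> G; G \<subseteq> verts E\<rbrakk> \<Longrightarrow> (\<Sum>v \<in> G. vx v) * q \<approx> q \<and> q * (\<Sum>v \<in> G. vx v) \<approx> q"
      by blast
    moreover have "(\<Sum>v \<in> G. vx v) * (p + q) \<approx> p + q \<and> (p + q) * (\<Sum>v \<in> G. vx v) \<approx> p + q"
      if "finite G" "V \<union> V' \<subseteq> G" "G \<subseteq> verts E" for G
      using V[of G] V'[of G] that cong_add by (simp add: distrib_left distrib_right)
    ultimately show ?case using add by (intro conjI exI[of _ "V \<union> V'"]) auto
  qed
  then show ?thesis using that by blast
qed

lemma L_local_units:
  assumes "x \<in> carrier L"
  shows "\<exists>u \<in> carrier L. u \<otimes>\<^bsub>L\<^esub> x = x \<and> x \<otimes>\<^bsub>L\<^esub> u = x"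
proof -
  obtain p where p: "p \<in> NU" "x = cl p" using assms unfolding L_carrier by blast
  obtain V where V: "finite V" "V \<subseteq> verts E"
    "(\<Sum>v \<in> V. vx v) * p \<approx> p" "p * (\<Sum>v \<in> V. vx v) \<approx> p"
    using local_units[OF p(1)] by (metis order_refl)
  have "(\<Sum>v \<in> V. vx v) \<in> NU" using V(2) by (intro NU_sum NU_vx) blast
  then show ?thesis
    using p V by (intro bexI[of _ "cl (\<Sum>v \<in> V. vx v)"])
      (auto simp: L_carrier L_mult cl_eq_iff NU_closed)
qed

text \<open>A local unit of \<open>p\<close> is a sum of finitely many vertices, and every other
  vertex is orthogonal to it. Along a path with distinct vertices this makes infinite sums act as
  finite ones.\<close>

lemma almost_all_vertices_annihilate:
  assumes "p \<in> NU"
  shows "\<exists>V. finite V \<and> (\<forall>v \<in> verts E - V. vx v * p \<approx> 0)"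
proof -
  obtain V where V: "finite V" "V \<subseteq> verts E" "(\<Sum>v \<in> V. vx v) * p \<approx> p"
    using local_units[OF assms] by (metis order_refl)
  have "vx v * p \<approx> 0" if v: "v \<in> verts E - V" for v
  proof -
    have "(\<Sum>u \<in> V. vx u) \<in> carrier F" using V by (intro sum_closed) auto
    note [simp] = NU_closed[OF assms] this
    have "vx v * p \<approx> vx v * ((\<Sum>u \<in> V. vx u) * p)"
      using v by (intro cong_left cong_sym[OF V(3)]) simp
    also have "\<dots> = (\<Sum>u \<in> V. vx v * vx u) * p" by (simp add: mult.assoc[symmetric] sum_distrib_left)
    also have "\<dots> \<approx> (\<Sum>u \<in> V. 0) * p" using v V(2) by (intro cong_right cong_sum vx_orth) auto
    finally show ?thesis by simp
  qed
  then show ?thesis using V(1) by blast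
qed

end

section \<open>The involution\<close>

fun gen_star :: "('v, 'e) lpa_gen \<Rightarrow> ('v, 'e) lpa_gen" where
  "gen_star (Vertex v) = Vertex v"
| "gen_star (Edge e) = Ghost e"
| "gen_star (Ghost e) = Edge e"

lemma gen_star_gen_star [simp]: "gen_star (gen_star g) = g"
  by (cases g) auto

definition word_star :: "('v, 'e) lpa_gen free_word \<Rightarrow> ('v, 'e) lpa_gen free_word" where
  "word_star w = Word (rev (map gen_star (letters w)))"

lemma word_star_word_star [simp]: "word_star (word_star w) = w"
  by (cases w) (simp add: word_star_def rev_map[symmetric] o_def)

lemma word_star_plus: "word_star (u + w) = word_star w + word_star u"
  by (simp add: word_star_def plus_free_word_def)

lemma inj_word_star: "inj word_star"
  by (metis injI word_star_word_star)

text \<open>\<open>map_key\<close> precomposes with \<open>word_star\<close>; as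
  \<open>word_star\<close> is its own inverse, this replaces every word by its star and keeps the
  coefficient.\<close>

definition star :: "('v, 'e, 'k::field) lpa_free \<Rightarrow> ('v, 'e, 'k) lpa_free" where
  "star p = Poly_Mapping.map_key word_star p"

lemma star_add: "star (p + q) = star p + star q"
  unfolding star_def by (rule map_key_plus[OF inj_word_star])

lemma star_zero [simp]: "star 0 = 0"
  unfolding star_def by (rule map_key_zero[OF inj_word_star])

lemma star_single: "star (Poly_Mapping.single w c) = Poly_Mapping.single (word_star w) c"
  unfolding star_def using map_key_single[OF inj_word_star, of "word_star w" c] by simp

lemma star_uminus: "star (- p) = - star p"
  using star_add[of p "- p"] by (simp add: eq_neg_iff_add_eq_0 add.commute)

lemma star_diff: "star (p - q) = star p - star q"
  using star_add[of p "- q"] by (simp add: star_uminus)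

lemma star_sum: "star (\<Sum>i \<in> S. f i) = (\<Sum>i \<in> S. star (f i))"
  by (induction S rule: infinite_finite_induct) (auto simp: star_add)

lemma star_mult: "star (p * q) = star q * star p"
proof (rule poly_mapping_induct_keys[of p "\<lambda>_. True"])
  fix w c
  show "star (Poly_Mapping.single w c * q) = star q * star (Poly_Mapping.single w c)"
    by (rule poly_mapping_induct_keys[of q "\<lambda>_. True"])
      (simp_all add: star_single mult_single word_star_plus star_add distrib_left distrib_right mult.commute)
qed (simp_all add: star_add distrib_left distrib_right)

lemma star_star [simp]: "star (star p) = p"
  by (rule poly_mapping_induct_keys[of p "\<lambda>_. True"]) (simp_all add: star_single star_add)

lemma star_gens [simp]: "star (vx v) = vx v" "star (ed e) = gh e" "star (gh e) = ed e"
  by (simp_all add: vx_def ed_def gh_def star_single word_star_def)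

lemma star_paths [simp]: "star (epath a) = gpath a" "star (gpath a) = epath a"
  by (simp_all add: epath_def gpath_def monomial_def star_single word_star_def rev_map o_def)

lemma keys_star: "Poly_Mapping.keys (star p) = word_star ` Poly_Mapping.keys p"
  unfolding star_def keys_map_key[OF inj_word_star]
  by (auto simp: image_iff) (metis word_star_word_star)

lemma gen_star_closed: "g \<in> lpa_gens E \<Longrightarrow> gen_star g \<in> lpa_gens E"
  by (auto simp: lpa_gens_def)

lemma star_closed: "p \<in> carrier (free_algebra E) \<Longrightarrow> star p \<in> carrier (free_algebra E)"
  unfolding carrier_free_algebra keys_star by (fastforce simp: word_star_def intro: gen_star_closed)

lemma star_nonunital: "p \<in> free_nonunital E \<Longrightarrow> star p \<in> free_nonunital E"
  unfolding free_nonunital_iff keys_star by (fastforce simp: word_star_def intro: gen_star_closed)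

context lpa
begin

lemma relationsI:
  "v \<in> verts E \<Longrightarrow> vx v * vx v - vx v \<in> lpa_relations E"
  "\<lbrakk>v \<in> verts E; w \<in> verts E; v \<noteq> w\<rbrakk> \<Longrightarrow> vx v * vx w \<in> lpa_relations E"
  "e \<in> arcs E \<Longrightarrow> vx (tail E e) * ed e - ed e \<in> lpa_relations E"
  "e \<in> arcs E \<Longrightarrow> ed e * vx (head E e) - ed e \<in> lpa_relations E"
  "e \<in> arcs E \<Longrightarrow> vx (head E e) * gh e - gh e \<in> lpa_relations E"
  "e \<in> arcs E \<Longrightarrow> gh e * vx (tail E e) - gh e \<in> lpa_relations E"
  "e \<in> arcs E \<Longrightarrow> gh e * ed e - vx (head E e) \<in> lpa_relations E"
  "\<lbrakk>e \<in> arcs E; f \<in> arcs E; e \<noteq> f\<rbrakk> \<Longrightarrow> gh e * ed f \<in> lpa_relations E"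
  "regular_vertex E v \<Longrightarrow> vx v - (\<Sum>e \<in> out_arcs E v. ed e * gh e) \<in> lpa_relations E"
  unfolding lpa_relations_def by blast+

text \<open>The involution exchanges the two families for edges with those for ghost edges and maps
  each of the remaining families to itself.\<close>

lemma star_relations:
  assumes "p \<in> lpa_relations E"
  shows "star p \<in> lpa_relations E"
  using assms[unfolded lpa_relations_def]
  by (elim UnE CollectE exE conjE)
    (simp_all only: star_diff star_mult star_sum star_gens relationsI simp_thms not_sym)

text \<open>The elements whose star lies in \<open>I\<close> form an ideal containing the relations.
  So \<open>star\<close> respects congruence, and statements about right ideals transfer to left
  ideals.\<close>

lemma star_I:
  assumes "p \<in> I"
  shows "star p \<in> I"
proof -
  let ?J = "{p \<in> carrier F. star p \<in> I}"
  interpret F: ring F by (rule ring_free_algebra)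
  have "ideal ?J F"
  proof (rule idealI[OF ring_free_algebra])
    show "subgroup ?J (add_monoid F)"
    proof
      show "\<one>\<^bsub>add_monoid F\<^esub> \<in> ?J" using I_zero by simp
      fix x assume "x \<in> ?J"
      then show "inv\<^bsub>add_monoid F\<^esub> x \<in> ?J"
        using I_uminus a_inv_free_algebra[of x E] by (simp add: a_inv_def star_uminus)
    qed (auto simp: star_add I_add)
  qed (auto simp: star_mult intro: I_mult star_closed)
  then show ?thesis
    using I_minimal[of ?J] star_relations relations_closed relations_subset assms by blast
qed

lemma cong_star: "p \<approx> q \<Longrightarrow> star p \<approx> star q"
  unfolding cong_def using star_I[of "p - q"] by (simp add: star_closed star_diff)

lemma star_path_monomial: "star (path_monomial a w b) = path_monomial b w a"
  unfolding path_monomial_def by (simp add: star_mult mult.assoc)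

section \<open>Right ideals at line points\<close>

lemma line_point_step:
  assumes "line_point E w" "awalk w c w'"
  shows "line_point E w'"
  using assms awalkD[OF assms(2)] unfolding line_point_def tree_def
  by (blast intro: awalk_appendI)

lemma line_point_unique_arc:
  assumes "line_point E w" "e \<in> arcs E" "tail E e = w" "f \<in> arcs E" "tail E f = w"
  shows "e = f"
proof -
  have "awalk w [] w" using assms by (simp add: awalk_Nil_iff line_point_def)
  then have "\<not> bifurcation E w" using assms(1) unfolding line_point_def tree_def by blast
  then show ?thesis using assms unfolding bifurcation_def by auto
qed

text \<open>Without bifurcations both walks are forced to use the same edges as long as both
  continue.\<close>

lemma line_point_walks_comparable:
  assumes "line_point E w" "awalk w a x" "awalk w b y"
  shows "(\<exists>c. b = a @ c \<and> awalk x c y) \<or> (\<exists>c. a = b @ c \<and> awalk y c x)"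
  using assms
proof (induction a arbitrary: w b)
  case Nil
  then show ?case by (auto simp: awalk_Nil_iff)
next
  case (Cons e a)
  show ?case
  proof (cases b)
    case Nil
    then show ?thesis using Cons.prems by (auto simp: awalk_Nil_iff)
  next
    case (Cons f b')
    have *: "e \<in> arcs E" "tail E e = w" "f \<in> arcs E" "tail E f = w"
      "awalk (head E e) a x" "awalk (head E f) b' y"
      using Cons.prems Cons by (auto simp: awalk_Cons_iff)
    then have ef: "f = e" using line_point_unique_arc Cons.prems(1) by blast
    have "line_point E (head E e)"
      using * awalkD[OF *(5)] by (intro line_point_step[OF Cons.prems(1), of "[e]"])
        (auto simp: awalk_Cons_iff awalk_Nil_iff)
    from Cons.IH[OF this *(5)] * ef show ?thesis unfolding Cons by auto
  qed
qed

text \<open>At every vertex of the walk that has a further edge \<open>e\<close>, relation (4) has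
  the single summand \<open>e e*\<close>; iterating it gives \<open>w = c c*\<close>.\<close>

lemma vx_line_point:
  assumes "line_point E w" "awalk w c w'"
  shows "vx w \<approx> path_monomial c w' c"
  using assms
proof (induction c arbitrary: w)
  case Nil
  then show ?case by (auto simp: path_monomial_def awalk_Nil_iff epath_simps gpath_simps)
next
  case (Cons e c)
  have e: "e \<in> arcs E" "tail E e = w" "awalk (head E e) c w'"
    using Cons.prems by (auto simp: awalk_Cons_iff)
  have out: "out_arcs E w = {e}"
    using line_point_unique_arc[OF Cons.prems(1)] e by auto
  then have reg: "regular_vertex E w" using Cons.prems awalkD by (simp add: regular_vertex_def)
  have lp: "line_point E (head E e)"
    using e awalkD[OF e(3)] by (intro line_point_step[OF Cons.prems(1), of "[e]"])
      (auto simp: awalk_Cons_iff awalk_Nil_iff)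
  have "vx w \<approx> ed e * vx (head E e) * gh e"
    using vx_expand[OF reg] unfolding out by simp
  also have "\<dots> \<approx> ed e * path_monomial c w' c * gh e"
    using e by (intro cong_middle Cons.IH lp) auto
  also have "\<dots> = path_monomial (e # c) w' (e # c)"
    by (simp add: path_monomial_def epath_simps gpath_simps mult.assoc)
  finally show ?case .
qed

text \<open>A normal form for elements of \<open>w L\<close>: a combination of monomials
  \<open>a b*\<close> with one common first path \<open>a\<close>. The coefficient function
  \<open>k\<close> is indexed by the second paths, so that a nonzero coefficient can be
  isolated.\<close>

definition line_form :: "'v \<Rightarrow> ('v, 'e, 'k) lpa_free \<Rightarrow> bool" where
  "line_form w x \<longleftrightarrow> (\<exists>a w' k. awalk w a w' \<and> (\<forall>b \<in> Poly_Mapping.keys k. \<exists>u. awalk u b w') \<and>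
     x \<approx> linear_extension (path_monomial a w') k)"

lemma linear_extension_cong:
  assumes "\<And>b. b \<in> Poly_Mapping.keys k \<Longrightarrow> f b \<approx> g b"
  shows "linear_extension f k \<approx> linear_extension g k"
  unfolding linear_extension_def by (intro cong_sum cong_left assms scalar_closed)

text \<open>Inserting \<open>vx w' = c c*\<close> in the middle turns each \<open>a b*\<close> into
  \<open>(a c) (b c)*\<close>, so the common first path can be prolonged along any walk.\<close>

lemma line_form_extend:
  fixes k :: "'e list \<Rightarrow>\<^sub>0 'k"
  assumes w: "line_point E w" "awalk w a w'" "awalk w' c w''"
    and k: "\<And>b. b \<in> Poly_Mapping.keys k \<Longrightarrow> \<exists>u. awalk u b w'"
  obtains k' :: "'e list \<Rightarrow>\<^sub>0 'k" where "\<And>b. b \<in> Poly_Mapping.keys k' \<Longrightarrow> \<exists>u. awalk u b w''"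
    "linear_extension (path_monomial a w') k \<approx> linear_extension (path_monomial (a @ c) w'') k'"
proof -
  define k' where
    "k' = (\<Sum>b \<in> Poly_Mapping.keys k. Poly_Mapping.single (b @ c) (Poly_Mapping.lookup k b))"
  have "Poly_Mapping.keys k' \<subseteq> (\<lambda>b. b @ c) ` Poly_Mapping.keys k"
  proof
    fix x assume "x \<in> Poly_Mapping.keys k'"
    then have "(\<Sum>b \<in> Poly_Mapping.keys k. (Poly_Mapping.lookup k b when b @ c = x)) \<noteq> 0"
      by (simp add: k'_def in_keys_iff lookup_sum lookup_single)
    then obtain b where "b \<in> Poly_Mapping.keys k" "(Poly_Mapping.lookup k b when b @ c = x) \<noteq> 0"
      by (meson sum.neutral)
    then show "x \<in> (\<lambda>b. b @ c) ` Poly_Mapping.keys k" by (auto simp: when_def split: if_splits)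
  qed
  then have 1: "\<exists>u. awalk u b w''" if "b \<in> Poly_Mapping.keys k'" for b
    using that k w(3) by (blast intro: awalk_appendI)
  have "path_monomial a w' b \<approx> path_monomial (a @ c) w'' (b @ c)" if b: "b \<in> Poly_Mapping.keys k" for b
  proof -
    obtain u where "awalk u b w'" using k[OF b] by blast
    then have "epath a * vx w' * gpath b \<approx> epath a * path_monomial c w'' c * gpath b"
      using awalkD[OF w(2)] awalkD
      by (intro cong_middle vx_line_point[OF line_point_step[OF w(1,2)] w(3)]) auto
    then show ?thesis by (simp add: path_monomial_def epath_simps gpath_simps mult.assoc)
  qed
  then have "linear_extension (path_monomial a w') k \<approx>
      linear_extension (\<lambda>b. path_monomial (a @ c) w'' (b @ c)) k"
    by (rule linear_extension_cong)
  also have "\<dots> = linear_extension (path_monomial (a @ c) w'') k'"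
    unfolding k'_def linear_extension_sum by (simp add: linear_extension_def[of _ k])
  finally show ?thesis using that 1 by blast
qed

text \<open>The two common first paths start at the line point \<open>w\<close>, so one extends the
  other; the summand with the shorter one is prolonged before the coefficients are added.\<close>

lemma line_form_add:
  assumes w: "line_point E w" and xy: "line_form w x" "line_form w y"
  shows "line_form w (x + y)"
proof -
  have *: "line_form w (x + y)"
    if H: "awalk w a w'" "\<forall>b \<in> Poly_Mapping.keys k. \<exists>u. awalk u b w'"
      "x \<approx> linear_extension (path_monomial a w') k"
      "awalk w' c w''" "\<forall>b \<in> Poly_Mapping.keys l. \<exists>u. awalk u b w''"
      "y \<approx> linear_extension (path_monomial (a @ c) w'') l"
    for x y a w' c w'' and k l :: "'e list \<Rightarrow>\<^sub>0 'k"
  proof -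
    obtain k' :: "'e list \<Rightarrow>\<^sub>0 'k" where k': "\<And>b. b \<in> Poly_Mapping.keys k' \<Longrightarrow> \<exists>u. awalk u b w''"
      "linear_extension (path_monomial a w') k \<approx> linear_extension (path_monomial (a @ c) w'') k'"
      using line_form_extend[OF w H(1,4)] H(2) by blast
    have "x + y \<approx> linear_extension (path_monomial (a @ c) w'') (k' + l)"
      unfolding linear_extension_add by (intro cong_add cong_trans[OF that(3) k'(2)] that(6))
    moreover have "\<forall>b \<in> Poly_Mapping.keys (k' + l). \<exists>u. awalk u b w''"
      using k'(1) that(5) keys_add[of k' l] by blast
    moreover have "awalk w (a @ c) w''" using that(1,4) by (rule awalk_appendI)
    ultimately show ?thesis unfolding line_form_def by blast
  qed
  obtain a w' k where x: "awalk w a w'" "\<forall>b \<in> Poly_Mapping.keys k. \<exists>u. awalk u b w'"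
      "x \<approx> linear_extension (path_monomial a w') k"
    using xy(1) unfolding line_form_def by blast
  obtain b w'' l where y: "awalk w b w''" "\<forall>c \<in> Poly_Mapping.keys l. \<exists>u. awalk u c w''"
      "y \<approx> linear_extension (path_monomial b w'') l"
    using xy(2) unfolding line_form_def by blast
  from line_point_walks_comparable[OF w x(1) y(1)] show ?thesis
  proof (elim disjE exE conjE)
    fix c assume "b = a @ c" "awalk w' c w''"
    then show ?thesis using *[OF x, of c w'' l y] y by simp
  next
    fix c assume "a = b @ c" "awalk w'' c w'"
    then show ?thesis using *[OF y, of c w' k x] x by (simp add: add.commute)
  qed
qed

text \<open>\<open>vx w\<close> annihilates the monomials that do not start at \<open>w\<close>; the
  others are in normal form and are collected by \<open>line_form_add\<close>.\<close>

lemma line_form_vx: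
  assumes w: "line_point E w" and p: "p \<in> NU"
  shows "line_form w (vx w * p)"
proof -
  have wv: "w \<in> verts E" "awalk w [] w" using w by (auto simp: line_point_def awalk_Nil_iff)
  note [simp] = wv(1)
  have zero: "line_form w x" if "x \<approx> 0" for x
    unfolding line_form_def using that wv
    by (intro exI[of _ "[]"] exI[of _ w] exI[of _ 0]) simp
  show ?thesis
    using p
  proof (induction rule: nonunital_induct)
    case zero
    show ?case by (rule \<open>\<And>x. x \<approx> 0 \<Longrightarrow> line_form w x\<close>) simp
  next
    case (add p q)
    then show ?case using line_form_add[OF w] by (simp add: distrib_left)
  next
    case (monomial xs c)
    have m: "(monomial xs :: ('v, 'e, 'k) lpa_free) \<in> carrier F"
      using monomial by (intro monomial_closed)
    have eq: "vx w * (scalar c * monomial xs) = scalar c * (vx w * (monomial xs :: ('v, 'e, 'k) lpa_free))"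
      by (metis mult.assoc scalar_commute)
    from monomial_reduce[OF monomial] show ?case
    proof (elim disjE exE conjE)
      assume "monomial xs \<approx> 0"
      then have "scalar c * (vx w * monomial xs) \<approx> scalar c * (vx w * 0)" by (intro cong_left) auto
      then show ?thesis unfolding eq by (intro zero) simp
    next
      fix a w' b u u'
      assume a: "awalk u a w'" "awalk u' b w'" and eqm: "monomial xs \<approx> path_monomial a w' b"
      note [simp] = path_monomial_closed[OF a] awalkD[OF a(1)]
      have 1: "scalar c * (vx w * monomial xs) \<approx> scalar c * (vx w * path_monomial a w' b)"
        using eqm by (intro cong_left) auto
      show ?thesis
      proof (cases "u = w")
        case True
        have "scalar c * (vx w * path_monomial a w' b) \<approx> scalar c * path_monomial a w' b"
          using vx_path_monomial(1)[OF a] True by (intro cong_left) auto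
        then have "scalar c * (vx w * monomial xs) \<approx>
            linear_extension (path_monomial a w') (Poly_Mapping.single b c)"
          using cong_trans[OF 1] by simp
        then show ?thesis unfolding eq line_form_def using a True
          by (intro exI[of _ a] exI[of _ w'] exI[of _ "Poly_Mapping.single b c"])
            (auto split: if_splits)
      next
        case False
        have "vx w * path_monomial a w' b \<approx> vx w * (vx u * path_monomial a w' b)"
          by (intro cong_left cong_sym[OF vx_path_monomial(1)[OF a]]) simp
        also have "\<dots> = (vx w * vx u) * path_monomial a w' b" by (simp add: mult.assoc)
        also have "\<dots> \<approx> 0 * path_monomial a w' b" using False by (intro cong_right vx_orth) auto
        finally have "scalar c * (vx w * path_monomial a w' b) \<approx> scalar c * 0"
          by (intro cong_left) auto
        then show ?thesis unfolding eq using cong_trans[OF 1] by (intro zero) simp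
      qed
    qed
  qed
qed

lemma acyclic_closed_walk:
  assumes "acyclic_graph E" "awalk u p u"
  shows "p = []"
proof (rule ccontr)
  assume "p \<noteq> []"
  then have "closed_w p" using assms(2) unfolding closed_w_def by auto
  then show False using closed_w_imp_cycle assms(1) unfolding acyclic_graph_def by blast
qed

text \<open>The multiplication rule of matrix units. If \<open>b\<close> and \<open>b'\<close> start
  at the same vertex and one were a proper prefix of the other, the rest would be a closed walk at
  \<open>w\<close>, against acyclicity; so distinct ones are incomparable and
  \<open>b* b' = 0\<close>. Different starting vertices are orthogonal.\<close>

lemma path_monomial_mult:
  assumes "acyclic_graph E" "awalk u a w" "awalk v b w" "awalk v' b' w"
  shows "path_monomial a w b * path_monomial b' w a \<approx> (if b = b' then path_monomial a w a else 0)"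
proof -
  note [simp] = awalkD[OF assms(2)] awalkD[OF assms(3)] awalkD[OF assms(4)]
  have "path_monomial a w b * path_monomial b' w a =
      epath a * (vx w * gpath b * (epath b' * vx w)) * gpath a"
    by (simp add: path_monomial_def mult.assoc)
  also have "\<dots> \<approx> epath a * (if b = b' then vx w else 0) * gpath a"
  proof (intro cong_middle)
    show "vx w * gpath b * (epath b' * vx w) \<approx> (if b = b' then vx w else 0)"
    proof (cases "v = v'")
      case True
      have clash: "c = []" if "awalk v (d @ c) w" "awalk v d w" for c d
      proof -
        have "awlast v d = w" using that(2) unfolding awalk_def by (simp add: awlast_if_cas)
        then show ?thesis using acyclic_closed_walk[OF assms(1), of w c] that(1) by simp
      qed
      show ?thesis
      proof (cases "b = b'")
        case True
        then show ?thesis using gpath_epath_same[OF assms(3)] by simp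
      next
        case False
        then show ?thesis
          using gpath_epath_diff[OF assms(3,4)] clash[of b] clash[of b'] assms(3,4) \<open>v = v'\<close>
          by fastforce
      qed
    next
      case False
      then have "b \<noteq> b'" using assms(3,4) by (cases b) (auto simp: awalk_Nil_iff awalk_Cons_iff)
      have "vx w * gpath b * (epath b' * vx w) \<approx> (vx w * gpath b * vx v) * (vx v' * (epath b' * vx w))"
        by (intro cong_mult cong_sym[OF gpath_vx[OF assms(3)]] cong_sym[OF vx_epath[OF assms(4)]])
      also have "\<dots> = (vx w * gpath b) * (vx v * vx v') * (epath b' * vx w)"
        by (simp add: mult.assoc)
      also have "\<dots> \<approx> (vx w * gpath b) * 0 * (epath b' * vx w)"
        using False by (intro cong_middle vx_orth) simp_all
      finally show ?thesis using \<open>b \<noteq> b'\<close> by simp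
    qed
  qed simp_all
  also have "\<dots> = (if b = b' then path_monomial a w a else 0)"
    by (simp add: path_monomial_def)
  finally show ?thesis .
qed

text \<open>For a normal form with nonzero coefficient \<open>c\<close> at \<open>b0\<close>, right
  multiplication by \<open>b0 a*\<close> annihilates all other terms and leaves
  \<open>c a a* = c w\<close>; dividing by \<open>c\<close> recovers \<open>w\<close>.\<close>

lemma line_point_atomic:
  assumes acyc: "acyclic_graph E" and w: "line_point E w" and p: "p \<in> NU"
  shows "vx w * p \<approx> 0 \<or> (\<exists>s \<in> NU. vx w * p * s \<approx> vx w)"
proof -
  obtain a w' k where a: "awalk w a w'" and k: "\<forall>b \<in> Poly_Mapping.keys k. \<exists>u. awalk u b w'"
    and x: "vx w * p \<approx> linear_extension (path_monomial a w') k"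
    using line_form_vx[OF w p] unfolding line_form_def by blast
  show ?thesis
  proof (cases "k = 0")
    case True
    then show ?thesis using x by simp
  next
    case False
    then obtain b0 where b0: "b0 \<in> Poly_Mapping.keys k"
      by (metis in_keys_iff lookup_zero poly_mapping_eqI)
    then obtain u0 where u0: "awalk u0 b0 w'" using k by blast
    let ?c = "Poly_Mapping.lookup k b0"
    let ?t = "path_monomial b0 w' a"
    have c: "?c \<noteq> 0" using b0 by (simp add: in_keys_iff)
    note [simp] = path_monomial_closed[OF u0 a] path_monomial_closed[OF a a]
    have "vx w * p * ?t \<approx> linear_extension (path_monomial a w') k * ?t"
      by (intro cong_right x) simp
    also have "\<dots> = (\<Sum>b \<in> Poly_Mapping.keys k. scalar (Poly_Mapping.lookup k b) * (path_monomial a w' b * ?t))"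
      by (simp add: linear_extension_def sum_distrib_right mult.assoc)
    also have "\<dots> \<approx> (\<Sum>b \<in> Poly_Mapping.keys k. scalar (Poly_Mapping.lookup k b) *
        (if b = b0 then path_monomial a w' a else 0))"
    proof (intro cong_sum cong_left scalar_closed)
      fix b assume "b \<in> Poly_Mapping.keys k"
      then obtain u where "awalk u b w'" using k by blast
      from path_monomial_mult[OF acyc a this u0]
      show "path_monomial a w' b * ?t \<approx> (if b = b0 then path_monomial a w' a else 0)" by simp
    qed
    also have "\<dots> = (\<Sum>b \<in> Poly_Mapping.keys k. if b = b0 then scalar ?c * path_monomial a w' a else 0)"
      by (intro sum.cong) auto
    also have "\<dots> = scalar ?c * path_monomial a w' a"
      using b0 by simp
    also have "\<dots> \<approx> scalar ?c * vx w"
      by (intro cong_left cong_sym[OF vx_line_point[OF w a]]) simp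
    finally have "vx w * p * ?t * scalar (inverse ?c) \<approx> scalar ?c * vx w * scalar (inverse ?c)"
      by (intro cong_right) simp_all
    also have "\<dots> = (scalar ?c * scalar (inverse ?c)) * vx w"
      by (simp only: mult.assoc scalar_commute[of "inverse ?c" "vx w"])
    also have "\<dots> = vx w" using c by (simp add: mult_single)
    finally have "vx w * p * (?t * scalar (inverse ?c)) \<approx> vx w" by (simp add: mult.assoc)
    moreover have "?t * scalar (inverse ?c) \<in> NU"
      using NU_path_monomial[OF u0 a] by (intro NU_mult(1)) simp_all
    ultimately show ?thesis by blast
  qed
qed

section \<open>Idempotents at line points and the expansion of vertices\<close>

definition line_idempotents :: "('v, 'e, 'k) lpa_free set" where
  "line_idempotents = {path_monomial a w a |u a w. awalk u a w \<and> line_point E w}"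

lemma line_idempotents_NU: "q \<in> line_idempotents \<Longrightarrow> q \<in> NU"
  unfolding line_idempotents_def using NU_path_monomial by blast

lemma star_line_idempotent: "q \<in> line_idempotents \<Longrightarrow> star q = q"
  unfolding line_idempotents_def using star_path_monomial by blast

lemma line_idempotent_idem:
  assumes "acyclic_graph E" "q \<in> line_idempotents"
  shows "q * q \<approx> q"
  using assms(2) path_monomial_mult[OF assms(1)] unfolding line_idempotents_def by fastforce

text \<open>With \<open>q = a a*\<close>, the product \<open>q r\<close> is \<open>a\<close> times
  \<open>w (a* r)\<close>. The line point case gives \<open>w (a* r) s = w\<close>, and multiplying
  by \<open>a\<close> and \<open>a*\<close> on the two sides recovers \<open>q\<close>.\<close>

lemma line_idempotent_atomic:
  assumes acyc: "acyclic_graph E" and q: "q \<in> line_idempotents" and r: "r \<in> NU"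
  shows "q * r \<approx> 0 \<or> (\<exists>s \<in> NU. q * r * s \<approx> q)"
proof -
  obtain u a w where a: "awalk u a w" "line_point E w" "q = path_monomial a w a"
    using q unfolding line_idempotents_def by blast
  note [simp] = awalkD[OF a(1)] NU_closed[OF r]
  have p: "gpath a * r \<in> NU" using r by (intro NU_mult(2)) simp_all
  have eq: "q * r = epath a * (vx w * (gpath a * r))"
    unfolding a(3) path_monomial_def by (simp add: mult.assoc)
  from line_point_atomic[OF acyc a(2) p] show ?thesis
  proof (elim disjE bexE)
    assume "vx w * (gpath a * r) \<approx> 0"
    then have "epath a * (vx w * (gpath a * r)) \<approx> epath a * 0" by (intro cong_left) simp_all
    then show ?thesis unfolding eq by simp
  next
    fix s assume s: "s \<in> NU" "vx w * (gpath a * r) * s \<approx> vx w"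
    have "epath a * (vx w * (gpath a * r) * s) * gpath a \<approx> epath a * vx w * gpath a"
      by (intro cong_middle s(2)) simp_all
    then have "q * r * (s * gpath a) \<approx> q"
      unfolding eq by (simp add: a(3) path_monomial_def mult.assoc)
    moreover have "s * gpath a \<in> NU" using s(1) by (intro NU_mult(1)) simp_all
    ultimately show ?thesis by blast
  qed
qed

text \<open>The mirror image under \<open>star\<close>, which fixes \<open>q\<close>.\<close>

lemma line_idempotent_atomic_left:
  assumes acyc: "acyclic_graph E" and q: "q \<in> line_idempotents" and r: "r \<in> NU"
  shows "r * q \<approx> 0 \<or> (\<exists>s \<in> NU. s * (r * q) \<approx> q)"
proof -
  have "q * star r \<approx> 0 \<or> (\<exists>s \<in> NU. q * star r * s \<approx> q)"
    by (rule line_idempotent_atomic[OF acyc q star_nonunital[OF r]])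
  then show ?thesis
  proof (elim disjE bexE)
    assume "q * star r \<approx> 0"
    from cong_star[OF this] show ?thesis by (simp add: star_mult star_line_idempotent[OF q])
  next
    fix s assume s: "s \<in> NU" "q * star r * s \<approx> q"
    from cong_star[OF s(2)] have "star s * (r * q) \<approx> q"
      by (simp add: star_mult star_line_idempotent[OF q] mult.assoc)
    then show ?thesis using star_nonunital[OF s(1)] by blast
  qed
qed

definition line_expansion :: "'v \<Rightarrow> bool" where
  "line_expansion v \<longleftrightarrow> (\<exists>P. finite P \<and> (\<forall>(a, w) \<in> P. awalk v a w \<and> line_point E w) \<and>
     vx v \<approx> (\<Sum>(a, w) \<in> P. path_monomial a w a))"

lemma line_point_line_expansion:
  assumes "line_point E w"
  shows "line_expansion w"
proof -
  have "w \<in> verts E" using assms unfolding line_point_def by blast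
  then show ?thesis
    using assms unfolding line_expansion_def
    by (intro exI[of _ "{([], w)}"])
      (auto simp: awalk_Nil_iff path_monomial_def epath_simps gpath_simps)
qed

text \<open>The expansions of the heads are substituted into relation (4). Paths with different
  first edges are different, so the double sum is one sum over a set of pairs.\<close>

lemma regular_line_expansion:
  assumes v: "regular_vertex E v" and heads: "\<And>e. e \<in> out_arcs E v \<Longrightarrow> line_expansion (head E e)"
  shows "line_expansion v"
proof -
  have "\<forall>e \<in> out_arcs E v. \<exists>P. finite P \<and> (\<forall>(a, w) \<in> P. awalk (head E e) a w \<and> line_point E w) \<and>
     vx (head E e) \<approx> (\<Sum>(a, w) \<in> P. path_monomial a w a)"
    using heads unfolding line_expansion_def by blast
  then obtain P where P: "\<And>e. e \<in> out_arcs E v \<Longrightarrow> finite (P e)"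
    "\<And>e a w. \<lbrakk>e \<in> out_arcs E v; (a, w) \<in> P e\<rbrakk> \<Longrightarrow> awalk (head E e) a w \<and> line_point E w"
    "\<And>e. e \<in> out_arcs E v \<Longrightarrow> vx (head E e) \<approx> (\<Sum>(a, w) \<in> P e. path_monomial a w a)"
    unfolding bchoice_iff by fast
  have fin: "finite (out_arcs E v)" using v unfolding regular_vertex_def by blast
  let ?h = "\<lambda>e (a, w). (e # a, w)"
  let ?P = "\<Union>e \<in> out_arcs E v. ?h e ` P e"
  have "vx v \<approx> (\<Sum>e \<in> out_arcs E v. ed e * vx (head E e) * gh e)" by (rule vx_expand[OF v])
  also have "\<dots> \<approx> (\<Sum>e \<in> out_arcs E v. ed e * (\<Sum>(a, w) \<in> P e. path_monomial a w a) * gh e)"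
    by (intro cong_sum cong_middle P(3)) auto
  also have "\<dots> = (\<Sum>e \<in> out_arcs E v. \<Sum>(a, w) \<in> P e. path_monomial (e # a) w (e # a))"
    by (simp add: sum_distrib_left sum_distrib_right case_prod_unfold path_monomial_def
        epath_simps gpath_simps mult.assoc)
  also have "\<dots> = (\<Sum>e \<in> out_arcs E v. \<Sum>(a, w) \<in> ?h e ` P e. path_monomial a w a)"
  proof (rule sum.cong[OF refl])
    fix e
    have "inj_on (?h e) (P e)" by (auto simp: inj_on_def)
    then show "(\<Sum>(a, w) \<in> P e. path_monomial (e # a) w (e # a)) =
        (\<Sum>(a, w) \<in> ?h e ` P e. path_monomial a w a)"
      by (simp add: sum.reindex case_prod_unfold)
  qed
  also have "\<dots> = (\<Sum>(a, w) \<in> ?P. path_monomial a w a)"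
    using fin P(1) by (intro sum.UNION_disjoint[symmetric]) auto
  finally have "vx v \<approx> (\<Sum>(a, w) \<in> ?P. path_monomial a w a)" .
  moreover have "finite ?P" using fin P(1) by auto
  moreover have "\<forall>(a, w) \<in> ?P. awalk v a w \<and> line_point E w"
    using P(2) by (auto simp: awalk_Cons_iff)
  ultimately show ?thesis unfolding line_expansion_def by blast
qed

text \<open>A vertex without expansion is not a line point, in particular not a sink, and one of its
  edges leads to another vertex without expansion. Continuing forever produces an infinite path that
  meets no line point.\<close>

lemma all_line_expansion:
  assumes rf: "row_finite E" and acyc: "acyclic_graph E"
    and ends: "\<forall>p. infinite_path E p \<longrightarrow> ends_in_sink E p" and v: "v \<in> verts E"
  shows "line_expansion v"
proof (rule ccontr)
  assume bad: "\<not> line_expansion v"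
  have next_arc: "\<exists>e \<in> out_arcs E u. \<not> line_expansion (head E e)"
    if u: "u \<in> verts E" "\<not> line_expansion u" for u
  proof -
    have "out_arcs E u \<noteq> {}"
    proof
      assume emp: "out_arcs E u = {}"
      have "x = u" if "awalk u p x" for p x
        using that emp by (cases p) (auto simp: awalk_Nil_iff awalk_Cons_iff)
      then have "tree E u \<subseteq> {u}" unfolding tree_def by blast
      moreover have "\<not> bifurcation E u" using emp unfolding bifurcation_def by simp
      moreover have "\<not> on_cycle E u" using acyc unfolding on_cycle_def acyclic_graph_def by blast
      ultimately have "line_point E u" using u(1) unfolding line_point_def by blast
      then show False using line_point_line_expansion u(2) by blast
    qed
    then have "regular_vertex E u"
      using rf u(1) unfolding regular_vertex_def row_finite_def by blast
    then show ?thesis using regular_line_expansion u(2) by blast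
  qed
  define nx where "nx u = (SOME e. e \<in> out_arcs E u \<and> \<not> line_expansion (head E e))" for u
  have nx: "nx u \<in> out_arcs E u \<and> \<not> line_expansion (head E (nx u))"
    if "u \<in> verts E" "\<not> line_expansion u" for u
    unfolding nx_def using next_arc[OF that] by (rule someI2_bex) blast
  define vs where "vs i = ((\<lambda>u. head E (nx u)) ^^ i) v" for i
  have vs: "vs i \<in> verts E \<and> \<not> line_expansion (vs i)" for i
  proof (induction i)
    case 0
    then show ?case using v bad by (simp add: vs_def)
  next
    case (Suc i)
    then show ?case using nx[of "vs i"] by (auto simp: vs_def)
  qed
  have vs_Suc: "vs (Suc i) = head E (nx (vs i))" for i by (simp add: vs_def)
  have tl: "tail E (nx (vs i)) = vs i" "nx (vs i) \<in> arcs E" for i using nx[of "vs i"] vs by auto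
  have "infinite_path E (\<lambda>i. nx (vs i))"
    unfolding infinite_path_def using tl by (simp only: vs_Suc[symmetric]) simp
  then obtain i where "line_point E (vs i)" using ends tl unfolding ends_in_sink_def by metis
  then show False using line_point_line_expansion vs by blast
qed

lemma generate_sum:
  assumes "X \<subseteq> carrier L" "finite S" "\<And>i. i \<in> S \<Longrightarrow> f i \<in> NU \<and> cl (f i) \<in> generate (add_monoid L) X"
  shows "cl (sum f S) \<in> generate (add_monoid L) X"
  using assms(2,3)
proof (induction S rule: finite_induct)
  case empty
  then show ?case using generate.one[of "add_monoid L" X] by (simp add: L_zero)
next
  case (insert i S)
  then have "cl (f i) \<oplus>\<^bsub>L\<^esub> cl (sum f S) \<in> generate (add_monoid L) X"
    using generate.eng[of "cl (f i)" "add_monoid L" X "cl (sum f S)"] by simp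
  then show ?case using insert by (simp add: L_add NU_closed NU_sum)
qed

lemma line_idempotents_generate:
  assumes all: "\<And>v. v \<in> verts E \<Longrightarrow> line_expansion v" and x: "x \<in> carrier L"
  shows "x \<in> generate (add_monoid L) {q \<otimes>\<^bsub>L\<^esub> a |q a. q \<in> cl ` line_idempotents \<and> a \<in> carrier L}"
    and "x \<in> generate (add_monoid L) {a \<otimes>\<^bsub>L\<^esub> q |q a. q \<in> cl ` line_idempotents \<and> a \<in> carrier L}"
proof -
  let ?X = "{q \<otimes>\<^bsub>L\<^esub> a |q a. q \<in> cl ` line_idempotents \<and> a \<in> carrier L}"
  let ?Y = "{a \<otimes>\<^bsub>L\<^esub> q |q a. q \<in> cl ` line_idempotents \<and> a \<in> carrier L}"
  interpret L: nonunital_ring L by (rule nonunital_ring_L)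
  have XY: "?X \<subseteq> carrier L" "?Y \<subseteq> carrier L"
    using line_idempotents_NU L.mult_closed unfolding L_carrier by blast+
  obtain p where p: "p \<in> NU" "x = cl p" using x unfolding L_carrier by blast
  obtain V where V: "finite V" "V \<subseteq> verts E"
    "(\<Sum>v \<in> V. vx v) * p \<approx> p" "p * (\<Sum>v \<in> V. vx v) \<approx> p"
    using local_units[OF p(1)] by (metis order_refl)
  note [simp] = NU_closed[OF p(1)]
  have vx: "cl (vx v * p) \<in> generate (add_monoid L) ?X \<and> cl (p * vx v) \<in> generate (add_monoid L) ?Y"
    if v: "v \<in> verts E" for v
  proof -
    obtain P where P: "finite P" "\<forall>(a, w) \<in> P. awalk v a w \<and> line_point E w"
      "vx v \<approx> (\<Sum>(a, w) \<in> P. path_monomial a w a)"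
      using all[OF v] unfolding line_expansion_def by blast
    let ?f = "\<lambda>(a, w). path_monomial a w a"
    have q: "?f i \<in> line_idempotents" if "i \<in> P" for i
      using P(2) that unfolding line_idempotents_def by fastforce
    have qc: "?f i \<in> carrier F" "?f i \<in> NU" if "i \<in> P" for i
      using line_idempotents_NU[OF q[OF that]] NU_closed by auto
    have "cl (vx v * p) = cl (\<Sum>i \<in> P. ?f i * p)"
      using cong_right[OF P(3), of p] v qc cl_eq_iff[of "vx v * p" "\<Sum>i \<in> P. ?f i * p"]
      by (simp add: sum_distrib_right)
    moreover have "cl (\<Sum>i \<in> P. ?f i * p) \<in> generate (add_monoid L) ?X"
    proof (rule generate_sum[OF XY(1) P(1)])
      fix i assume i: "i \<in> P"
      have "cl (?f i * p) = cl (?f i) \<otimes>\<^bsub>L\<^esub> cl p" using qc[OF i] by (simp add: L_mult)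
      then have "cl (?f i * p) \<in> ?X" using q[OF i] p(1) unfolding L_carrier by blast
      then show "?f i * p \<in> NU \<and> cl (?f i * p) \<in> generate (add_monoid L) ?X"
        using qc[OF i] by (simp add: NU_mult generate.incl)
    qed
    moreover have "cl (p * vx v) = cl (\<Sum>i \<in> P. p * ?f i)"
      using cong_left[OF P(3), of p] v qc cl_eq_iff[of "p * vx v" "\<Sum>i \<in> P. p * ?f i"]
      by (simp add: sum_distrib_left)
    moreover have "cl (\<Sum>i \<in> P. p * ?f i) \<in> generate (add_monoid L) ?Y"
    proof (rule generate_sum[OF XY(2) P(1)])
      fix i assume i: "i \<in> P"
      have "cl (p * ?f i) = cl p \<otimes>\<^bsub>L\<^esub> cl (?f i)" using qc[OF i] by (simp add: L_mult)
      then have "cl (p * ?f i) \<in> ?Y" using q[OF i] p(1) unfolding L_carrier by blast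
      then show "p * ?f i \<in> NU \<and> cl (p * ?f i) \<in> generate (add_monoid L) ?Y"
        using qc[OF i] by (simp add: NU_mult generate.incl)
    qed
    ultimately show ?thesis by simp
  qed
  have s: "(\<Sum>v \<in> V. vx v) \<in> carrier F" using V(2) by (intro sum_closed) auto
  have "x = cl (\<Sum>v \<in> V. vx v * p)" "x = cl (\<Sum>v \<in> V. p * vx v)"
    using V(3,4)[THEN cong_sym] s p
    by (simp_all add: cl_eq_iff sum_distrib_left[symmetric] sum_distrib_right[symmetric])
  moreover have "cl (\<Sum>v \<in> V. vx v * p) \<in> generate (add_monoid L) ?X"
    "cl (\<Sum>v \<in> V. p * vx v) \<in> generate (add_monoid L) ?Y"
    using V(2) vx p(1) by (intro generate_sum XY V(1); blast intro: NU_mult NU_vx NU_closed)+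
  ultimately show "x \<in> generate (add_monoid L) ?X" "x \<in> generate (add_monoid L) ?Y" by simp_all
qed

lemma atomic_rings:
  assumes acyc: "acyclic_graph E" and all: "\<And>v. v \<in> verts E \<Longrightarrow> line_expansion v"
  shows "atomic_ring L (cl ` line_idempotents)" "atomic_ring (opp_ring L) (cl ` line_idempotents)"
proof -
  have sub: "cl ` line_idempotents \<subseteq> carrier L"
    using line_idempotents_NU unfolding L_carrier by blast
  have qc: "q \<in> carrier F" if "q \<in> line_idempotents" for q using NU_closed line_idempotents_NU that
    by blast
  have idem: "q \<otimes>\<^bsub>L\<^esub> q = q" if q: "q \<in> cl ` line_idempotents" for q
  proof -
    obtain q' where "q' \<in> line_idempotents" "q = cl q'" using q by blast
    then show ?thesis using line_idempotent_idem[OF acyc] qc by (simp add: L_mult cl_eq_iff)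
  qed
  have left: "r \<otimes>\<^bsub>L\<^esub> q = \<zero>\<^bsub>L\<^esub> \<or> (\<exists>s \<in> carrier L. s \<otimes>\<^bsub>L\<^esub> (r \<otimes>\<^bsub>L\<^esub> q) = q)"
    if qr: "q \<in> cl ` line_idempotents" "r \<in> carrier L" for q r
  proof -
    obtain q' r' where *: "q' \<in> line_idempotents" "q = cl q'" "r' \<in> NU" "r = cl r'"
      using qr unfolding L_carrier by blast
    note [simp] = qc[OF *(1)] NU_closed[OF *(3)]
    from line_idempotent_atomic_left[OF acyc *(1,3)] show ?thesis
    proof (elim disjE bexE)
      assume "r' * q' \<approx> 0"
      then show ?thesis by (simp add: * L_mult L_zero cl_eq_iff)
    next
      fix s assume "s \<in> NU" "s * (r' * q') \<approx> q'"
      then show ?thesis by (intro disjI2 bexI[of _ "cl s"])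
        (auto simp: * L_mult cl_eq_iff L_carrier NU_closed)
    qed
  qed
  have right: "q \<otimes>\<^bsub>L\<^esub> r = \<zero>\<^bsub>L\<^esub> \<or> (\<exists>s \<in> carrier L. (q \<otimes>\<^bsub>L\<^esub> r) \<otimes>\<^bsub>L\<^esub> s = q)"
    if qr: "q \<in> cl ` line_idempotents" "r \<in> carrier L" for q r
  proof -
    obtain q' r' where *: "q' \<in> line_idempotents" "q = cl q'" "r' \<in> NU" "r = cl r'"
      using qr unfolding L_carrier by blast
    note [simp] = qc[OF *(1)] NU_closed[OF *(3)]
    from line_idempotent_atomic[OF acyc *(1,3)] show ?thesis
    proof (elim disjE bexE)
      assume "q' * r' \<approx> 0"
      then show ?thesis by (simp add: * L_mult L_zero cl_eq_iff)
    next
      fix s assume "s \<in> NU" "q' * r' * s \<approx> q'"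
      then show ?thesis by (intro disjI2 bexI[of _ "cl s"])
        (auto simp: * L_mult cl_eq_iff L_carrier NU_closed)
    qed
  qed
  show "atomic_ring L (cl ` line_idempotents)"
    using nonunital_ring_L sub idem left line_idempotents_generate(1)[OF all]
    unfolding atomic_ring_def atomic_ring_axioms_def by (intro conjI) auto
  have "generate (add_monoid (opp_ring L)) X = generate (add_monoid L) X" for X
    by (simp add: opp_ring_def)
  then show "atomic_ring (opp_ring L) (cl ` line_idempotents)"
    using nonunital_ring.nonunital_ring_opp[OF nonunital_ring_L] sub idem right
      line_idempotents_generate(2)[OF all]
    unfolding atomic_ring_def atomic_ring_axioms_def by (intro conjI) (auto simp: opp_ring_def)
qed

end

section \<open>A representation\<close>

text \<open>
  The algebra acts on the vector space with basis \<open>verts E \<times> \<nat> \<times> \<int>\<close>.  An edge \<open>e\<close> maps the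
  copy of \<open>\<nat>\<close> at its head injectively into the copy at its tail, as the residue class of \<open>idx e\<close>
  modulo the number of edges leaving the tail; the integer coordinate records the degree.  If \<open>idx\<close>
  vanishes on the edges of a cycle, the cycle maps \<open>(u, 0, m)\<close> to \<open>(u, 0, m + n)\<close>.
\<close>

fun act :: "('v, 'e) pre_digraph \<Rightarrow> ('e \<Rightarrow> nat) \<Rightarrow> ('v, 'e) lpa_gen \<Rightarrow>
    'v \<times> nat \<times> int \<Rightarrow> ('v \<times> nat \<times> int) option" where
  "act E idx (Vertex v) (u, k, m) = (if u = v then Some (u, k, m) else None)"
| "act E idx (Edge e) (u, k, m) =
    (if u = head E e then Some (tail E e, card (out_arcs E (tail E e)) * k + idx e, m + 1) else None)"
| "act E idx (Ghost e) (u, k, m) =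
    (if u = tail E e \<and> k mod card (out_arcs E (tail E e)) = idx e
     then Some (head E e, k div card (out_arcs E (tail E e)), m - 1) else None)"

fun act_word :: "('v, 'e) pre_digraph \<Rightarrow> ('e \<Rightarrow> nat) \<Rightarrow> ('v, 'e) lpa_gen list \<Rightarrow>
    'v \<times> nat \<times> int \<Rightarrow> ('v \<times> nat \<times> int) option" where
  "act_word E idx [] x = Some x"
| "act_word E idx (g # gs) x = Option.bind (act_word E idx gs x) (act E idx g)"

lemma act_word_append:
  "act_word E idx (gs @ hs) x = Option.bind (act_word E idx hs x) (act_word E idx gs)"
  by (induction gs) (auto simp: Option.bind_assoc split: Option.bind_split)

lemma act_degree:
  assumes "act E idx g (u, k, m) = Some (u', k', m')"
  shows "\<bar>m' - m\<bar> \<le> 1"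
  using assms by (cases g) (auto split: if_splits)

lemma act_word_degree:
  "act_word E idx gs (u, k, m) = Some (u', k', m') \<Longrightarrow> \<bar>m' - m\<bar> \<le> int (length gs)"
proof (induction gs arbitrary: u' k' m')
  case (Cons g gs)
  then obtain u1 k1 m1 where "act_word E idx gs (u, k, m) = Some (u1, k1, m1)"
    "act E idx g (u1, k1, m1) = Some (u', k', m')"
    by (auto simp: bind_eq_Some_conv)
  then have "\<bar>m1 - m\<bar> \<le> int (length gs)" "\<bar>m' - m1\<bar> \<le> 1"
    using Cons.IH[of u1 k1 m1] act_degree[of E idx g u1 k1 m1 u' k' m'] by simp_all
  then show ?case by simp
qed simp

definition pullback :: "('x \<Rightarrow> 'k::zero) \<Rightarrow> 'x option \<Rightarrow> 'k" where
  "pullback f y = (case y of None \<Rightarrow> 0 | Some x \<Rightarrow> f x)"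

lemma pullback_simps [simp]: "pullback f None = 0" "pullback f (Some x) = f x"
  by (simp_all add: pullback_def)

text \<open>The transpose of the action on basis vectors. It applies to arbitrary functions on the
  basis, also those of infinite support, and is a right action: \<open>p * q\<close> applies
  \<open>p\<close> first. A word undefined at a basis vector contributes zero.\<close>

definition dual_act :: "('v, 'e) pre_digraph \<Rightarrow> ('e \<Rightarrow> nat) \<Rightarrow> ('v, 'e, 'k::field) lpa_free \<Rightarrow>
    ('v \<times> nat \<times> int \<Rightarrow> 'k) \<Rightarrow> 'v \<times> nat \<times> int \<Rightarrow> 'k" where
  "dual_act E idx p f x =
    (\<Sum>w \<in> Poly_Mapping.keys p. Poly_Mapping.lookup p w * pullback f (act_word E idx (letters w) x))"

lemma dual_act_zero [simp]: "dual_act E idx 0 f x = 0"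
  by (simp add: dual_act_def)

lemma dual_act_add: "dual_act E idx (p + q) f x = dual_act E idx p f x + dual_act E idx q f x"
  unfolding dual_act_def by (rule setsum_keys_plus_distrib) (simp_all add: distrib_right)

lemma dual_act_single:
  "dual_act E idx (Poly_Mapping.single w c) f x = c * pullback f (act_word E idx (letters w) x)"
  by (simp add: dual_act_def)

lemma dual_act_diff: "dual_act E idx (p - q) f x = dual_act E idx p f x - dual_act E idx q f x"
  using dual_act_add[of E idx "p - q" q f x] by simp

lemma dual_act_uminus: "dual_act E idx (- p) f x = - dual_act E idx p f x"
  using dual_act_diff[of E idx 0 p f x] by simp

lemma dual_act_sum: "dual_act E idx (\<Sum>i \<in> S. g i) f x = (\<Sum>i \<in> S. dual_act E idx (g i) f x)"
  by (induction S rule: infinite_finite_induct) (auto simp: dual_act_add)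

lemma dual_act_fun_zero [simp]: "dual_act E idx p (\<lambda>_. 0) x = 0"
  unfolding dual_act_def by (intro sum.neutral ballI) (simp add: pullback_def split: option.split)

lemma dual_act_fun_add:
  "dual_act E idx p (\<lambda>x. f x + g x) x = dual_act E idx p f x + dual_act E idx p g x"
  unfolding dual_act_def sum.distrib[symmetric]
  by (intro sum.cong refl) (auto simp: pullback_def distrib_left split: option.split)

lemma dual_act_mult: "dual_act E idx (p * q) f x = dual_act E idx q (dual_act E idx p f) x"
proof (rule poly_mapping_induct_keys[of p "\<lambda>_. True"])
  fix w c
  show "dual_act E idx (Poly_Mapping.single w c * q) f x =
      dual_act E idx q (dual_act E idx (Poly_Mapping.single w c) f) x"
  proof (rule poly_mapping_induct_keys[of q "\<lambda>_. True"])
    fix w' d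
    show "dual_act E idx (Poly_Mapping.single w c * Poly_Mapping.single w' d) f x =
        dual_act E idx (Poly_Mapping.single w' d) (dual_act E idx (Poly_Mapping.single w c) f) x"
      by (cases "act_word E idx (letters w') x")
        (auto simp: mult_single dual_act_single plus_free_word_def act_word_append)
  qed (simp_all add: distrib_left dual_act_add)
next
  fix p p'
  assume "dual_act E idx (p * q) f x = dual_act E idx q (dual_act E idx p f) x"
    "dual_act E idx (p' * q) f x = dual_act E idx q (dual_act E idx p' f) x"
  then show "dual_act E idx ((p + p') * q) f x = dual_act E idx q (dual_act E idx (p + p') f) x"
    by (simp add: distrib_right dual_act_add dual_act_add[abs_def] dual_act_fun_add)
next
  have "dual_act E idx 0 f = (\<lambda>_. 0)" by (rule ext) simp
  then show "dual_act E idx (0 * q) f x = dual_act E idx q (dual_act E idx 0 f) x" by simp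
qed simp

lemma dual_act_gens:
  "dual_act E idx (vx v) f (u, k, m) = (if u = v then f (u, k, m) else 0)"
  "dual_act E idx (ed e) f (u, k, m) =
    (if u = head E e then f (tail E e, card (out_arcs E (tail E e)) * k + idx e, m + 1) else 0)"
  "dual_act E idx (gh e) f (u, k, m) =
    (if u = tail E e \<and> k mod card (out_arcs E (tail E e)) = idx e
     then f (head E e, k div card (out_arcs E (tail E e)), m - 1) else 0)"
  by (simp_all add: vx_def ed_def gh_def dual_act_single)

text \<open>Numbering the edges that leave a vertex by all residues makes their images partition the
  copy of \<nat> at that vertex, which is what relations (3) and (4) require.\<close>

definition edge_index :: "('v, 'e) pre_digraph \<Rightarrow> ('e \<Rightarrow> nat) \<Rightarrow> bool" where
  "edge_index E idx \<longleftrightarrow> (\<forall>v \<in> verts E. bij_betw idx (out_arcs E v) {..<card (out_arcs E v)})"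

text \<open>Intended for the edges \<open>A\<close> leaving a vertex and the edges \<open>S\<close>
  of a cycle: the at most one common edge receives the number \<open>0\<close>.\<close>

lemma bij_betw_lessThan_card_with_zero:
  assumes "finite A" "\<And>a b. \<lbrakk>a \<in> A \<inter> S; b \<in> A \<inter> S\<rbrakk> \<Longrightarrow> a = b"
  shows "\<exists>h. bij_betw h A {..<card A} \<and> (\<forall>a \<in> A \<inter> S. h a = 0)"
proof (cases "A \<inter> S = {}")
  case True
  then show ?thesis using ex_bij_betw_finite_nat[OF assms(1)] by (auto simp: atLeast0LessThan)
next
  case False
  then obtain a where a: "a \<in> A" "A \<inter> S = {a}" using assms(2) by blast
  obtain g where g: "bij_betw g (A - {a}) {0..<card (A - {a})}"
    using ex_bij_betw_finite_nat[of "A - {a}"] assms(1) by auto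
  let ?h = "\<lambda>x. if x = a then 0 else Suc (g x)"
  have card: "card A = Suc (card (A - {a}))" by (rule card.remove[OF assms(1) a(1)])
  have "inj_on ?h A" using g unfolding bij_betw_def by (auto simp: inj_on_def)
  moreover have "?h ` A = {..<card A}"
  proof -
    have "?h ` A = insert 0 (Suc ` (g ` (A - {a})))" using a(1) by (auto simp: image_iff)
    also have "\<dots> = {..<card A}"
      using g unfolding bij_betw_def card by (simp add: lessThan_Suc_eq_insert_0 atLeast0LessThan)
    finally show ?thesis .
  qed
  ultimately show ?thesis using a(2) unfolding bij_betw_def by (intro exI[of _ ?h]) auto
qed

lemma edge_index_exists:
  assumes "row_finite E" "\<And>e f. \<lbrakk>e \<in> S; f \<in> S; tail E e = tail E f\<rbrakk> \<Longrightarrow> e = f"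
  obtains idx where "edge_index E idx" "\<And>e. \<lbrakk>e \<in> S; e \<in> arcs E; tail E e \<in> verts E\<rbrakk> \<Longrightarrow> idx e = 0"
proof -
  have "\<exists>h. bij_betw h (out_arcs E v) {..<card (out_arcs E v)} \<and> (\<forall>e \<in> out_arcs E v \<inter> S. h e = 0)"
    if "v \<in> verts E" for v
    using that assms by (intro bij_betw_lessThan_card_with_zero) (auto simp: row_finite_def)
  then obtain h where h: "\<And>v. v \<in> verts E \<Longrightarrow> bij_betw (h v) (out_arcs E v) {..<card (out_arcs E v)}"
    "\<And>v e. \<lbrakk>v \<in> verts E; e \<in> out_arcs E v \<inter> S\<rbrakk> \<Longrightarrow> h v e = 0"
    by metis
  let ?idx = "\<lambda>e. h (tail E e) e"
  have "edge_index E ?idx"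
    unfolding edge_index_def
  proof
    fix v assume v: "v \<in> verts E"
    show "bij_betw ?idx (out_arcs E v) {..<card (out_arcs E v)}"
      using h(1)[OF v] by (subst bij_betw_cong[where g = "h v"]) auto
  qed
  then show ?thesis using that[of ?idx] h(2) by auto
qed

context lpa
begin

lemma dual_act_relations:
  assumes rf: "row_finite E" and idx: "edge_index E idx" and p: "p \<in> lpa_relations E"
  shows "dual_act E idx p f x = 0"
proof -
  obtain u k m where x: "x = (u, k, m)" by (cases x)
  have inj: "e = e'" if "e \<in> arcs E" "e' \<in> arcs E" "tail E e = tail E e'" "idx e = idx e'" for e e'
    using idx that tail_in_verts unfolding edge_index_def bij_betw_def inj_on_def by fastforce
  have lt: "idx e < card (out_arcs E (tail E e))" if "e \<in> arcs E" for e
    using idx that tail_in_verts unfolding edge_index_def bij_betw_def by fastforce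
  have div_mod: "idx e mod card (out_arcs E w) = idx e"
    "(card (out_arcs E w) * k + idx e) div card (out_arcs E w) = k"
    if "e \<in> arcs E" "tail E e = w" for e w k
    using lt[OF that(1)] that(2) by simp_all
  \<comment> \<open>Relation (4): exactly one edge leaving \<open>v\<close> has the index
    \<open>k mod card (out_arcs E v)\<close>; its term returns \<open>f (u, k, m)\<close> if
    \<open>u = v\<close>, and all other terms vanish.\<close>
  have ck2: "(\<Sum>e \<in> out_arcs E v. dual_act E idx (gh e) (dual_act E idx (ed e) f) (u, k, m)) =
      (if u = v then f (u, k, m) else 0)" if v: "regular_vertex E v" for v
  proof -
    let ?n = "card (out_arcs E v)"
    have v': "v \<in> verts E" "finite (out_arcs E v)" "?n \<noteq> 0"
      using v unfolding regular_vertex_def by (simp_all add: card_eq_0_iff del: in_out_arcs_conv)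
    have "idx ` out_arcs E v = {..<?n}"
      using idx v'(1) unfolding edge_index_def bij_betw_def by blast
    then have "k mod ?n \<in> idx ` out_arcs E v" using v'(3) by simp
    then obtain e0 where e0: "e0 \<in> out_arcs E v" "idx e0 = k mod ?n" by auto
    have "(\<Sum>e \<in> out_arcs E v. dual_act E idx (gh e) (dual_act E idx (ed e) f) (u, k, m)) =
        (\<Sum>e \<in> out_arcs E v. if e = e0 then (if u = v then f (u, k, m) else 0) else 0)"
    proof (rule sum.cong[OF refl])
      fix e assume e: "e \<in> out_arcs E v"
      then have te: "e \<in> arcs E" "tail E e = v" "e0 \<in> arcs E" "tail E e0 = v"
        using e0(1) by simp_all
      have iff: "k mod ?n = idx e \<longleftrightarrow> e = e0" using inj[OF te(1,3)] te(2,4) e0(2) by metis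
      show "dual_act E idx (gh e) (dual_act E idx (ed e) f) (u, k, m) =
          (if e = e0 then (if u = v then f (u, k, m) else 0) else 0)"
      proof (cases "e = e0")
        case True
        have "?n * (k div ?n) + idx e0 = k" unfolding e0(2) by simp
        then show ?thesis using True e0(2) by (simp add: dual_act_gens te(4))
      next
        case False
        then show ?thesis using iff by (simp add: dual_act_gens te(2))
      qed
    qed
    then show ?thesis using e0(1) v'(2) by simp
  qed
  show ?thesis
    using p[unfolded lpa_relations_def] unfolding x
    by (elim UnE CollectE exE conjE)
      (auto simp: dual_act_diff dual_act_mult dual_act_sum dual_act_gens(1) ck2 simp del: in_out_arcs_conv,
        auto simp: dual_act_gens div_mod dest: inj)
qed

text \<open>The elements acting as zero on all functions form an ideal containing the relations;
  quantifying over \<open>f\<close> is what makes it closed under multiplication on both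
  sides.\<close>

lemma dual_act_I:
  assumes rf: "row_finite E" and idx: "edge_index E idx" and p: "p \<in> I"
  shows "dual_act E idx p f x = 0"
proof -
  let ?J = "{p \<in> carrier F. \<forall>f x. dual_act E idx p f x = 0}"
  interpret F: ring F by (rule ring_free_algebra)
  have z: "dual_act E idx q (dual_act E idx p f) x = 0" if "\<forall>f x. dual_act E idx p f x = 0"
    for p q :: "('v, 'e, 'k) lpa_free" and f x
  proof -
    have "dual_act E idx p f = (\<lambda>_. 0)" using that by blast
    then show ?thesis by simp
  qed
  have "ideal ?J F"
  proof (rule idealI[OF ring_free_algebra])
    show "subgroup ?J (add_monoid F)"
    proof
      fix x assume "x \<in> ?J"
      then show "inv\<^bsub>add_monoid F\<^esub> x \<in> ?J"
        using a_inv_free_algebra[of x E] by (simp add: a_inv_def dual_act_uminus)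
    qed (auto simp: dual_act_add)
  qed (auto simp: dual_act_mult z)
  then show ?thesis
    using I_minimal[of ?J] dual_act_relations[OF rf idx] relations_closed p by blast
qed

text \<open>The constant function \<open>1\<close> separates the vertex from zero, so the relations
  do not collapse it.\<close>

lemma vx_nonzero:
  assumes rf: "row_finite E" and v: "v \<in> verts E"
  shows "\<not> vx v \<approx> 0"
proof
  assume "vx v \<approx> 0"
  then have "vx v \<in> I" unfolding cong_def by simp
  moreover obtain idx where "edge_index E idx" using edge_index_exists[OF rf, of "{}"] by auto
  ultimately have "dual_act E idx (vx v) (\<lambda>_. 1 :: 'k) (v, 0, 0) = 0"
    using dual_act_I[OF rf] by blast
  then show False by (simp add: dual_act_gens)
qed

text \<open>Edges act from head to tail, so a walk from \<open>v\<close> to \<open>u\<close> carries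
  the copy of \<nat> at \<open>u\<close> into that at \<open>v\<close>. The number \<open>0\<close>
  is kept when all indices vanish, because each step multiplies by a count and adds the
  index.\<close>

lemma act_word_walk:
  assumes "awalk v c u"
  shows "\<exists>k'. act_word E idx (map Edge c) (u, k, m) = Some (v, k', m + int (length c)) \<and>
    (k = 0 \<longrightarrow> (\<forall>e \<in> set c. idx e = 0) \<longrightarrow> k' = 0)"
  using assms
proof (induction c arbitrary: v)
  case Nil
  then show ?case by (simp add: awalk_Nil_iff)
next
  case (Cons e c)
  then have e: "e \<in> arcs E" "v = tail E e" "awalk (head E e) c u" by (auto simp: awalk_Cons_iff)
  from Cons.IH[OF e(3)] obtain k' where
    "act_word E idx (map Edge c) (u, k, m) = Some (head E e, k', m + int (length c))"
    "k = 0 \<longrightarrow> (\<forall>e \<in> set c. idx e = 0) \<longrightarrow> k' = 0" by blast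
  then show ?case using e(2) by auto
qed

lemma act_word_walk_None:
  assumes "awalk v c u" "c \<noteq> []" "u' \<noteq> u"
  shows "act_word E idx (map Edge c) (u', k, m) = None"
  using assms(2,1)
proof (induction c arbitrary: v rule: list_nonempty_induct)
  case (single e)
  then show ?case using assms(3) by (auto simp: awalk_Cons_iff awalk_Nil_iff)
next
  case (cons e c)
  then show ?case by (auto simp: awalk_Cons_iff)
qed

text \<open>\<open>cycle\<close> demands that the vertices after the first be distinct; since the
  last one equals the first, these are exactly the tails of the edges.\<close>

lemma cycle_distinct_tails:
  assumes "cycle c"
  obtains v where "awalk v c v" "c \<noteq> []" "distinct (map (tail E) c)"
proof -
  obtain v where v: "awalk v c v" "distinct (tl (awalk_verts v c))" "c \<noteq> []"
    using assms unfolding cycle_def by blast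
  then obtain e c' where c: "c = e # c'" by (cases c) auto
  have "awlast v c = v" using v(1) by (auto simp: awalk_def awlast_if_cas)
  moreover have "awalk_verts v c = map (tail E) c @ [head E (last c)]"
    using v by (simp add: awalk_verts_conv)
  ultimately have "head E (last c) = v" "tl (awalk_verts v c) = map (tail E) c' @ [v]"
    unfolding c by auto
  moreover have "tail E e = v" using v(1) c by (simp add: awalk_Cons_iff)
  ultimately have "distinct (map (tail E) c)" using v(2) unfolding c by simp
  then show ?thesis using that v by blast
qed

text \<open>
  For a cycle \<open>c\<close> of length \<open>n\<close> at \<open>v\<close> let \<open>a = v - c = a b a\<close>, and let \<open>f\<close> be the indicator
  function of the degrees \<open>m \<ge> 0\<close>.  Then \<open>h = f a\<close> has bounded support, hence so has \<open>H = h b\<close>; but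
  \<open>H(v, 0, m) - H(v, 0, m + n)\<close> is \<open>-1\<close> for \<open>m = -n\<close> and \<open>0\<close> for all other multiples \<open>m\<close> of \<open>n\<close>.
\<close>

lemma von_neumann_regular_imp_acyclic:
  assumes rf: "row_finite E" and reg: "von_neumann_regular L"
  shows "acyclic_graph E"
proof (rule ccontr)
  assume "\<not> acyclic_graph E"
  then obtain c where "cycle c" unfolding acyclic_graph_def by blast
  then obtain v where c: "awalk v c v" "c \<noteq> []" "distinct (map (tail E) c)"
    by (rule cycle_distinct_tails)
  have "e = f" if "e \<in> set c" "f \<in> set c" "tail E e = tail E f" for e f
    using c(3) that by (simp add: distinct_map inj_on_def)
  then obtain idx where idx: "edge_index E idx"
    "\<And>e. \<lbrakk>e \<in> set c; e \<in> arcs E; tail E e \<in> verts E\<rbrakk> \<Longrightarrow> idx e = 0"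
    using edge_index_exists[OF rf, of "set c"] by blast
  have idx0: "\<forall>e \<in> set c. idx e = 0" using idx(2) awalkD(1)[OF c(1)] tail_in_verts by blast
  let ?n = "int (length c)"
  have n: "?n > 0" using c(2) by simp
  define a :: "('v, 'e, 'k) lpa_free" where "a = vx v - epath c"
  have vv: "v \<in> verts E" using awalkD[OF c(1)] by blast
  have "epath c \<in> NU"
    using c(2) awalkD(1)[OF c(1)] unfolding epath_def lpa_gens_def by (intro NU_monomial)
      (auto simp: lpa_gens_def)
  then have a: "a \<in> NU"
    unfolding a_def using NU_add[OF NU_vx[OF vv] NU_uminus] by (metis diff_conv_add_uminus)
  have act_epath: "dual_act E idx (epath c) f x = pullback f (act_word E idx (map Edge c) x)"
    for f :: "'v \<times> nat \<times> int \<Rightarrow> 'k" and x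
    unfolding epath_def monomial_def by (simp add: dual_act_single)
  have act_a: "dual_act E idx a f (v, 0, m) = f (v, 0, m) - f (v, 0, m + ?n)"
    for f :: "'v \<times> nat \<times> int \<Rightarrow> 'k" and m
    using act_word_walk[OF c(1), of idx 0 m] idx0
    by (auto simp: a_def dual_act_diff dual_act_gens act_epath)
  define f :: "'v \<times> nat \<times> int \<Rightarrow> 'k" where "f = (\<lambda>(u, k, m). if m \<ge> 0 then 1 else 0)"
  define h where "h = dual_act E idx a f"
  \<comment> \<open>Beyond \<open>?n\<close> in absolute value, the degrees \<open>m\<close> and
    \<open>m + ?n\<close> have the same sign, so \<open>f\<close> takes the same value at
    both.\<close>
  have h_supp: "h (u, k, m) = 0" if "\<bar>m\<bar> > ?n" for u k m
  proof (cases "u = v")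
    case True
    obtain k' where "act_word E idx (map Edge c) (v, k, m) = Some (v, k', m + ?n)"
      using act_word_walk[OF c(1)] by blast
    then show ?thesis using that True n
      by (auto simp: h_def a_def dual_act_diff dual_act_gens act_epath f_def)
  next
    case False
    then show ?thesis using act_word_walk_None[OF c(1,2) False]
      by (simp add: h_def a_def dual_act_diff dual_act_gens act_epath)
  qed
  have "cl a \<in> carrier L" using a unfolding L_carrier by blast
  then obtain y where "y \<in> carrier L" "cl a = cl a \<otimes>\<^bsub>L\<^esub> y \<otimes>\<^bsub>L\<^esub> cl a"
    using reg unfolding von_neumann_regular_def by blast
  then obtain b where b: "b \<in> NU" "cl a = cl a \<otimes>\<^bsub>L\<^esub> cl b \<otimes>\<^bsub>L\<^esub> cl a" unfolding L_carrier by blast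
  then have "a \<approx> a * b * a" using a by (simp add: L_mult NU_closed cl_eq_iff)
  then have "a - a * b * a \<in> I" unfolding cong_def by blast
  define H where "H = dual_act E idx b h"
  have rec: "H (v, 0, m) - H (v, 0, m + ?n) = f (v, 0, m) - f (v, 0, m + ?n)" for m
  proof -
    have "dual_act E idx a f (v, 0, m) = dual_act E idx (a * b * a) f (v, 0, m)"
      using dual_act_I[OF rf idx(1) \<open>a - a * b * a \<in> I\<close>, of f "(v, 0, m)"]
        by (simp add: dual_act_diff)
    also have "\<dots> = dual_act E idx a H (v, 0, m)"
      unfolding dual_act_mult H_def h_def
      by (rule arg_cong[where f = "\<lambda>g. dual_act E idx a g (v, 0, m)"])
        (rule ext, simp add: dual_act_mult)
    finally show ?thesis unfolding act_a by simp
  qed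
  \<comment> \<open>A word shifts the degree by at most its length, so \<open>b\<close> enlarges a
    bounded range of degrees by at most \<open>B\<close>.\<close>
  obtain B where B: "\<And>w. w \<in> Poly_Mapping.keys b \<Longrightarrow> length (letters w) \<le> B"
    using finite_nat_set_iff_bounded_le[of "(\<lambda>w. length (letters w)) ` Poly_Mapping.keys b"] by auto
  have H_supp: "H (v, 0, m) = 0" if m: "\<bar>m\<bar> > ?n + int B" for m
    unfolding H_def dual_act_def
  proof (rule sum.neutral, rule ballI)
    fix w assume w: "w \<in> Poly_Mapping.keys b"
    have "pullback h (act_word E idx (letters w) (v, 0, m)) = 0"
    proof (cases "act_word E idx (letters w) (v, 0, m)")
      case (Some y)
      obtain u k m' where y: "y = (u, k, m')" by (cases y)
      have "\<bar>m' - m\<bar> \<le> int B"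
        using act_word_degree[of E idx "letters w" v 0 m u k m'] Some y B[OF w] by simp
      then have "\<bar>m'\<bar> > ?n" using m by linarith
      then show ?thesis using Some y h_supp by simp
    qed simp
    then show "Poly_Mapping.lookup b w * pullback h (act_word E idx (letters w) (v, 0, m)) = 0"
      by simp
  qed
  \<comment> \<open>The only jump of \<open>H\<close> along the multiples of \<open>?n\<close> lies
    between \<open>-?n\<close> and \<open>0\<close>. Hence one chain runs upwards from
    \<open>0\<close> and another downwards from \<open>-?n\<close>, both ending where
    \<open>H\<close> vanishes.\<close>
  have up: "H (v, 0, 0) = H (v, 0, int j * ?n)" for j
  proof (induction j)
    case (Suc j)
    have "H (v, 0, int j * ?n) = H (v, 0, int j * ?n + ?n)"
      using rec[of "int j * ?n"] n by (simp add: f_def)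
    then show ?case using Suc by (simp add: algebra_simps)
  qed simp
  have down: "H (v, 0, - ?n) = H (v, 0, - int (Suc j) * ?n)" for j
  proof (induction j)
    case (Suc j)
    have eq: "- int (Suc (Suc j)) * ?n + ?n = - int (Suc j) * ?n" by (simp add: algebra_simps)
    have "- int (Suc j) * ?n < 0" using n by (simp add: mult_neg_pos)
    moreover from this have "- int (Suc (Suc j)) * ?n < 0" using n eq by linarith
    ultimately have "H (v, 0, - int (Suc (Suc j)) * ?n) = H (v, 0, - int (Suc j) * ?n)"
      using rec[of "- int (Suc (Suc j)) * ?n"] unfolding eq by (simp add: f_def)
    then show ?case using Suc by simp
  qed simp
  \<comment> \<open>As \<open>?n\<close> is at least \<open>1\<close>, this many steps of length
    \<open>?n\<close> lead beyond the bound \<open>?n + int B\<close> of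
    \<open>H_supp\<close>.\<close>
  let ?j = "length c + B + 1"
  have big: "int ?j * ?n > ?n + int B"
  proof -
    define J where "J = int ?j"
    have "J * 1 \<le> J * ?n" using n unfolding J_def by (intro mult_left_mono) linarith+
    moreover have "J = ?n + int B + 1" unfolding J_def by simp
    ultimately have "J * ?n > ?n + int B" by linarith
    then show ?thesis unfolding J_def .
  qed
  have "H (v, 0, 0) = 0" using up[of ?j] H_supp[of "int ?j * ?n"] big by simp
  moreover have "H (v, 0, - ?n) = 0"
  proof -
    have "int (Suc ?j) * ?n = int ?j * ?n + ?n" by (simp add: algebra_simps)
    then have "\<bar>- int (Suc ?j) * ?n\<bar> > ?n + int B" using big n by linarith
    then show ?thesis using down[of ?j] H_supp by simp
  qed
  moreover have "H (v, 0, - ?n) - H (v, 0, 0) = - 1" using rec[of "- ?n"] n by (simp add: f_def)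
  ultimately show False by simp
qed

end

section \<open>Infinite paths\<close>

locale lpa_path = lpa E K for E :: "('v, 'e) pre_digraph" and K :: "'k::field itself" +
  fixes p :: "nat \<Rightarrow> 'e"
  assumes row_finite: "row_finite E" and acyclic: "acyclic_graph E"
    and path: "infinite_path E p" and no_sink: "\<not> ends_in_sink E p"
begin

definition vert :: "nat \<Rightarrow> 'v" where "vert i = tail E (p i)"

lemma path_arc: "p i \<in> arcs E" "head E (p i) = vert (Suc i)" "tail E (p i) = vert i"
  using path unfolding infinite_path_def vert_def by auto

lemma vert_in_verts [simp]: "vert i \<in> verts E"
  using path_arc tail_in_verts by metis

lemma awalk_segment: "i \<le> j \<Longrightarrow> awalk (vert i) (map p [i..<j]) (vert j)"
proof (induction j rule: dec_induct)
  case base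
  then show ?case by (simp add: awalk_Nil_iff)
next
  case (step j)
  have "awalk (vert j) [p j] (vert (Suc j))"
    using path_arc[of j] by (simp add: awalk_Cons_iff awalk_Nil_iff)
  then show ?case using awalk_appendI[OF step.IH] step(1) by simp
qed

lemma inj_vert: "inj vert"
proof (rule linorder_injI)
  fix i j :: nat assume "i < j"
  then show "vert i \<noteq> vert j"
    using awalk_segment[of i j] acyclic_closed_walk[OF acyclic, of "vert i" "map p [i..<j]"] by auto
qed

definition bif :: "nat set" where "bif = {i. bifurcation E (vert i)}"

text \<open>Beyond a last bifurcation every walk would be forced to follow \<open>p\<close>, so the
  tree would consist of vertices of \<open>p\<close> without bifurcations, and its root would be a
  line point.\<close>

lemma infinite_bif: "infinite bif"
proof
  assume "finite bif"
  then obtain i where i: "\<And>j. j \<in> bif \<Longrightarrow> j < i"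
    unfolding finite_nat_set_iff_bounded by auto
  have nobif: "\<not> bifurcation E (vert j)" if "j \<ge> i" for j using i[of j] that unfolding bif_def
    by auto
  have "\<exists>k \<ge> i. w = vert k" if "awalk (vert j) a w" "j \<ge> i" for j a w
    using that
  proof (induction a arbitrary: j)
    case Nil
    then show ?case by (auto simp: awalk_Nil_iff)
  next
    case (Cons e a)
    then have e: "e \<in> arcs E" "tail E e = vert j" "awalk (head E e) a w"
      by (auto simp: awalk_Cons_iff)
    then have "e = p j"
      using nobif[OF Cons.prems(2)] path_arc[of j] unfolding bifurcation_def by auto
    then show ?case using Cons.IH[of "Suc j"] e(3) path_arc(2)[of j] Cons.prems(2) by simp
  qed
  then have "tree E (vert i) \<subseteq> {vert k |k. k \<ge> i}" unfolding tree_def by blast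
  moreover have "\<not> on_cycle E w" for w using acyclic unfolding on_cycle_def acyclic_graph_def
    by blast
  ultimately have "line_point E (vert i)" using nobif unfolding line_point_def by auto
  then show False using no_sink unfolding ends_in_sink_def vert_def by blast
qed

text \<open>The edge \<open>f_i\<close> of the overview; the choice is meaningful for
  \<open>i\<close> in \<open>bif\<close> only.\<close>

definition exit :: "nat \<Rightarrow> 'e" where "exit i = (SOME e. e \<in> out_arcs E (vert i) \<and> e \<noteq> p i)"

lemma exit_arc:
  assumes "i \<in> bif"
  shows "exit i \<in> arcs E" "tail E (exit i) = vert i" "exit i \<noteq> p i"
proof -
  have "\<exists>e. e \<in> out_arcs E (vert i) \<and> e \<noteq> p i"
    using assms unfolding bif_def bifurcation_def by blast
  then have "exit i \<in> out_arcs E (vert i) \<and> exit i \<noteq> p i" unfolding exit_def by (rule someI_ex)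
  then show "exit i \<in> arcs E" "tail E (exit i) = vert i" "exit i \<noteq> p i" by auto
qed

definition exit_head :: "nat \<Rightarrow> 'v" where "exit_head i = head E (exit i)"

text \<open>The path \<open>g_i\<close> of the overview.\<close>

definition exit_walk :: "nat \<Rightarrow> 'e list" where "exit_walk i = map p [0..<i] @ [exit i]"

lemma exit_head_in_verts: "i \<in> bif \<Longrightarrow> exit_head i \<in> verts E"
  unfolding exit_head_def using exit_arc(1) head_in_verts by blast

lemma awalk_exit: "i \<in> bif \<Longrightarrow> awalk (vert i) [exit i] (exit_head i)"
  using exit_arc exit_head_in_verts by (simp add: awalk_Cons_iff awalk_Nil_iff exit_head_def)

lemma awalk_exit_head: "i \<in> bif \<Longrightarrow> awalk (exit_head i) [] (exit_head i)"
  using exit_head_in_verts by (simp add: awalk_Nil_iff)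

lemma awalk_exit_walk: "i \<in> bif \<Longrightarrow> awalk (vert 0) (exit_walk i) (exit_head i)"
  unfolding exit_walk_def using awalk_segment[of 0 i] awalk_exit by (blast intro: awalk_appendI)

text \<open>At position \<open>i\<close> the path \<open>exit_walk i\<close> has left
  \<open>p\<close>, whereas a longer \<open>exit_walk j\<close> still follows it there.\<close>

lemma exit_walk_not_prefix:
  assumes "i \<in> bif" "j \<in> bif" "i \<noteq> j"
  shows "exit_walk j \<noteq> exit_walk i @ c"
proof
  assume eq: "exit_walk j = exit_walk i @ c"
  then have "length (exit_walk i) \<le> length (exit_walk j)" by simp
  then have "i < j" using assms(3) by (simp add: exit_walk_def)
  then have "exit_walk j ! i = p i" by (simp add: exit_walk_def nth_append)
  moreover have "exit_walk j ! i = exit i" unfolding eq by (simp add: exit_walk_def nth_append)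
  ultimately show False using exit_arc(3)[OF assms(1)] by simp
qed

lemma ghost_exit_walk:
  assumes "i \<in> bif" "j \<in> bif"
  shows "vx (exit_head i) * gpath (exit_walk i) * (epath (exit_walk j) * vx (exit_head j)) \<approx>
    (if i = j then vx (exit_head i) else 0)"
  using gpath_epath_same[OF awalk_exit_walk[OF assms(1)]]
    gpath_epath_diff[OF awalk_exit_walk[OF assms(1)] awalk_exit_walk[OF assms(2)]]
    exit_walk_not_prefix[OF assms] exit_walk_not_prefix[OF assms(2,1)] by auto

text \<open>In the notation of the introduction, \<open>z\<^sub>i = g\<^sub>i f\<^sub>i*\<close>, \<open>y\<^sub>i = f\<^sub>i g\<^sub>i*\<close> and \<open>x\<^sub>i = g\<^sub>i\<close>.\<close>

definition z_elem :: "nat \<Rightarrow> ('v, 'e, 'k) lpa_free" where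
  "z_elem i = path_monomial (exit_walk i) (exit_head i) [exit i]"

definition y_elem :: "nat \<Rightarrow> ('v, 'e, 'k) lpa_free" where
  "y_elem i = path_monomial [exit i] (exit_head i) (exit_walk i)"

definition x_elem :: "nat \<Rightarrow> ('v, 'e, 'k) lpa_free" where
  "x_elem i = path_monomial (exit_walk i) (exit_head i) []"

lemma elems_NU: "i \<in> bif \<Longrightarrow> z_elem i \<in> NU" "i \<in> bif \<Longrightarrow> y_elem i \<in> NU" "i \<in> bif \<Longrightarrow> x_elem i \<in> NU"
  unfolding z_elem_def y_elem_def x_elem_def using NU_path_monomial awalk_exit awalk_exit_walk awalk_exit_head by blast+

lemma elems_closed [simp]:
  "i \<in> bif \<Longrightarrow> z_elem i \<in> carrier F" "i \<in> bif \<Longrightarrow> y_elem i \<in> carrier F" "i \<in> bif \<Longrightarrow> x_elem i \<in> carrier F"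
  "i \<in> bif \<Longrightarrow> vx (exit_head i) \<in> carrier F" "i \<in> bif \<Longrightarrow> ed (exit i) \<in> carrier F" "i \<in> bif \<Longrightarrow> gh (exit i) \<in> carrier F"
  "i \<in> bif \<Longrightarrow> epath (exit_walk i) \<in> carrier F" "i \<in> bif \<Longrightarrow> gpath (exit_walk i) \<in> carrier F"
  using elems_NU NU_closed exit_head_in_verts exit_arc awalkD(1)[OF awalk_exit_walk] by simp_all

lemma ghost_z_elem:
  assumes "i \<in> bif" "j \<in> bif"
  shows "vx (exit_head i) * gpath (exit_walk i) * z_elem j \<approx>
    (if i = j then vx (exit_head i) * gh (exit i) else 0)"
proof -
  have "vx (exit_head i) * gpath (exit_walk i) * (epath (exit_walk j) * vx (exit_head j)) * gh (exit j) \<approx>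
      (if i = j then vx (exit_head i) else 0) * gh (exit j)"
    using assms by (intro cong_right ghost_exit_walk) simp_all
  then show ?thesis
    by (simp add: z_elem_def path_monomial_def gpath_simps mult.assoc split: if_splits)
qed

lemma y_elem_x_elem:
  assumes "i \<in> bif" "j \<in> bif"
  shows "y_elem i * x_elem j \<approx> (if i = j then ed (exit i) else 0)"
proof -
  have "ed (exit i) * (vx (exit_head i) * gpath (exit_walk i) * (epath (exit_walk j) * vx (exit_head j))) \<approx>
      ed (exit i) * (if i = j then vx (exit_head i) else 0)"
    using assms by (intro cong_left ghost_exit_walk) simp_all
  also have "\<dots> \<approx> (if i = j then ed (exit i) else 0)"
    using ed_head[OF exit_arc(1)[OF assms(1)]] by (cases "i = j") (auto simp: exit_head_def)
  finally show ?thesis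
    by (simp add: y_elem_def x_elem_def path_monomial_def gpath_simps epath_simps mult.assoc)
qed

lemma vert0_z_elem: "i \<in> bif \<Longrightarrow> vx (vert 0) * z_elem i \<approx> z_elem i"
  unfolding z_elem_def by (rule vx_path_monomial(1)[OF awalk_exit_walk awalk_exit])

lemma vert0_x_elem: "i \<in> bif \<Longrightarrow> vx (vert 0) * x_elem i \<approx> x_elem i"
  unfolding x_elem_def by (rule vx_path_monomial(1)[OF awalk_exit_walk awalk_exit_head])

lemma z_elem_vert: "i \<in> bif \<Longrightarrow> z_elem i * vx (vert i) \<approx> z_elem i"
  unfolding z_elem_def by (rule vx_path_monomial(2)[OF awalk_exit_walk awalk_exit])

text \<open>Both reduce to \<open>vx_nonzero\<close> at the head of the edge, since
  \<open>e* e\<close> is that vertex.\<close>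

lemma not_zero:
  assumes "i \<in> bif"
  shows "\<not> ed (exit i) \<approx> 0" "\<not> vx (exit_head i) * gh (exit i) \<approx> 0"
proof -
  note arc = exit_arc(1)[OF assms]
  have nz: "\<not> vx (exit_head i) \<approx> 0" by (rule vx_nonzero[OF row_finite exit_head_in_verts[OF assms]])
  have gf: "gh (exit i) * ed (exit i) \<approx> vx (exit_head i)"
    using gh_ed_same[OF arc] by (simp add: exit_head_def)
  show "\<not> ed (exit i) \<approx> 0"
  proof
    assume "ed (exit i) \<approx> 0"
    then have "gh (exit i) * ed (exit i) \<approx> gh (exit i) * 0" using arc by (intro cong_left) simp_all
    then have "vx (exit_head i) \<approx> 0" using cong_trans[OF cong_sym[OF gf]] by simp
    then show False using nz by blast
  qed
  show "\<not> vx (exit_head i) * gh (exit i) \<approx> 0"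
  proof
    assume 0: "vx (exit_head i) * gh (exit i) \<approx> 0"
    have "vx (exit_head i) \<approx> gh (exit i) * ed (exit i)" by (rule cong_sym[OF gf])
    also have "\<dots> \<approx> vx (exit_head i) * gh (exit i) * ed (exit i)"
      using cong_sym[OF head_gh[OF arc]] arc by (intro cong_right) (simp_all add: exit_head_def)
    also have "\<dots> \<approx> 0 * ed (exit i)" using arc by (intro cong_right 0) simp
    finally show False using nz by simp
  qed
qed

text \<open>Let \<open>\<phi>\<close> be the infinite sum of the \<open>z_i\<close>, so
  \<open>\<phi>(v_j) = z_j\<close>. From \<open>\<phi> = \<phi> \<psi> \<phi>\<close> follows
  \<open>z_j = \<phi>(\<psi>(z_j)) = \<phi>(c) z_j\<close> with \<open>c = \<psi>(v_0)\<close>. But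
  \<open>\<phi>(c)\<close> is reached by a finite partial sum, which \<open>g_j*\<close> annihilates
  for large \<open>j\<close>, while \<open>g_j* z_j = f_j*\<close> is nonzero.\<close>

lemma not_endo_regular: "\<not> von_neumann_regular (endo_ring (opp_ring L) (right_regular_module L))"
proof
  interpret L: nonunital_ring L by (rule nonunital_ring_L)
  assume reg: "von_neumann_regular (endo_ring (opp_ring L) (right_regular_module L))"
  define s where "s n = (\<Sum>i | i \<in> bif \<and> i < n. z_elem i)" for n
  have s: "s n \<in> NU" for n unfolding s_def by (intro NU_sum) (simp add: elems_NU)
  have sL: "cl (s n) \<in> carrier L" for n using s unfolding L_carrier by blast
  define S where "S n = cl (s n)" for n
  \<comment> \<open>Since \<open>z_i = z_i v_i\<close> and the \<open>v_i\<close> are distinct, all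
    but finitely many terms annihilate \<open>a\<close>; so the limit is defined on all of
    \<open>L\<close>.\<close>
  have stable: "a \<in> L.stable S" if a: "a \<in> carrier L" for a
  proof -
    obtain q where q: "q \<in> NU" "a = cl q" using a unfolding L_carrier by blast
    obtain V where V: "finite V" "\<And>u. u \<in> verts E - V \<Longrightarrow> vx u * q \<approx> 0"
      using almost_all_vertices_annihilate[OF q(1)] by blast
    have "finite (vert -` V)" using V(1) inj_vert by (rule finite_vimageI)
    then obtain N where N: "\<And>i. vert i \<in> V \<Longrightarrow> i < N"
      unfolding finite_nat_set_iff_bounded by auto
    note [simp] = NU_closed[OF q(1)]
    have zq: "z_elem i * q \<approx> 0" if "i \<in> bif" "i \<ge> N" for i
    proof -
      have "z_elem i * q \<approx> z_elem i * vx (vert i) * q"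
        using that by (intro cong_right cong_sym[OF z_elem_vert]) simp_all
      also have "\<dots> = z_elem i * (vx (vert i) * q)" by (simp add: mult.assoc)
      also have "\<dots> \<approx> z_elem i * 0" using N[of i] that by (intro cong_left V) auto
      finally show ?thesis by simp
    qed
    have "S n \<otimes>\<^bsub>L\<^esub> a = S N \<otimes>\<^bsub>L\<^esub> a" if n: "n \<ge> N" for n
    proof -
      have "s n * q = (\<Sum>i | i \<in> bif \<and> i < n. z_elem i * q)" by (simp add: s_def sum_distrib_right)
      also have "\<dots> \<approx> (\<Sum>i | i \<in> bif \<and> i < n. if i < N then z_elem i * q else 0)"
        using zq by (intro cong_sum) auto
      also have "\<dots> = (\<Sum>i | i \<in> bif \<and> i < N. z_elem i * q)"
        using n by (intro sum.mono_neutral_cong_right) auto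
      also have "\<dots> = s N * q" by (simp add: s_def sum_distrib_right)
      finally have "s n * q \<approx> s N * q" .
      then show ?thesis by (simp add: S_def q(2) L_mult NU_closed s cl_eq_iff)
    qed
    then show ?thesis using a unfolding L.stable_def eventually_sequentially by blast
  qed
  then have st: "L.stable S = carrier L" unfolding L.stable_def by blast
  define \<phi> where "\<phi> = restrict (L.stable_value S) (carrier L)"
  have SL: "S n \<in> carrier L" for n using sL unfolding S_def .
  have M: "right_regular_module L = L.right_module" by (simp add: right_regular_module_def)
  have car: "L.right_module\<lparr>carrier := carrier L\<rparr> = L.right_module"
    by (simp add: regular_module_def opp_ring_def)
  have "\<phi> \<in> mod_homs (opp_ring L) L.right_module L.right_module"
    using L.stable_value_hom[of S, OF SL] unfolding \<phi>_def st car by simp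
  then obtain \<psi> where \<psi>: "\<psi> \<in> mod_homs (opp_ring L) L.right_module L.right_module"
    "\<phi> = compose (carrier L) (compose (carrier L) \<phi> \<psi>) \<phi>"
    using reg unfolding M von_neumann_regular_def endo_ring_def by (auto simp: L.right_module_simps)
  have \<psi>c: "\<psi> a \<in> carrier L" if "a \<in> carrier L" for a
    using mod_homsD(2)[OF \<psi>(1), of a] that by (simp add: L.right_module_simps)
  have \<psi>m: "\<psi> (a \<otimes>\<^bsub>L\<^esub> b) = \<psi> a \<otimes>\<^bsub>L\<^esub> b" if "a \<in> carrier L" "b \<in> carrier L" for a b
    using mod_homsD(4)[OF \<psi>(1), of b a] that by (simp add: L.right_module_simps)
  have vL: "cl (vx (vert i)) \<in> carrier L" for i using NU_vx[OF vert_in_verts] unfolding L_carrier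
    by blast
  have zL: "cl (z_elem i) \<in> carrier L" if "i \<in> bif" for i using elems_NU(1)[OF that] unfolding L_carrier by blast
  have \<phi>vert: "\<phi> (cl (vx (vert j))) = cl (z_elem j)" if j: "j \<in> bif" for j
  proof -
    have "S n \<otimes>\<^bsub>L\<^esub> cl (vx (vert j)) = cl (z_elem j)" if n: "n \<ge> Suc j" for n
    proof -
      have zv: "z_elem i * vx (vert j) \<approx> (if i = j then z_elem i else 0)" if "i \<in> bif" for i
      proof (cases "i = j")
        case False
        then have "vert i \<noteq> vert j" using inj_vert by (simp add: inj_eq)
        have "z_elem i * vx (vert j) \<approx> z_elem i * vx (vert i) * vx (vert j)"
          using that by (intro cong_right cong_sym[OF z_elem_vert]) simp_all
        also have "\<dots> = z_elem i * (vx (vert i) * vx (vert j))" by (simp add: mult.assoc)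
        also have "\<dots> \<approx> z_elem i * 0"
          using \<open>vert i \<noteq> vert j\<close> that by (intro cong_left vx_orth) simp_all
        finally show ?thesis using False by simp
      qed (use z_elem_vert[OF j] in simp)
      have "s n * vx (vert j) = (\<Sum>i | i \<in> bif \<and> i < n. z_elem i * vx (vert j))"
        by (simp add: s_def sum_distrib_right)
      also have "\<dots> \<approx> (\<Sum>i | i \<in> bif \<and> i < n. if i = j then z_elem i else 0)"
        using zv by (intro cong_sum) auto
      also have "\<dots> = z_elem j" using j n by (subst sum.delta) auto
      finally show ?thesis using j by (simp add: S_def L_mult NU_closed s cl_eq_iff)
    qed
    then have "L.stable_value S (cl (vx (vert j))) = cl (z_elem j)"
      by (intro L.stable_value_eq) (auto simp: eventually_sequentially)
    then show ?thesis using vL by (simp add: \<phi>_def)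
  qed
  \<comment> \<open>By right linearity and \<open>z_j = v_0 z_j\<close>, the one element
    \<open>c\<close> determines \<open>\<psi>\<close> at every \<open>z_elem j\<close>;
    \<open>N\<close> is a stage at which the partial sums have stabilised on
    \<open>c\<close>.\<close>
  define c where "c = \<psi> (cl (vx (vert 0)))"
  have c: "c \<in> carrier L" unfolding c_def by (rule \<psi>c[OF vL])
  obtain N where N: "L.stable_value S c = S N \<otimes>\<^bsub>L\<^esub> c"
    using L.stable_value_obtain[of c S] st c by (metis order_refl)
  have key: "cl (z_elem j) = (S N \<otimes>\<^bsub>L\<^esub> c) \<otimes>\<^bsub>L\<^esub> cl (z_elem j)" if j: "j \<in> bif" for j
  proof -
    have "cl (z_elem j) = cl (vx (vert 0)) \<otimes>\<^bsub>L\<^esub> cl (z_elem j)"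
      using j vert0_z_elem[OF j, THEN cong_sym] by (simp add: L_mult cl_eq_iff)
    then have \<psi>z_elem: "\<psi> (cl (z_elem j)) = c \<otimes>\<^bsub>L\<^esub> cl (z_elem j)"
      using \<psi>m[OF vL zL[OF j], of 0] unfolding c_def by simp
    have "cl (z_elem j) = compose (carrier L) (compose (carrier L) \<phi> \<psi>) \<phi> (cl (vx (vert j)))"
      using \<phi>vert[OF j] \<psi>(2) by metis
    also have "\<dots> = \<phi> (c \<otimes>\<^bsub>L\<^esub> cl (z_elem j))"
      using \<phi>vert[OF j] vL zL[OF j] \<psi>z_elem by (simp add: compose_def)
    also have "\<dots> = (S N \<otimes>\<^bsub>L\<^esub> c) \<otimes>\<^bsub>L\<^esub> cl (z_elem j)"
      using L.stable_operations(4)[of S, OF SL, of c "cl (z_elem j)"] c zL[OF j] N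
      by (simp add: \<phi>_def st L.mult_closed)
    finally show ?thesis .
  qed
  obtain j where j: "j \<in> bif" "j \<ge> N"
    using infinite_bif by (meson infinite_nat_iff_unbounded_le)
  \<comment> \<open>\<open>?G\<close> is \<open>g_j*\<close>. The sum \<open>s N\<close> has only
    terms with \<open>i < N\<close>, and \<open>N \<le> j\<close>, so \<open>?G\<close> annihilates
    all of them.\<close>
  let ?G = "vx (exit_head j) * gpath (exit_walk j) :: ('v, 'e, 'k) lpa_free"
  have G: "?G \<in> NU" using j by (intro NU_mult(1) NU_vx exit_head_in_verts) simp_all
  then have GL: "cl ?G \<in> carrier L" unfolding L_carrier by blast
  have "?G * s N = (\<Sum>i | i \<in> bif \<and> i < N. ?G * z_elem i)" by (simp add: s_def sum_distrib_left)
  also have "\<dots> \<approx> (\<Sum>i | i \<in> bif \<and> i < N. 0)"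
    using ghost_z_elem[OF j(1)] j(2) by (intro cong_sum) fastforce
  finally have "cl ?G \<otimes>\<^bsub>L\<^esub> S N = \<zero>\<^bsub>L\<^esub>"
    using G by (simp add: S_def L_mult L_zero NU_closed s cl_eq_iff)
  then have "cl ?G \<otimes>\<^bsub>L\<^esub> cl (z_elem j) = \<zero>\<^bsub>L\<^esub>"
    using key[OF j(1)] GL SL c zL[OF j(1)]
    by (metis L.mult_assoc L.mult_closed L.mult_zero_minus(2))
  then have "?G * z_elem j \<approx> 0"
    using G j by (simp add: L_mult L_zero NU_closed cl_eq_iff)
  then show False
    using cong_trans[OF cong_sym[OF ghost_z_elem[OF j(1) j(1)]]] not_zero(2)[OF j(1)] by simp
qed

text \<open>The limit of the partial sums of the \<open>y_i\<close> is defined at every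
  \<open>g_j\<close>, with value \<open>f_j\<close>. An extension to \<open>L\<close> with
  \<open>q\<close> as its value at \<open>v_0\<close> satisfies \<open>q g_j = f_j\<close> for all
  \<open>j\<close> in \<open>bif\<close>, because \<open>g_j = v_0 g_j\<close>. Then
  \<open>v_j q\<close> is nonzero for infinitely many distinct vertices \<open>v_j\<close>, which is
  impossible.\<close>

lemma not_right_self_injective: "\<not> right_self_injective TYPE('m) L"
proof
  interpret L: nonunital_ring L by (rule nonunital_ring_L)
  assume "right_self_injective TYPE('m) L"
  then have inj: "injective_module TYPE('m) (opp_ring L) L.right_module"
    unfolding right_self_injective_def right_regular_module_def .
  define t where "t n = (\<Sum>i | i \<in> bif \<and> i < n. y_elem i)" for n
  have t: "t n \<in> NU" for n unfolding t_def by (intro NU_sum) (simp add: elems_NU)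
  define T where "T n = cl (t n)" for n
  have TL: "T n \<in> carrier L" for n using t unfolding T_def L_carrier by blast
  have xL: "cl (x_elem j) \<in> carrier L" if "j \<in> bif" for j using elems_NU(3)[OF that] unfolding L_carrier by blast
  have Tx: "\<forall>\<^sub>F n in sequentially. T n \<otimes>\<^bsub>L\<^esub> cl (x_elem j) = cl (ed (exit j))" if j: "j \<in> bif" for j
    unfolding eventually_sequentially
  proof (intro exI[of _ "Suc j"] allI impI)
    fix n assume n: "Suc j \<le> n"
    have "t n * x_elem j = (\<Sum>i | i \<in> bif \<and> i < n. y_elem i * x_elem j)"
      by (simp add: t_def sum_distrib_right)
    also have "\<dots> \<approx> (\<Sum>i | i \<in> bif \<and> i < n. if i = j then ed (exit i) else 0)"
      using y_elem_x_elem j by (intro cong_sum) auto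
    also have "\<dots> = ed (exit j)" using j n by (subst sum.delta) auto
    finally show "T n \<otimes>\<^bsub>L\<^esub> cl (x_elem j) = cl (ed (exit j))"
      using j by (simp add: T_def L_mult NU_closed t cl_eq_iff)
  qed
  have xst: "cl (x_elem j) \<in> L.stable T" if "j \<in> bif" for j
    using Tx[OF that] xL[OF that] unfolding L.stable_def by blast
  have "\<exists>\<theta> \<in> mod_homs (opp_ring L) L.right_module L.right_module.
      \<forall>a \<in> L.stable T. \<theta> a = restrict (L.stable_value T) (L.stable T) a"
  proof (rule injective_module_extend[OF inj L.nonunital_right_module L.stable_submodule[of T, OF TL]
        L.stable_value_hom[of T, OF TL]])
    \<comment> \<open>A local unit writes \<open>a\<close> as \<open>a u\<close>, which makes the
      domain a unitary module.\<close>
    fix a assume a: "a \<in> L.stable T"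
    then have "a \<in> carrier L" unfolding L.stable_def by blast
    then show "\<exists>b\<in>carrier (opp_ring L). \<exists>w\<in>L.stable T. a = b \<odot>\<^bsub>L.right_module\<^esub> w"
      using L_local_units[of a] a by (metis L.right_module_simps(4,6))
  next
    fix a assume "a \<in> carrier L.right_module"
    then have "a \<in> carrier L" by (simp add: L.right_module_simps)
    then show "\<exists>b\<in>carrier (opp_ring L). \<exists>w\<in>carrier L.right_module. a = b \<odot>\<^bsub>L.right_module\<^esub> w"
      using L_local_units[of a] by (metis L.right_module_simps(1,4,6))
  qed
  then obtain \<theta> where \<theta>: "\<theta> \<in> mod_homs (opp_ring L) L.right_module L.right_module"
    "\<And>a. a \<in> L.stable T \<Longrightarrow> \<theta> a = L.stable_value T a" by auto
  have vL: "cl (vx (vert 0)) \<in> carrier L" using NU_vx[OF vert_in_verts] unfolding L_carrier by blast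
  have "\<theta> (cl (vx (vert 0))) \<in> carrier L"
    using mod_homsD(2)[OF \<theta>(1), of "cl (vx (vert 0))"] vL by (simp add: L.right_module_simps)
  then obtain q where q: "q \<in> NU" "\<theta> (cl (vx (vert 0))) = cl q" unfolding L_carrier by blast
  note [simp] = NU_closed[OF q(1)]
  have key: "q * x_elem j \<approx> ed (exit j)" if j: "j \<in> bif" for j
  proof -
    have "cl (x_elem j) = cl (vx (vert 0)) \<otimes>\<^bsub>L\<^esub> cl (x_elem j)"
      using j vert0_x_elem[OF j, THEN cong_sym] by (simp add: L_mult cl_eq_iff)
    then have "\<theta> (cl (x_elem j)) = cl q \<otimes>\<^bsub>L\<^esub> cl (x_elem j)"
      using mod_homsD(4)[OF \<theta>(1), of "cl (x_elem j)" "cl (vx (vert 0))"] vL xL[OF j] q(2)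
      by (simp add: L.right_module_simps)
    moreover have "\<theta> (cl (x_elem j)) = cl (ed (exit j))"
      using \<theta>(2)[OF xst[OF j]] L.stable_value_eq[OF Tx[OF j]] by simp
    ultimately show ?thesis using j by (simp add: L_mult cl_eq_iff cong_sym)
  qed
  obtain V where V: "finite V" "\<And>u. u \<in> verts E - V \<Longrightarrow> vx u * q \<approx> 0"
    using almost_all_vertices_annihilate[OF q(1)] by blast
  have "finite (vert -` V)" using V(1) inj_vert by (rule finite_vimageI)
  then have "\<not> bif \<subseteq> vert -` V" using infinite_bif finite_subset by blast
  then obtain j where j: "j \<in> bif" "vert j \<notin> V" by blast
  have "ed (exit j) \<approx> vx (vert j) * ed (exit j)"
    using tail_ed[OF exit_arc(1)[OF j(1)]] exit_arc(2)[OF j(1)] by (simp add: cong_sym)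
  also have "\<dots> \<approx> vx (vert j) * (q * x_elem j)" by (intro cong_left cong_sym[OF key[OF j(1)]]) simp
  also have "\<dots> = vx (vert j) * q * x_elem j" by (simp add: mult.assoc)
  also have "\<dots> \<approx> 0 * x_elem j" using j by (intro cong_right V(2)) simp_all
  finally show False using not_zero(1)[OF j(1)] by simp
qed

end

section \<open>From the endomorphism ring to \<open>L\<close>, and the equivalences\<close>

lemma (in nonunital_ring) von_neumann_regular_opp:
  assumes "von_neumann_regular (opp_ring R)"
  shows "von_neumann_regular R"
  unfolding von_neumann_regular_def
proof
  fix a assume "a \<in> carrier R"
  then obtain b where "b \<in> carrier R" "a = a \<otimes> (b \<otimes> a)"
    using assms unfolding von_neumann_regular_def by (auto simp: opp_ring_def)
  then show "\<exists>b\<in>carrier R. a = a \<otimes> b \<otimes> a" using \<open>a \<in> carrier R\<close> mult_assoc by metis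
qed

context lpa
begin

lemma right_local_units: "x \<in> carrier (opp_ring L) \<Longrightarrow>
    \<exists>u \<in> carrier (opp_ring L). u \<otimes>\<^bsub>opp_ring L\<^esub> x = x \<and> x \<otimes>\<^bsub>opp_ring L\<^esub> u = x"
  using L_local_units[of x] by (auto simp: opp_ring_def)

lemma regular_if_endo_regular:
  assumes "von_neumann_regular (endo_ring (opp_ring L) (right_regular_module L))"
  shows "von_neumann_regular L"
  using nonunital_ring.von_neumann_regular_if_endo_ring[OF nonunital_ring.nonunital_ring_opp[OF nonunital_ring_L]]
    right_local_units assms nonunital_ring.von_neumann_regular_opp[OF nonunital_ring_L]
  unfolding right_regular_module_def by blast

text \<open>The condition \<open>ii\<close> implies semisimplicity, which implies regularity of
  \<open>A\<close>, which implies \<open>ii\<close>. In the third condition, regularity of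
  \<open>L\<close> yields acyclicity and right self-injectivity the statement on infinite paths;
  conversely, regularity of \<open>L\<close> is obtained from that of \<open>A\<close>.\<close>

lemma lpa_equivalences:
  assumes rf: "row_finite E"
  defines "ii \<equiv> acyclic_graph E \<and> (\<forall>p. infinite_path E p \<longrightarrow> ends_in_sink E p)"
  shows "von_neumann_regular (endo_ring (opp_ring L) (right_regular_module L)) \<longleftrightarrow> ii"
    and "ii \<longleftrightarrow> left_self_injective TYPE('m) L \<and> right_self_injective TYPE('m) L \<and> von_neumann_regular L"
    and "semisimple_module (opp_ring L) (right_regular_module L) \<longleftrightarrow> ii"
proof -
  interpret L: nonunital_ring L by (rule nonunital_ring_L)
  let ?A = "endo_ring (opp_ring L) (right_regular_module L)"
  let ?ss = "semisimple_module (opp_ring L) (right_regular_module L)"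
  have uR: "unitary_module (opp_ring L) (right_regular_module L)"
    unfolding right_regular_module_def
    using nonunital_ring.unitary_regular_module[OF L.nonunital_ring_opp] right_local_units by blast
  have uL: "unitary_module L (left_regular_module L)"
    unfolding left_regular_module_def using L.unitary_regular_module L_local_units by blast
  have ss_A: "von_neumann_regular ?A" if ?ss
    using semisimple_endo_ring_von_neumann_regular[OF _ that] uR unfolding unitary_module_def
      by blast
  have path: "lpa_path E p" if "acyclic_graph E" "infinite_path E p" "\<not> ends_in_sink E p" for p
    using rf that by unfold_locales
  have A_ii: ii if A: "von_neumann_regular ?A"
  proof -
    have "acyclic_graph E"
      using von_neumann_regular_imp_acyclic[OF rf regular_if_endo_regular[OF A]] .
    then show ?thesis unfolding ii_def using path lpa_path.not_endo_regular A by blast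
  qed
  have iii_ii: ii if "right_self_injective TYPE('m) L" "von_neumann_regular L"
  proof -
    have "acyclic_graph E" using von_neumann_regular_imp_acyclic[OF rf that(2)] .
    then show ?thesis unfolding ii_def using path lpa_path.not_right_self_injective that(1) by blast
  qed
  have atomic: "atomic_ring L (cl ` line_idempotents)" "atomic_ring (opp_ring L) (cl ` line_idempotents)"
    if ii
    using atomic_rings all_line_expansion[OF rf] that unfolding ii_def by blast+
  have ii_ss: ?ss if ii
    by (rule atomic_ring.semisimple_if_unitary[OF atomic(2)[OF that] uR])
  have ii_iii: "left_self_injective TYPE('m) L \<and> right_self_injective TYPE('m) L" if ii
    unfolding left_self_injective_def right_self_injective_def
    using atomic_ring.injective_if_unitary[OF atomic(1)[OF that] uL]
      atomic_ring.injective_if_unitary[OF atomic(2)[OF that] uR] by blast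
  show "von_neumann_regular ?A \<longleftrightarrow> ii" using A_ii ii_ss ss_A by blast
  show "ii \<longleftrightarrow> left_self_injective TYPE('m) L \<and> right_self_injective TYPE('m) L \<and> von_neumann_regular L"
    using iii_ii ii_iii ii_ss ss_A regular_if_endo_regular by blast
  show "?ss \<longleftrightarrow> ii" using A_ii ii_ss ss_A by blast
qed

end

theorem theorem3p5:
  fixes E :: "('v, 'e) pre_digraph"
    and L :: "('v, 'e, 'k::field) lpa_elem ring"
    and A :: "(('v, 'e, 'k) lpa_elem \<Rightarrow> ('v, 'e, 'k) lpa_elem) ring"
  assumes "wf_digraph E"
    and "row_finite E"
    and "L = leavitt_path_algebra E"
    and "A = endo_ring (opp_ring L) (right_regular_module L)"
  shows "(von_neumann_regular A \<longleftrightarrow>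
            acyclic_graph E \<and> (\<forall>p. infinite_path E p \<longrightarrow> ends_in_sink E p))
       \<and> (acyclic_graph E \<and> (\<forall>p. infinite_path E p \<longrightarrow> ends_in_sink E p) \<longleftrightarrow>
            left_self_injective TYPE('m) L \<and> right_self_injective TYPE('m) L \<and>
            von_neumann_regular L)
       \<and> (left_self_injective TYPE('m) L \<and> right_self_injective TYPE('m) L \<and>
            von_neumann_regular L \<longleftrightarrow>
            semisimple_module (opp_ring L) (right_regular_module L))"
proof -
  have "lpa E" using assms(1) by (rule lpa.intro)
  note eqs = lpa.lpa_equivalences[OF this assms(2)]
  show ?thesis
    unfolding assms(3,4) using eqs(1,3)[where 'k = 'k] eqs(2)[where 'k = 'k and 'm = 'm] by blast
qed

end
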